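(* Suppose $n\ge3$ and $\mathbf{char}(q)=\ell\ge3$, let $m\ge1$ be an integer, $N=n(m\ell-1)$ and $0\le s\le N$. Then $\mathcal A_q^{(s)}(n,\mathbf m)$ is a rigid $\mathfrak u_q(\mathfrak{sl}_n)$-module, and its Loewy length equals $E(s)-E(s)_0+1$.
   Context: $k$ is an algebraically closed field of characteristic $0$ and $q\in k^*$, $q\ne\pm1$. $[a]=\frac{q^a-q^{-a}}{q-q^{-1}}$ for $a\in\mathbb Z$; $\mathbf{char}(q)$ is the smallest positive integer $\ell$ with $[\ell]=0$ (so $q$ is either a primitive $2\ell$-th root of unity, or $\ell$ is odd and $q$ is a primitive $\ell$-th root of unity). $U_q(\mathfrak{sl}_n)$ is the usual quantum group with generators $e_i,f_i,K_i^{\pm1}$ ($1\le i\le n-1$), and $\mathfrak u_q(\mathfrak{sl}_n)=U_q(\mathfrak{sl}_n)/(e_i^\ell,f_i^\ell,K_i^{2\ell}-1)$. $\mathcal A_q(n)$ is the $k$-vector space with basis $\{x^{(\alpha)}\mid\alpha\in\mathbb Z_+^n\}$ ($\mathbb Z_+$ = nonnegative integers), with $\mathfrak u_q(\mathfrak{sl}_n)$-action (where $x^{(\beta)}:=0$ if $\beta\notin\mathbb Z_+^n$, and $\varepsilon_i$ is the $i$-th unit vector) $$e_i.x^{(\beta)}=[\beta_i+1]x^{(\beta+\varepsilon_i-\varepsilon_{i+1})},\quad f_i.x^{(\beta)}=[\beta_{i+1}+1]x^{(\beta-\varepsilon_i+\varepsilon_{i+1})},\quad K_i^{\pm1}.x^{(\beta)}=q^{\pm(\beta_i-\beta_{i+1})}x^{(\beta)}.$$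 For an integer $m\ge1$, $\mathbf m=(m\ell-1,\dots,m\ell-1)\in\mathbb Z_+^n$; $\mathbb Z_+^n(s,\mathbf m)=\{\alpha\in\mathbb Z_+^n\mid\sum_i\alpha_i=s,\ \alpha_i\le m\ell-1\ \forall i\}$ and $\mathcal A_q^{(s)}(n,\mathbf m)=\mathrm{span}_k\{x^{(\alpha)}\mid\alpha\in\mathbb Z_+^n(s,\mathbf m)\}$, a submodule of $\mathcal A_q(n)$. Energy degree: $\mathrm{Edeg}\,x^{(\alpha)}=\sum_i\lfloor\alpha_i/\ell\rfloor$. $E(s)_0$ (resp. $E(s)$) is the minimum (resp. maximum) of $\mathrm{Edeg}\,x^{(\alpha)}$ over $\alpha\in\mathbb Z_+^n(s,\mathbf m)$. The Loewy length $r$ of a finite-dimensional module $M$ is the common length of its socle and radical filtrations (the minimal length of a filtration with semisimple quotients). $M$ is rigid if its socle filtration and radical filtration coincide, i.e. $\mathrm{Rad}^{r-k}M=\mathrm{Soc}^kM$ for $0\le k\le r$, where $\mathrm{Soc}^0M=0$, $\mathrm{Soc}^{k+1}M/\mathrm{Soc}^kM=\mathrm{Soc}(M/\mathrm{Soc}^kM)$, $\mathrm{Rad}^0M=M$, $\mathrm{Rad}^{k+1}M=\mathrm{Rad}(\mathrm{Rad}^kM)$. *)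

theory Defs
  imports
    "HOL-Library.Poly_Mapping"
    "HOL-Computational_Algebra.Polynomial"
    "HOL-Algebra.Module"
    "HOL-Algebra.QuotRing"
begin

section \<open>Modules over a noncommutative ring\<close>

text \<open>The locale \<open>module\<close> of the library requires a commutative ring of scalars; the record type
  and the locale \<open>submodule\<close> do not.\<close>

locale left_module = R?: ring R + M?: abelian_group M for R (structure) and M (structure) +
  assumes smult_closed [simp, intro]:
      "\<lbrakk>a \<in> carrier R; x \<in> carrier M\<rbrakk> \<Longrightarrow> a \<odot>\<^bsub>M\<^esub> x \<in> carrier M"
    and smult_l_distr:
      "\<lbrakk>a \<in> carrier R; b \<in> carrier R; x \<in> carrier M\<rbrakk> \<Longrightarrow>
        (a \<oplus> b) \<odot>\<^bsub>M\<^esub> x = a \<odot>\<^bsub>M\<^esub> x \<oplus>\<^bsub>M\<^esub> b \<odot>\<^bsub>M\<^esub> x"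
    and smult_r_distr:
      "\<lbrakk>a \<in> carrier R; x \<in> carrier M; y \<in> carrier M\<rbrakk> \<Longrightarrow>
        a \<odot>\<^bsub>M\<^esub> (x \<oplus>\<^bsub>M\<^esub> y) = a \<odot>\<^bsub>M\<^esub> x \<oplus>\<^bsub>M\<^esub> a \<odot>\<^bsub>M\<^esub> y"
    and smult_assoc1:
      "\<lbrakk>a \<in> carrier R; b \<in> carrier R; x \<in> carrier M\<rbrakk> \<Longrightarrow>
        (a \<otimes> b) \<odot>\<^bsub>M\<^esub> x = a \<odot>\<^bsub>M\<^esub> (b \<odot>\<^bsub>M\<^esub> x)"
    and smult_one [simp]:
      "x \<in> carrier M \<Longrightarrow> \<one> \<odot>\<^bsub>M\<^esub> x = x"

definition simple_submodule ::
  "'a set \<Rightarrow> ('r, 'c) ring_scheme \<Rightarrow> ('r, 'a, 'd) module_scheme \<Rightarrow> bool" where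
  "simple_submodule S R M \<longleftrightarrow> submodule S R M \<and> S \<noteq> {\<zero>\<^bsub>M\<^esub>} \<and>
     (\<forall>H. submodule H R M \<longrightarrow> H \<subseteq> S \<longrightarrow> H = {\<zero>\<^bsub>M\<^esub>} \<or> H = S)"

definition maximal_submodule ::
  "'a set \<Rightarrow> ('r, 'c) ring_scheme \<Rightarrow> ('r, 'a, 'd) module_scheme \<Rightarrow> bool" where
  "maximal_submodule L R M \<longleftrightarrow> submodule L R M \<and> L \<noteq> carrier M \<and>
     (\<forall>H. submodule H R M \<longrightarrow> L \<subseteq> H \<longrightarrow> H = L \<or> H = carrier M)"

text \<open>The sum of all simple submodules, i.e. the smallest submodule containing each of them.\<close>

definition Soc :: "('r, 'c) ring_scheme \<Rightarrow> ('r, 'a, 'd) module_scheme \<Rightarrow> 'a set" where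
  "Soc R M = \<Inter> {H. submodule H R M \<and> (\<forall>S. simple_submodule S R M \<longrightarrow> S \<subseteq> H)}"

definition Rad :: "('r, 'c) ring_scheme \<Rightarrow> ('r, 'a, 'd) module_scheme \<Rightarrow> 'a set" where
  "Rad R M = carrier M \<inter> \<Inter> {L. maximal_submodule L R M}"

text \<open>The fields \<open>mult\<close> and \<open>one\<close>, which the record type inherits from rings, play no role in
  modules.\<close>

definition quotient_module :: "('r, 'a, 'd) module_scheme \<Rightarrow> 'a set \<Rightarrow> ('r, 'a set) module" where
  "quotient_module M N =
     \<lparr>carrier = a_rcosets\<^bsub>M\<^esub> N, mult = undefined, one = undefined,
      zero = N, add = set_add M,
      smult = (\<lambda>r X. \<Union>x\<in>X. N +>\<^bsub>M\<^esub> (r \<odot>\<^bsub>M\<^esub> x))\<rparr>"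

primrec Soc_pow ::
  "('r, 'c) ring_scheme \<Rightarrow> ('r, 'a, 'd) module_scheme \<Rightarrow> nat \<Rightarrow> 'a set" where
  "Soc_pow R M 0 = {\<zero>\<^bsub>M\<^esub>}"
| "Soc_pow R M (Suc j) =
     {x \<in> carrier M. Soc_pow R M j +>\<^bsub>M\<^esub> x \<in> Soc R (quotient_module M (Soc_pow R M j))}"

primrec Rad_pow ::
  "('r, 'c) ring_scheme \<Rightarrow> ('r, 'a, 'd) module_scheme \<Rightarrow> nat \<Rightarrow> 'a set" where
  "Rad_pow R M 0 = carrier M"
| "Rad_pow R M (Suc j) = Rad R (M\<lparr>carrier := Rad_pow R M j\<rparr>)"

text \<open>A relation rather than a function, since for a module that is not of finite length the
  filtrations need not terminate.\<close>

definition has_Loewy_length ::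
  "('r, 'c) ring_scheme \<Rightarrow> ('r, 'a, 'd) module_scheme \<Rightarrow> nat \<Rightarrow> bool" where
  "has_Loewy_length R M r \<longleftrightarrow>
     (Soc_pow R M r = carrier M \<and> (\<forall>j<r. Soc_pow R M j \<noteq> carrier M)) \<and>
     (Rad_pow R M r = {\<zero>\<^bsub>M\<^esub>} \<and> (\<forall>j<r. Rad_pow R M j \<noteq> {\<zero>\<^bsub>M\<^esub>}))"

definition rigid :: "('r, 'c) ring_scheme \<Rightarrow> ('r, 'a, 'd) module_scheme \<Rightarrow> bool" where
  "rigid R M \<longleftrightarrow>
     (\<exists>r. has_Loewy_length R M r \<and> (\<forall>j\<le>r. Rad_pow R M (r - j) = Soc_pow R M j))"


section \<open>Quantum integers\<close>

definition qint :: "'k::field \<Rightarrow> int \<Rightarrow> 'k" where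
  "qint q a = (q powi a - q powi (- a)) / (q - inverse q)"

text \<open>The value \<open>0\<close> stands for the case that no quantum integer \<open>[l]\<close>, \<open>l > 0\<close>, vanishes.\<close>

definition qchar :: "'k::field \<Rightarrow> nat" where
  "qchar q = (if \<exists>l>0. qint q (int l) = 0 then LEAST l. l > 0 \<and> qint q (int l) = 0 else 0)"


section \<open>The small quantum group of type \<open>A\<close>\<close>

datatype qgen = gen_e nat | gen_f nat | gen_K nat | gen_Kinv nat

text \<open>The free monoid on the generators, written additively: then the free algebra is the type
  \<open>qword \<Rightarrow>\<^sub>0 'k\<close> with its convolution product.\<close>

datatype qword = Word (letters: "qgen list")

instantiation qword :: monoid_add
begin

definition "0 = Word []"

definition "u + v = Word (letters u @ letters v)"

instance
  by standard (simp_all add: zero_qword_def plus_qword_def)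

end

definition qgens :: "nat \<Rightarrow> qgen set" where
  "qgens n = (\<Union>i\<in>{1..n - 1}. {gen_e i, gen_f i, gen_K i, gen_Kinv i})"

definition free_algebra :: "nat \<Rightarrow> (qword \<Rightarrow>\<^sub>0 'k::field) ring" where
  "free_algebra n =
     \<lparr>carrier = {p. \<forall>w\<in>Poly_Mapping.keys p. set (letters w) \<subseteq> qgens n},
      mult = (*), one = 1, zero = 0, add = (+)\<rparr>"

definition const :: "'k::field \<Rightarrow> (qword \<Rightarrow>\<^sub>0 'k)" where
  "const c = Poly_Mapping.single 0 c"

definition gen :: "qgen \<Rightarrow> (qword \<Rightarrow>\<^sub>0 'k::field)" where
  "gen g = Poly_Mapping.single (Word [g]) 1"

abbreviation "ge i \<equiv> gen (gen_e i)"
abbreviation "gf i \<equiv> gen (gen_f i)"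
abbreviation "gK i \<equiv> gen (gen_K i)"
abbreviation "gKinv i \<equiv> gen (gen_Kinv i)"

definition cartan :: "nat \<Rightarrow> nat \<Rightarrow> int" where
  "cartan i j = (if i = j then 2 else if i = j + 1 \<or> j = i + 1 then - 1 else 0)"

definition Uq_relations :: "nat \<Rightarrow> 'k::field \<Rightarrow> (qword \<Rightarrow>\<^sub>0 'k) set" where
  "Uq_relations n q =
     (\<Union>i\<in>{1..n - 1}. {gK i * gKinv i - 1, gKinv i * gK i - 1}) \<union>
     (\<Union>i\<in>{1..n - 1}. \<Union>j\<in>{1..n - 1}.
        {gK i * gK j - gK j * gK i,
         gK i * ge j - const (q powi cartan i j) * ge j * gK i,
         gK i * gf j - const (q powi (- cartan i j)) * gf j * gK i,
         ge i * gf j - gf j * ge i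
           - (if i = j then const (1 / (q - inverse q)) * (gK i - gKinv i) else 0)}) \<union>
     (\<Union>i\<in>{1..n - 1}. \<Union>j\<in>{j\<in>{1..n - 1}. cartan i j = 0}.
        {ge i * ge j - ge j * ge i, gf i * gf j - gf j * gf i}) \<union>
     (\<Union>i\<in>{1..n - 1}. \<Union>j\<in>{j\<in>{1..n - 1}. cartan i j = - 1}.
        {ge i ^ 2 * ge j - const (qint q 2) * ge i * ge j * ge i + ge j * ge i ^ 2,
         gf i ^ 2 * gf j - const (qint q 2) * gf i * gf j * gf i + gf j * gf i ^ 2})"

definition small_relations :: "nat \<Rightarrow> nat \<Rightarrow> (qword \<Rightarrow>\<^sub>0 'k::field) set" where
  "small_relations n l = (\<Union>i\<in>{1..n - 1}. {ge i ^ l, gf i ^ l, gK i ^ (2 * l) - 1})"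

definition small_uq :: "nat \<Rightarrow> 'k::field \<Rightarrow> nat \<Rightarrow> (qword \<Rightarrow>\<^sub>0 'k) set ring" where
  "small_uq n q l =
     free_algebra n Quot genideal (free_algebra n) (Uq_relations n q \<union> small_relations n l)"


section \<open>The module \<open>A\<^sub>q(n)\<close> and its truncations\<close>

text \<open>Exponents are integer-valued functions vanishing outside \<open>{1..n}\<close>, so that
  \<open>x\<^sup>(\<^sup>\<beta>\<^sup>)\<close> makes sense, and is \<open>0\<close>, when an entry of \<open>\<beta>\<close> is negative.\<close>

definition Zplus :: "nat \<Rightarrow> (nat \<Rightarrow> int) set" where
  "Zplus n = {\<alpha>. (\<forall>i. 0 \<le> \<alpha> i) \<and> (\<forall>i. i \<notin> {1..n} \<longrightarrow> \<alpha> i = 0)}"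

definition scale :: "'k::field \<Rightarrow> ('b \<Rightarrow>\<^sub>0 'k) \<Rightarrow> ('b \<Rightarrow>\<^sub>0 'k)" where
  "scale c v = Poly_Mapping.map ((*) c) v"

definition x_pow :: "nat \<Rightarrow> (nat \<Rightarrow> int) \<Rightarrow> ((nat \<Rightarrow> int) \<Rightarrow>\<^sub>0 'k::field)" where
  "x_pow n \<beta> = (if \<beta> \<in> Zplus n then Poly_Mapping.single \<beta> 1 else 0)"

primrec basis_act :: "nat \<Rightarrow> 'k::field \<Rightarrow> qgen \<Rightarrow> (nat \<Rightarrow> int) \<Rightarrow> ((nat \<Rightarrow> int) \<Rightarrow>\<^sub>0 'k)" where
  "basis_act n q (gen_e i) \<beta> =
     scale (qint q (\<beta> i + 1)) (x_pow n (\<beta>(i := \<beta> i + 1, i + 1 := \<beta> (i + 1) - 1)))"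
| "basis_act n q (gen_f i) \<beta> =
     scale (qint q (\<beta> (i + 1) + 1)) (x_pow n (\<beta>(i := \<beta> i - 1, i + 1 := \<beta> (i + 1) + 1)))"
| "basis_act n q (gen_K i) \<beta> = scale (q powi (\<beta> i - \<beta> (i + 1))) (x_pow n \<beta>)"
| "basis_act n q (gen_Kinv i) \<beta> = scale (q powi (- (\<beta> i - \<beta> (i + 1)))) (x_pow n \<beta>)"

definition gen_act ::
  "nat \<Rightarrow> 'k::field \<Rightarrow> qgen \<Rightarrow> ((nat \<Rightarrow> int) \<Rightarrow>\<^sub>0 'k) \<Rightarrow> ((nat \<Rightarrow> int) \<Rightarrow>\<^sub>0 'k)" where
  "gen_act n q g v =
     (\<Sum>\<beta>\<in>Poly_Mapping.keys v. scale (Poly_Mapping.lookup v \<beta>) (basis_act n q g \<beta>))"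

definition free_act ::
  "nat \<Rightarrow> 'k::field \<Rightarrow> (qword \<Rightarrow>\<^sub>0 'k) \<Rightarrow> ((nat \<Rightarrow> int) \<Rightarrow>\<^sub>0 'k) \<Rightarrow> ((nat \<Rightarrow> int) \<Rightarrow>\<^sub>0 'k)" where
  "free_act n q p v =
     (\<Sum>w\<in>Poly_Mapping.keys p. scale (Poly_Mapping.lookup p w) (foldr (gen_act n q) (letters w) v))"

text \<open>A class in the quotient algebra acts by the common value of the actions of its
  representatives.\<close>

definition Aq :: "nat \<Rightarrow> 'k::field \<Rightarrow> ((qword \<Rightarrow>\<^sub>0 'k) set, (nat \<Rightarrow> int) \<Rightarrow>\<^sub>0 'k) module" where
  "Aq n q =
     \<lparr>carrier = {v. Poly_Mapping.keys v \<subseteq> Zplus n}, mult = undefined, one = undefined,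
      zero = 0, add = (+),
      smult = (\<lambda>X v. the_elem ((\<lambda>p. free_act n q p v) ` X))\<rparr>"

definition Zplus_trunc :: "nat \<Rightarrow> nat \<Rightarrow> nat \<Rightarrow> nat \<Rightarrow> (nat \<Rightarrow> int) set" where
  "Zplus_trunc n l m s =
     {\<alpha> \<in> Zplus n. (\<Sum>i=1..n. \<alpha> i) = int s \<and> (\<forall>i\<in>{1..n}. \<alpha> i \<le> int m * int l - 1)}"

definition Aq_trunc ::
  "nat \<Rightarrow> 'k::field \<Rightarrow> nat \<Rightarrow> nat \<Rightarrow> nat \<Rightarrow> ((qword \<Rightarrow>\<^sub>0 'k) set, (nat \<Rightarrow> int) \<Rightarrow>\<^sub>0 'k) module" where
  "Aq_trunc n q l m s = (Aq n q)\<lparr>carrier := Modules.module.span scale (x_pow n ` Zplus_trunc n l m s)\<rparr>"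

definition Edeg :: "nat \<Rightarrow> nat \<Rightarrow> (nat \<Rightarrow> int) \<Rightarrow> int" where
  "Edeg n l \<alpha> = (\<Sum>i=1..n. \<alpha> i div int l)"

definition E_min :: "nat \<Rightarrow> nat \<Rightarrow> nat \<Rightarrow> nat \<Rightarrow> int" where
  "E_min n l m s = Min (Edeg n l ` Zplus_trunc n l m s)"

definition E_max :: "nat \<Rightarrow> nat \<Rightarrow> nat \<Rightarrow> nat \<Rightarrow> int" where
  "E_max n l m s = Max (Edeg n l ` Zplus_trunc n l m s)"

end

theory Submission
  imports Defs
begin

text \<open>Let \<open>V\<^sub>k\<close> be the span of the monomials of energy degree at most \<open>k\<close>. A generator never raises the
  energy degree, so \<open>V\<^sub>k\<close> is a submodule; up to signs, \<open>V\<^sub>k / V\<^sub>k\<^sub>-\<^sub>1\<close> is a sum of copies, one for each vector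
  of quotients \<open>\<lfloor>\<alpha>\<^sub>i / l\<rfloor>\<close>, of the simple module on the vectors of residues modulo \<open>l\<close>. The key point is
  descent: a submodule that meets the layer \<open>j\<close>, where \<open>j\<close> is not minimal, also meets the layer \<open>j - 1\<close>.
  To see this, raise a vector until its leading layer is singular. Then its residues there are
  \<open>(l - 1, \<dots>, l - 1, r, 0, \<dots>, 0)\<close>; the layer \<open>j - 1\<close> is removed by means of some \<open>K\<^sub>i\<^sup>2\<close>, the residues are
  transported to a vector with \<open>b\<^sub>c = 0\<close> and \<open>b\<^sub>d < l - 1\<close>, and a move from \<open>c\<close> to \<open>d\<close> lowers the energy
  degree by one. Descent shows that the socle of \<open>M / V\<^sub>k\<^sub>-\<^sub>1\<close> is \<open>V\<^sub>k / V\<^sub>k\<^sub>-\<^sub>1\<close>. The modules for \<open>s\<close> and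
  \<open>n (m l - 1) - s\<close> are dual to each other up to signs, and descent in the dual shows that the radical
  of \<open>V\<^sub>k\<close> is \<open>V\<^sub>k\<^sub>-\<^sub>1\<close>. Hence both filtrations are the energy filtration.\<close>

section \<open>Quantum integers at a root of unity\<close>

text \<open>The engine is an asymmetry between carrying and borrowing modulo \<open>l\<close>. A
  unit moved from entry c to entry d has the coefficient \<open>[\<beta>_d + 1]\<close>, which
  vanishes exactly when \<open>l\<close> divides \<open>\<beta>_d + 1\<close>, that is, when the
  move would carry at d. A borrow at c is allowed. So the energy degree never rises and drops by at
  most one, and the bound \<open>m l - 1\<close> is respected because exceeding it would be a carry.
  Every monomial in the image of a generator has a single source, so its coefficient is one product
  and nothing can cancel.

  Squares of the \<open>K_i\<close> are taken because \<open>q^l\<close> may be -1: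
  \<open>q^(2 a)\<close> depends only on a modulo \<open>l\<close>, whereas \<open>K_i\<close>
  itself may also see the parity of the quotients.

  Descent is a statement about submodules and therefore speaks of socles. The radical of
  \<open>V\<^sub>k\<close> is about its quotients; these become submodules in the dual, and
  \<open>[m l - a] = - q^(m l) [a]\<close> puts the dual into the same family of modules, where
  descent is available again.\<close>

lemma qint_0 [simp]: "qint q 0 = 0"
  by (simp add: qint_def)

lemma qint_eq_0_iff:
  assumes "q \<noteq> 0" "q - inverse q \<noteq> 0"
  shows "qint q a = 0 \<longleftrightarrow> q powi (2 * a) = 1"
proof -
  have "q powi (2 * a) = q powi a * q powi a"
    using assms by (simp add: power_int_add[symmetric])
  moreover have "q powi (-a) * q powi a = 1"
    using assms by (simp add: power_int_add[symmetric])
  moreover have "q powi a \<noteq> 0"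
    using assms by simp
  ultimately have "q powi (2 * a) = 1 \<longleftrightarrow> q powi a = q powi (-a)"
    by (metis mult_right_cancel)
  then show ?thesis
    using assms by (simp add: qint_def)
qed

text \<open>\<open>[l] = 0\<close> means \<open>q^(2 l) = 1\<close>, so \<open>q^(2 a)\<close>
  depends on a modulo \<open>l\<close> only; minimality of \<open>l\<close> excludes the nonzero
  remainders. In other words, \<open>q^2\<close> has order \<open>l\<close>.\<close>

lemma powi_two_eq_1_iff_qchar_dvd:
  assumes "q \<noteq> (0 :: 'k :: field)" "q - inverse q \<noteq> 0" "qchar q = l" "l > 0"
  shows "q powi (2 * a) = 1 \<longleftrightarrow> int l dvd a"
proof -
  define P where "P l \<longleftrightarrow> l > 0 \<and> qint q (int l) = 0" for l
  have ex: "\<exists>l. P l"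
    using assms(3,4) by (auto simp: qchar_def P_def split: if_splits)
  then have l: "l = (LEAST l. P l)"
    using assms(3) by (auto simp: qchar_def P_def split: if_splits)
  have "P l"
    using LeastI_ex[OF ex] l by simp
  then have ql: "q powi (2 * int l) = 1"
    using qint_eq_0_iff[OF assms(1,2)] by (simp add: P_def)
  have less: "q powi (2 * int k) \<noteq> 1" if "0 < k" "k < l" for k
    using that not_less_Least[of k P] l qint_eq_0_iff[OF assms(1,2)] by (simp add: P_def)
  have "2 * a = (2 * int l) * (a div int l) + 2 * (a mod int l)"
    by (metis distrib_left mult.assoc mult_div_mod_eq)
  then have "q powi (2 * a) = (q powi (2 * int l)) powi (a div int l) * q powi (2 * (a mod int l))"
    using assms(1) by (metis power_int_add power_int_mult)
  then have red: "q powi (2 * a) = q powi (2 * (a mod int l))"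
    by (simp add: ql)
  show ?thesis
  proof
    assume "q powi (2 * a) = 1"
    then have "q powi (2 * int (nat (a mod int l))) = 1"
      using red assms(4) by simp
    moreover have "nat (a mod int l) < l"
      using assms(4) by (simp add: nat_less_iff)
    ultimately have "nat (a mod int l) = 0"
      using less by blast
    moreover have "a mod int l \<ge> 0"
      using assms(4) by simp
    ultimately show "int l dvd a"
      by (simp add: dvd_eq_mod_eq_0)
  next
    assume "int l dvd a"
    then show "q powi (2 * a) = 1"
      using red by simp
  qed
qed

text \<open>Asking only for the order of \<open>q^2\<close> treats both kinds of \<open>q\<close> at
  once: primitive roots of order \<open>2 l\<close>, and primitive roots of odd order
  \<open>l\<close>.\<close>

locale root_of_unity =
  fixes q :: "'k :: field" and l :: nat
  assumes q_nonzero: "q \<noteq> 0"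
    and q_diff_nonzero: "q - inverse q \<noteq> 0"
    and powi_two_eq_1: "q powi (2 * a) = 1 \<longleftrightarrow> int l dvd a"
    and l_ge: "l \<ge> 3"
begin

lemma qint_eq_0: "qint q a = 0 \<longleftrightarrow> int l dvd a"
  using qint_eq_0_iff[OF q_nonzero q_diff_nonzero] powi_two_eq_1 by simp

text \<open>\<open>q^(m l)\<close> has square 1 and so is its own inverse. The duality between
  complementary degrees rests on this identity.\<close>

lemma qint_reflect: "qint q (int m * int l - a) = - (q powi (int m * int l)) * qint q a"
proof -
  have "q powi (int m * int l) * q powi (int m * int l) = q powi (2 * (int m * int l))"
    using q_nonzero by (metis mult_2 power_int_add)
  then have *: "q powi (int m * int l) * q powi (int m * int l) = 1"
    using powi_two_eq_1[of "int m * int l"] by simp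
  have "q powi (int m * int l) * (q powi (int m * int l) * q powi (a - int m * int l)) = q powi (int m * int l) * q powi a"
    using q_nonzero by (simp add: power_int_add[symmetric])
  then have "q powi (- (int m * int l - a)) = q powi (int m * int l) * q powi a"
    using * by (metis minus_diff_eq mult.assoc mult_1)
  moreover have "q powi (int m * int l - a) = q powi (int m * int l) * q powi (- a)"
    using q_nonzero power_int_add[of q "int m * int l" "- a"] by simp
  ultimately show ?thesis
    unfolding qint_def by (simp only: right_diff_distrib times_divide_eq_right minus_mult_left[symmetric] minus_diff_eq minus_divide_left) simp
qed

end

section \<open>The action on coefficient functions\<close>

lemma lookup_scale [simp]: "Poly_Mapping.lookup (scale c v) x = c * Poly_Mapping.lookup v x"
  by (simp add: scale_def Poly_Mapping.map.rep_eq when_def)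

lemma keys_scale_subset: "Poly_Mapping.keys (scale c v) \<subseteq> Poly_Mapping.keys v"
  by (auto simp: in_keys_iff)

global_interpretation scale: vector_space "scale :: 'k::field \<Rightarrow> ('b \<Rightarrow>\<^sub>0 'k) \<Rightarrow> _"
  by standard (auto intro!: poly_mapping_eqI simp: lookup_add algebra_simps)

lemma poly_mapping_monomial_induct [case_names zero add]:
  assumes "P 0"
    and "\<And>a b p. P p \<Longrightarrow> P (Poly_Mapping.single a b + p)"
  shows "P p"
proof (induction p rule: update_induct)
  case const
  then show ?case by (simp add: assms)
next
  case (update f a b)
  have "Poly_Mapping.update a b f = Poly_Mapping.single a b + f"
    using update(1) by (intro poly_mapping_eqI) (auto simp: lookup_update lookup_add lookup_single in_keys_iff when_def)
  then show ?case
    using assms(2) update by simp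
qed

lemma lookup_x_pow:
  "Poly_Mapping.lookup (x_pow n \<beta>) \<gamma> = (if \<beta> \<in> Zplus n \<and> \<gamma> = \<beta> then 1 else 0)"
  by (auto simp: x_pow_def lookup_single when_def)

text \<open>The action seen from the target: the new coefficient at \<open>\<gamma>\<close> in terms
  of the old coefficient at its source. No sign or support condition is imposed on exponents, so the
  relations of the algebra become identities between functions on the whole lattice.\<close>

primrec gen_op :: "'k::field \<Rightarrow> qgen \<Rightarrow> ((nat \<Rightarrow> int) \<Rightarrow> 'k) \<Rightarrow> (nat \<Rightarrow> int) \<Rightarrow> 'k" where
  "gen_op q (gen_e i) F \<gamma> = qint q (\<gamma> i) * F (\<gamma>(i := \<gamma> i - 1, i + 1 := \<gamma> (i + 1) + 1))"
| "gen_op q (gen_f i) F \<gamma> = qint q (\<gamma> (i + 1)) * F (\<gamma>(i := \<gamma> i + 1, i + 1 := \<gamma> (i + 1) - 1))"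
| "gen_op q (gen_K i) F \<gamma> = q powi (\<gamma> i - \<gamma> (i + 1)) * F \<gamma>"
| "gen_op q (gen_Kinv i) F \<gamma> = q powi (- (\<gamma> i - \<gamma> (i + 1))) * F \<gamma>"

definition restrict_Zplus :: "nat \<Rightarrow> ((nat \<Rightarrow> int) \<Rightarrow> 'k::zero) \<Rightarrow> (nat \<Rightarrow> int) \<Rightarrow> 'k" where
  "restrict_Zplus n F \<gamma> = (if \<gamma> \<in> Zplus n then F \<gamma> else 0)"

lemma lookup_gen_act:
  "Poly_Mapping.lookup (gen_act n q g v) = restrict_Zplus n (gen_op q g (Poly_Mapping.lookup v))"
proof
  fix \<gamma>
  \<comment> \<open>Only the one exponent \<open>\<delta>\<close> is sent to
    \<open>\<gamma>\<close>, so the sum over the support has at most one nonzero term.\<close>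
  have one: "Poly_Mapping.lookup (gen_act n q g v) \<gamma> =
      (if \<gamma> \<in> Zplus n then c \<delta> * Poly_Mapping.lookup v \<delta> else 0)"
    if *: "\<And>\<beta>. Poly_Mapping.lookup (basis_act n q g \<beta>) \<gamma> = (if \<gamma> \<in> Zplus n \<and> \<beta> = \<delta> then c \<beta> else 0)"
    for c \<delta>
  proof -
    have "Poly_Mapping.lookup (gen_act n q g v) \<gamma> = (\<Sum>\<beta>\<in>Poly_Mapping.keys v.
        if \<beta> = \<delta> then (if \<gamma> \<in> Zplus n then c \<beta> * Poly_Mapping.lookup v \<beta> else 0) else 0)"
      unfolding gen_act_def lookup_sum lookup_scale * by (intro sum.cong) auto
    then show ?thesis
      by (simp add: sum.delta' in_keys_iff)
  qed
  show "Poly_Mapping.lookup (gen_act n q g v) \<gamma> = restrict_Zplus n (gen_op q g (Poly_Mapping.lookup v)) \<gamma>"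
  proof (cases g)
    case (gen_e i)
    define \<delta> where "\<delta> = \<gamma>(i := \<gamma> i - 1, i + 1 := \<gamma> (i + 1) + 1)"
    have "Poly_Mapping.lookup (basis_act n q g \<beta>) \<gamma> =
        (if \<gamma> \<in> Zplus n \<and> \<beta> = \<delta> then qint q (\<beta> i + 1) else 0)" for \<beta>
    proof (cases "\<beta> = \<delta>")
      case True
      then have "\<beta>(i := \<beta> i + 1, i + 1 := \<beta> (i + 1) - 1) = \<gamma>"
        by (auto simp: \<delta>_def)
      then show ?thesis
        unfolding gen_e basis_act.simps lookup_scale lookup_x_pow using True by simp
    next
      case False
      then have "\<gamma> \<noteq> \<beta>(i := \<beta> i + 1, i + 1 := \<beta> (i + 1) - 1)"
        by (auto simp: \<delta>_def)
      then show ?thesis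
        unfolding gen_e basis_act.simps lookup_scale lookup_x_pow using False by simp
    qed
    from one[OF this] show ?thesis
      by (simp add: restrict_Zplus_def gen_e \<delta>_def)
  next
    case (gen_f i)
    define \<delta> where "\<delta> = \<gamma>(i := \<gamma> i + 1, i + 1 := \<gamma> (i + 1) - 1)"
    have "Poly_Mapping.lookup (basis_act n q g \<beta>) \<gamma> =
        (if \<gamma> \<in> Zplus n \<and> \<beta> = \<delta> then qint q (\<beta> (i + 1) + 1) else 0)" for \<beta>
    proof (cases "\<beta> = \<delta>")
      case True
      then have "\<beta>(i := \<beta> i - 1, i + 1 := \<beta> (i + 1) + 1) = \<gamma>"
        by (auto simp: \<delta>_def)
      then show ?thesis
        unfolding gen_f basis_act.simps lookup_scale lookup_x_pow using True by simp
    next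
      case False
      then have "\<gamma> \<noteq> \<beta>(i := \<beta> i - 1, i + 1 := \<beta> (i + 1) + 1)"
        by (auto simp: \<delta>_def)
      then show ?thesis
        unfolding gen_f basis_act.simps lookup_scale lookup_x_pow using False by simp
    qed
    from one[OF this] show ?thesis
      by (simp add: restrict_Zplus_def gen_f \<delta>_def)
  next
    case (gen_K i)
    have "Poly_Mapping.lookup (basis_act n q g \<beta>) \<gamma> =
        (if \<gamma> \<in> Zplus n \<and> \<beta> = \<gamma> then q powi (\<beta> i - \<beta> (i + 1)) else 0)" for \<beta>
      unfolding gen_K basis_act.simps lookup_scale lookup_x_pow by (cases "\<beta> = \<gamma>") simp_all
    from one[OF this] show ?thesis
      by (simp add: restrict_Zplus_def gen_K)
  next
    case (gen_Kinv i)
    have "Poly_Mapping.lookup (basis_act n q g \<beta>) \<gamma> =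
        (if \<gamma> \<in> Zplus n \<and> \<beta> = \<gamma> then q powi (- (\<beta> i - \<beta> (i + 1))) else 0)" for \<beta>
      unfolding gen_Kinv basis_act.simps lookup_scale lookup_x_pow by (cases "\<beta> = \<gamma>") simp_all
    from one[OF this] show ?thesis
      by (simp add: restrict_Zplus_def gen_Kinv)
  qed
qed

text \<open>A source of \<open>\<gamma>\<close> leaves the nonnegative exponents only if the entry
  that receives the unit is 0 in \<open>\<gamma>\<close>, and there the factor \<open>[0]\<close>
  vanishes. Hence truncation to nonnegative exponents may be postponed to the end of a word.\<close>

lemma gen_op_restrict_Zplus:
  assumes "g \<in> qgens n" "\<gamma> \<in> Zplus n"
  shows "gen_op q g (restrict_Zplus n F) \<gamma> = gen_op q g F \<gamma>"
proof -
  have "\<gamma> i = 0" if "\<gamma>(i := \<gamma> i - 1, Suc i := \<gamma> (Suc i) + 1) \<notin> Zplus n" "Suc 0 \<le> i" "i \<le> n - Suc 0" for i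
    using that assms(2) by (auto simp: Zplus_def split: if_splits) (smt (verit))+
  moreover have "\<gamma> (Suc i) = 0" if "\<gamma>(i := \<gamma> i + 1, Suc i := \<gamma> (Suc i) - 1) \<notin> Zplus n" "Suc 0 \<le> i" "i \<le> n - Suc 0" for i
    using that assms(2) by (auto simp: Zplus_def split: if_splits) (smt (verit))+
  ultimately show ?thesis
    using assms by (cases g) (force simp: restrict_Zplus_def qgens_def)+
qed

lemma gen_act_add: "gen_act n q g (v + w) = gen_act n q g v + gen_act n q g w"
  by (rule poly_mapping_eqI, cases g)
    (auto simp: lookup_gen_act restrict_Zplus_def lookup_add algebra_simps)

lemma gen_act_scale: "gen_act n q g (scale c v) = scale c (gen_act n q g v)"
  by (rule poly_mapping_eqI, cases g) (auto simp: lookup_gen_act restrict_Zplus_def)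

section \<open>Extension of the action from generators to words and to the free algebra\<close>

definition word_act :: "nat \<Rightarrow> 'k::field \<Rightarrow> qgen list \<Rightarrow> ((nat \<Rightarrow> int) \<Rightarrow>\<^sub>0 'k) \<Rightarrow> ((nat \<Rightarrow> int) \<Rightarrow>\<^sub>0 'k)" where
  "word_act n q gs v = foldr (gen_act n q) gs v"

lemma word_act_add: "word_act n q gs (v + w) = word_act n q gs v + word_act n q gs w"
  by (induction gs) (auto simp: word_act_def gen_act_add)

lemma word_act_scale: "word_act n q gs (scale c v) = scale c (word_act n q gs v)"
  by (induction gs) (auto simp: word_act_def gen_act_scale)

lemma word_act_append: "word_act n q (gs @ hs) v = word_act n q gs (word_act n q hs v)"
  by (simp add: word_act_def)

lemma free_act_superset:
  assumes "finite A" "Poly_Mapping.keys p \<subseteq> A"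
  shows "free_act n q p v = (\<Sum>w\<in>A. scale (Poly_Mapping.lookup p w) (word_act n q (letters w) v))"
  unfolding free_act_def word_act_def
  using assms by (intro sum.mono_neutral_left) (auto simp: in_keys_iff)

lemma free_act_add: "free_act n q (p + p') v = free_act n q p v + free_act n q p' v"
  using keys_add[of p p']
  by (simp add: free_act_superset[of "Poly_Mapping.keys p \<union> Poly_Mapping.keys p'"]
      lookup_add scale.scale_left_distrib sum.distrib)

lemma free_act_0 [simp]: "free_act n q 0 v = 0"
  by (simp add: free_act_def)

lemma free_act_single: "free_act n q (Poly_Mapping.single w c) v = scale c (word_act n q (letters w) v)"
  by (subst free_act_superset[of "{w}"]) auto

lemma free_act_add_right: "free_act n q p (v + w) = free_act n q p v + free_act n q p w"
  by (simp add: free_act_def word_act_def[symmetric] word_act_add scale.scale_right_distrib sum.distrib)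

lemma free_act_scale: "free_act n q p (scale c v) = scale c (free_act n q p v)"
  by (simp add: free_act_def word_act_def[symmetric] word_act_scale scale.scale_sum_right mult.commute)

lemma free_act_0_right [simp]: "free_act n q p 0 = 0"
  using free_act_scale[of n q p 0 0] by simp

lemma free_act_uminus: "free_act n q (- p) v = - free_act n q p v"
  using free_act_add[of n q p "- p" v] by (simp add: eq_neg_iff_add_eq_0 add.commute)

lemma free_act_diff: "free_act n q (p - p') v = free_act n q p v - free_act n q p' v"
  using free_act_add[of n q p "- p'" v] by (simp add: free_act_uminus)

lemma free_act_mult: "free_act n q (p * p') v = free_act n q p (free_act n q p' v)"
proof (induction p rule: poly_mapping_monomial_induct)
  case (add a b p)
  have "free_act n q (Poly_Mapping.single a b * p') v = free_act n q (Poly_Mapping.single a b) (free_act n q p' v)"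
    by (induction p' rule: poly_mapping_monomial_induct)
      (simp_all add: distrib_left free_act_add free_act_add_right mult_single free_act_single
        word_act_scale plus_qword_def word_act_append)
  then show ?case
    using add by (simp add: distrib_right free_act_add)
qed simp

lemma letters_0 [simp]: "letters 0 = []"
  by (simp add: zero_qword_def)

lemma free_act_1 [simp]: "free_act n q 1 v = v"
  using free_act_single[of n q 0 1 v] by (simp add: word_act_def)

lemma free_act_const [simp]: "free_act n q (const c) v = scale c v"
  by (simp add: const_def free_act_single word_act_def)

lemma free_act_gen [simp]: "free_act n q (gen g) v = gen_act n q g v"
  by (simp add: gen_def free_act_single word_act_def)

lemma free_act_power: "free_act n q (p ^ k) v = (free_act n q p ^^ k) v"
  by (induction k) (auto simp: free_act_mult)

section \<open>The relations of the small quantum group\<close>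

text \<open>Minus the simple root: \<open>e_i\<close> adds the root to an exponent, so its source
  differs from the target by \<open>root_vec i\<close>. In additive form, sources of composites
  agree up to the order of summands.\<close>

definition root_vec :: "nat \<Rightarrow> nat \<Rightarrow> int" where
  "root_vec i k = (if k = i then - 1 else if k = i + 1 then 1 else 0)"

lemma gen_op_e: "gen_op q (gen_e i) F \<gamma> = qint q (\<gamma> i) * F (\<lambda>k. \<gamma> k + root_vec i k)"
proof -
  have "\<gamma>(i := \<gamma> i - 1, i + 1 := \<gamma> (i + 1) + 1) = (\<lambda>k. \<gamma> k + root_vec i k)"
    by (auto simp: root_vec_def fun_eq_iff)
  then show ?thesis
    by simp
qed

lemma gen_op_f: "gen_op q (gen_f i) F \<gamma> = qint q (\<gamma> (i + 1)) * F (\<lambda>k. \<gamma> k - root_vec i k)"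
proof -
  have "\<gamma>(i := \<gamma> i + 1, i + 1 := \<gamma> (i + 1) - 1) = (\<lambda>k. \<gamma> k - root_vec i k)"
    by (auto simp: root_vec_def fun_eq_iff)
  then show ?thesis
    by simp
qed

context root_of_unity
begin

lemma powi_add: "q powi (a + b) = q powi a * q powi b"
  using q_nonzero by (simp add: power_int_add)

lemma powi_diff: "q powi (a - b) = q powi a * q powi (- b)"
  using powi_add[of a "- b"] by simp

lemma powi_neg_cancel: "q powi a * q powi (- a) = 1" "q powi (- a) * q powi a = 1"
  using powi_add[of a "- a"] powi_add[of "- a" a] by auto

lemma qint_2: "qint q 2 = q + inverse q"
proof -
  have "(q + inverse q) * (q - inverse q) = q powi 2 - q powi (- 2)"
    by (simp add: algebra_simps power_int_minus power2_eq_square)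
  then show ?thesis
    using q_diff_nonzero by (simp add: qint_def field_simps)
qed

lemma qint_rec: "qint q 2 * qint q a = qint q (a + 1) + qint q (a - 1)"
proof -
  have "q powi (a - 1) = q powi a * inverse q" "q powi (- (a + 1)) = q powi (- a) * inverse q"
    "q powi (a + 1) = q powi a * q" "q powi (- (a - 1)) = q powi (- a) * q"
    using powi_add[of a 1] powi_add[of a "-1"] powi_add[of "-a" "-1"] powi_add[of "-a" 1]
    by (simp_all add: power_int_minus)
  then have "(q powi (a + 1) - q powi (- (a + 1))) + (q powi (a - 1) - q powi (- (a - 1)))
      = (q + inverse q) * (q powi a - q powi (- a))"
    by (simp only:) (simp add: algebra_simps)
  then show ?thesis
    unfolding qint_2 by (simp only: qint_def add_divide_distrib[symmetric] times_divide_eq_right)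
qed

lemma qint_commutator:
  "qint q a * qint q (b + 1) - qint q b * qint q (a + 1) = qint q (a - b)"
proof -
  have *: "q powi (a + 1) = q powi a * q" "q powi (- (a + 1)) = q powi (- a) * inverse q" for a
    using powi_add[of a 1] powi_add[of "-a" "-1"] by (simp_all add: power_int_minus)
  have d: "q powi (a - b) = q powi a * q powi (- b)" "q powi (- (a - b)) = q powi (- a) * q powi b"
    using powi_diff[of a b] powi_diff[of b a] by (simp_all add: mult.commute)
  have "(q powi a - q powi (- a)) * (q powi (b + 1) - q powi (- (b + 1))) -
      (q powi b - q powi (- b)) * (q powi (a + 1) - q powi (- (a + 1))) =
      (q powi (a - b) - q powi (- (a - b))) * (q - inverse q)"
    unfolding * d by (simp only: ring_distribs) (simp add: mult_ac)
  then show ?thesis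
    using q_diff_nonzero unfolding qint_def
    by (simp add: times_divide_times_eq diff_divide_distrib[symmetric] del: right_diff_distrib left_diff_distrib)
qed

text \<open>Both cases are multiples of the recursion \<open>[2] [a] = [a + 1] + [a - 1]\<close>.
  The numbers \<open>c\<close> and \<open>d\<close> record which of the two neighbouring operators
  changes the entry whose quantum integer the other one reads.\<close>

lemma qint_serre:
  assumes "c = 1 \<and> d = 0 \<or> c = 0 \<and> d = 1"
  shows "qint q a * (qint q (a - 1) * qint q (b + 2 * c)) + qint q b * (qint q (a + d) * qint q (a + d - 1)) =
    qint q 2 * (qint q a * (qint q (b + c) * qint q (a - 1 + d)))"
  using assms
proof
  assume *: "c = 1 \<and> d = 0"
  have "qint q (b + 2) + qint q b = qint q 2 * qint q (b + 1)"
    using qint_rec[of "b + 1"] by (simp add: add.assoc)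
  from arg_cong[OF this, of "\<lambda>x. qint q a * qint q (a - 1) * x"] show ?thesis
    using * by (simp only: algebra_simps) (simp add: algebra_simps add.commute)
next
  assume *: "c = 0 \<and> d = 1"
  from arg_cong[OF qint_rec[of a], of "\<lambda>x. qint q a * qint q b * x"] show ?thesis
    using * by (simp add: algebra_simps)
qed

lemma gen_op_serre:
  assumes "j = i + 1 \<or> i = j + 1"
  shows "gen_op q (gen_e i) (gen_op q (gen_e i) (gen_op q (gen_e j) F)) \<gamma>
      + gen_op q (gen_e j) (gen_op q (gen_e i) (gen_op q (gen_e i) F)) \<gamma>
      = qint q 2 * gen_op q (gen_e i) (gen_op q (gen_e j) (gen_op q (gen_e i) F)) \<gamma>" (is ?E)
    and "gen_op q (gen_f i) (gen_op q (gen_f i) (gen_op q (gen_f j) F)) \<gamma>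
      + gen_op q (gen_f j) (gen_op q (gen_f i) (gen_op q (gen_f i) F)) \<gamma>
      = qint q 2 * gen_op q (gen_f i) (gen_op q (gen_f j) (gen_op q (gen_f i) F)) \<gamma>" (is ?F)
proof -
  have F_cong: "F x = F y" if "\<And>k. x k = y k" for x y
    using that by presburger
  have cd: "root_vec i j = 1 \<and> root_vec j i = 0 \<or> root_vec i j = 0 \<and> root_vec j i = 1"
    using assms by (auto simp: root_vec_def)
  have ii: "root_vec i i = - 1" "root_vec i (i + 1) = 1" "root_vec j j = - 1" "root_vec j (j + 1) = 1"
    by (auto simp: root_vec_def)
  define x where "x = F (\<lambda>k. \<gamma> k + root_vec i k + root_vec i k + root_vec j k)"
  have x: "F (\<lambda>k. \<gamma> k + root_vec i k + root_vec j k + root_vec i k) = x"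
    "F (\<lambda>k. \<gamma> k + root_vec j k + root_vec i k + root_vec i k) = x"
    unfolding x_def by (rule F_cong, simp)+
  have "gen_op q (gen_e i) (gen_op q (gen_e i) (gen_op q (gen_e j) F)) \<gamma> =
      qint q (\<gamma> i) * (qint q (\<gamma> i - 1) * qint q (\<gamma> j + 2 * root_vec i j)) * x"
    unfolding gen_op_e ii x_def by (simp add: mult_ac add_ac)
  moreover have "gen_op q (gen_e i) (gen_op q (gen_e j) (gen_op q (gen_e i) F)) \<gamma> =
      qint q (\<gamma> i) * (qint q (\<gamma> j + root_vec i j) * qint q (\<gamma> i - 1 + root_vec j i)) * x"
    unfolding gen_op_e ii x by (simp add: mult_ac)
  moreover have "gen_op q (gen_e j) (gen_op q (gen_e i) (gen_op q (gen_e i) F)) \<gamma> =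
      qint q (\<gamma> j) * (qint q (\<gamma> i + root_vec j i) * qint q (\<gamma> i + root_vec j i - 1)) * x"
    unfolding gen_op_e ii x by (simp add: mult_ac)
  ultimately show ?E
    using arg_cong[OF qint_serre[OF cd, of "\<gamma> i" "\<gamma> j"], of "\<lambda>y. y * x"]
    by (simp only: distrib_right mult.assoc)
  \<comment> \<open>The operators f read entry \<open>i + 1\<close> or \<open>j + 1\<close> where
    the operators e read \<open>i\<close> or \<open>j\<close>; this exchanges the two cases.\<close>
  have cd: "- root_vec i (j + 1) = 1 \<and> - root_vec j (i + 1) = 0 \<or> - root_vec i (j + 1) = 0 \<and> - root_vec j (i + 1) = 1"
    using assms by (auto simp: root_vec_def)
  define x where "x = F (\<lambda>k. \<gamma> k - root_vec i k - root_vec i k - root_vec j k)"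
  have x: "F (\<lambda>k. \<gamma> k - root_vec i k - root_vec j k - root_vec i k) = x"
    "F (\<lambda>k. \<gamma> k - root_vec j k - root_vec i k - root_vec i k) = x"
    unfolding x_def by (rule F_cong, simp)+
  have "gen_op q (gen_f i) (gen_op q (gen_f i) (gen_op q (gen_f j) F)) \<gamma> =
      qint q (\<gamma> (i + 1)) * (qint q (\<gamma> (i + 1) - 1) * qint q (\<gamma> (j + 1) + 2 * - root_vec i (j + 1))) * x"
    unfolding gen_op_f ii x_def by (simp add: mult_ac algebra_simps)
  moreover have "gen_op q (gen_f i) (gen_op q (gen_f j) (gen_op q (gen_f i) F)) \<gamma> =
      qint q (\<gamma> (i + 1)) * (qint q (\<gamma> (j + 1) + - root_vec i (j + 1)) * qint q (\<gamma> (i + 1) - 1 + - root_vec j (i + 1))) * x"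
    unfolding gen_op_f ii x by (simp add: mult_ac)
  moreover have "gen_op q (gen_f j) (gen_op q (gen_f i) (gen_op q (gen_f i) F)) \<gamma> =
      qint q (\<gamma> (j + 1)) * (qint q (\<gamma> (i + 1) + - root_vec j (i + 1)) * qint q (\<gamma> (i + 1) + - root_vec j (i + 1) - 1)) * x"
    unfolding gen_op_f ii x by (simp add: mult_ac)
  ultimately show ?F
    using arg_cong[OF qint_serre[OF cd, of "\<gamma> (i + 1)" "\<gamma> (j + 1)"], of "\<lambda>y. y * x"]
    by (simp only: distrib_right mult.assoc)
qed

lemma dvd_or_pred_mod_less:
  assumes "x mod int l < int (Suc k)"
  shows "int l dvd x \<or> (x - 1) mod int l < int k"
proof (cases "x mod int l = 0")
  case False
  have pos: "0 < int l"
    using l_ge by simp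
  have "x mod int l \<ge> 0" "x mod int l < int l"
    using pos by simp_all
  then have "(x mod int l - 1) mod int l = x mod int l - 1"
    using False by (intro mod_pos_pos_trivial) auto
  then show ?thesis
    using assms by (simp add: mod_simps)
qed auto

text \<open>Each factor reads the entry \<open>i\<close> one lower than the previous one, so a
  multiple of \<open>l\<close> is met after as many steps as the residue counts, and its quantum
  integer is 0. For \<open>k = l\<close> the hypothesis always holds, which yields
  \<open>e_i^l = 0\<close>.\<close>

lemma gen_op_e_nilpotent: "\<gamma> i mod int l < int k \<Longrightarrow> (gen_op q (gen_e i) ^^ k) F \<gamma> = 0"
proof (induction k arbitrary: \<gamma>)
  case 0
  have "\<gamma> i mod int l \<ge> 0"
    using l_ge by simp
  with 0 show ?case
    by simp
next
  case (Suc k)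
  then show ?case
    using dvd_or_pred_mod_less[OF Suc.prems]
    by (auto simp: gen_op_e qint_eq_0 root_vec_def simp del: gen_op.simps)
qed

lemma gen_op_f_nilpotent: "\<gamma> (i + 1) mod int l < int k \<Longrightarrow> (gen_op q (gen_f i) ^^ k) F \<gamma> = 0"
proof (induction k arbitrary: \<gamma>)
  case 0
  have "\<gamma> (i + 1) mod int l \<ge> 0"
    using l_ge by simp
  with 0 show ?case
    by simp
next
  case (Suc k)
  then show ?case
    using dvd_or_pred_mod_less[OF Suc.prems]
    by (auto simp: gen_op_f qint_eq_0 root_vec_def simp del: gen_op.simps)
qed

lemma gen_op_K_power: "(gen_op q (gen_K i) ^^ k) F \<gamma> = q powi (int k * (\<gamma> i - \<gamma> (i + 1))) * F \<gamma>"
  by (induction k) (simp_all add: distrib_right powi_add mult_ac)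

end

lemma restrict_Zplus_gen_op:
  assumes "g \<in> qgens n"
  shows "restrict_Zplus n (gen_op q g (restrict_Zplus n F)) = restrict_Zplus n (gen_op q g F)"
proof
  fix \<gamma>
  show "restrict_Zplus n (gen_op q g (restrict_Zplus n F)) \<gamma> = restrict_Zplus n (gen_op q g F) \<gamma>"
    using gen_op_restrict_Zplus[OF assms, of \<gamma> q F]
    unfolding restrict_Zplus_def[of n "gen_op _ _ _"] by simp
qed

lemma restrict_Zplus_idem [simp]: "restrict_Zplus n (restrict_Zplus n F) = restrict_Zplus n F"
  by (auto simp: restrict_Zplus_def)

lemma restrict_Zplus_lookup:
  "Poly_Mapping.keys v \<subseteq> Zplus n \<Longrightarrow> restrict_Zplus n (Poly_Mapping.lookup v) = Poly_Mapping.lookup v"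
  by (auto simp: restrict_Zplus_def fun_eq_iff in_keys_iff subset_iff)

lemma lookup_word_act:
  assumes "set gs \<subseteq> qgens n" "Poly_Mapping.keys v \<subseteq> Zplus n"
  shows "Poly_Mapping.lookup (word_act n q gs v) = restrict_Zplus n (foldr (gen_op q) gs (Poly_Mapping.lookup v))"
  using assms
  by (induction gs) (simp_all add: word_act_def lookup_gen_act restrict_Zplus_gen_op restrict_Zplus_lookup)

lemma keys_word_act:
  assumes "set gs \<subseteq> qgens n" "Poly_Mapping.keys v \<subseteq> Zplus n"
  shows "Poly_Mapping.keys (word_act n q gs v) \<subseteq> Zplus n"
  using assms by (auto simp: in_keys_iff lookup_word_act restrict_Zplus_def split: if_splits)

section \<open>The action of the small quantum group\<close>

lemma carrier_free_algebra:
  "p \<in> carrier (free_algebra n) \<longleftrightarrow> (\<forall>w\<in>Poly_Mapping.keys p. set (letters w) \<subseteq> qgens n)"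
  by (simp add: free_algebra_def)

lemma free_algebra_closed [intro]:
  "p \<in> carrier (free_algebra n) \<Longrightarrow> p' \<in> carrier (free_algebra n) \<Longrightarrow> p + p' \<in> carrier (free_algebra n)"
  "p \<in> carrier (free_algebra n) \<Longrightarrow> p' \<in> carrier (free_algebra n) \<Longrightarrow> p - p' \<in> carrier (free_algebra n)"
  "p \<in> carrier (free_algebra n) \<Longrightarrow> - p \<in> carrier (free_algebra n)"
  "p \<in> carrier (free_algebra n) \<Longrightarrow> p' \<in> carrier (free_algebra n) \<Longrightarrow> p * p' \<in> carrier (free_algebra n)"
  "p \<in> carrier (free_algebra n) \<Longrightarrow> p ^ k \<in> carrier (free_algebra n)"
  "0 \<in> carrier (free_algebra n)"
  "1 \<in> carrier (free_algebra n)"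
  "const c \<in> carrier (free_algebra n)"
  "g \<in> qgens n \<Longrightarrow> gen g \<in> carrier (free_algebra n)"
proof -
  show add: "p + p' \<in> carrier (free_algebra n)" if "p \<in> carrier (free_algebra n)" "p' \<in> carrier (free_algebra n)" for p p'
    using that keys_add[of p p'] unfolding carrier_free_algebra by blast
  show neg: "- p \<in> carrier (free_algebra n)" if "p \<in> carrier (free_algebra n)" for p
    using that by (simp add: carrier_free_algebra in_keys_iff)
  show "p - p' \<in> carrier (free_algebra n)" if "p \<in> carrier (free_algebra n)" "p' \<in> carrier (free_algebra n)" for p p'
    using add[OF that(1) neg[OF that(2)]] by simp
  show mult: "p * p' \<in> carrier (free_algebra n)" if "p \<in> carrier (free_algebra n)" "p' \<in> carrier (free_algebra n)" for p p'
    using that keys_mult[of p p'] unfolding carrier_free_algebra by (fastforce simp: plus_qword_def)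
  show one: "1 \<in> carrier (free_algebra n)"
    by (simp add: carrier_free_algebra)
  show "p ^ k \<in> carrier (free_algebra n)" if "p \<in> carrier (free_algebra n)"
    by (induction k) (auto intro: mult one that)
  show "0 \<in> carrier (free_algebra n)"
    by (simp add: carrier_free_algebra)
  show "const c \<in> carrier (free_algebra n)"
    by (simp add: carrier_free_algebra const_def)
  show "g \<in> qgens n \<Longrightarrow> gen g \<in> carrier (free_algebra n)"
    by (simp add: carrier_free_algebra gen_def)
qed

lemma free_algebra_simps [simp]:
  "p \<oplus>\<^bsub>free_algebra n\<^esub> p' = p + p'" "p \<otimes>\<^bsub>free_algebra n\<^esub> p' = p * p'"
  "\<zero>\<^bsub>free_algebra n\<^esub> = 0" "\<one>\<^bsub>free_algebra n\<^esub> = 1"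
  by (simp_all add: free_algebra_def)

lemma ring_free_algebra: "ring (free_algebra n)"
proof (rule ringI)
  show "abelian_group (free_algebra n)"
    by (rule abelian_groupI) (auto intro: exI[of _ "- _"] bexI[of _ "- _"] simp: add_ac)
  show "monoid (free_algebra n)"
    by (rule monoidI) (auto simp: mult.assoc)
qed (auto simp: algebra_simps)

lemma keys_sum_subset: "(\<And>i. i \<in> A \<Longrightarrow> Poly_Mapping.keys (f i) \<subseteq> S) \<Longrightarrow> Poly_Mapping.keys (sum f A) \<subseteq> S"
  using keys_sum[of f A] by blast

lemma keys_free_act:
  assumes "p \<in> carrier (free_algebra n)" "Poly_Mapping.keys v \<subseteq> Zplus n"
  shows "Poly_Mapping.keys (free_act n q p v) \<subseteq> Zplus n"
  unfolding free_act_def word_act_def[symmetric]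
  using assms
  by (intro keys_sum_subset order_trans[OF keys_scale_subset] keys_word_act) (auto simp: carrier_free_algebra)

lemma gens_in_qgens [intro, simp]:
  assumes "i \<in> {1..n - 1}"
  shows "gen_e i \<in> qgens n" "gen_f i \<in> qgens n" "gen_K i \<in> qgens n" "gen_Kinv i \<in> qgens n"
  using assms by (auto simp: qgens_def)

lemmas free_act_expand = free_act_diff free_act_add free_act_mult free_act_power
  lookup_minus lookup_add lookup_gen_act restrict_Zplus_gen_op

context root_of_unity
begin

section \<open>The defining relations act as zero on nonnegative exponents\<close>

context
  fixes n :: nat and v :: "(nat \<Rightarrow> int) \<Rightarrow>\<^sub>0 'k"
  assumes v: "Poly_Mapping.keys v \<subseteq> Zplus n"
begin

lemma relation_K_inverse:
  assumes "i \<in> {1..n - 1}"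
  shows "free_act n q (gK i * gKinv i - 1) v = 0" "free_act n q (gKinv i * gK i - 1) v = 0"
proof -
  note gens = gens_in_qgens[OF assms]
  have *: "restrict_Zplus n (Poly_Mapping.lookup v) = Poly_Mapping.lookup v"
    by (rule restrict_Zplus_lookup[OF v])
  show "free_act n q (gK i * gKinv i - 1) v = 0" "free_act n q (gKinv i * gK i - 1) v = 0"
    by (rule poly_mapping_eqI, simp add: free_act_expand gens, subst *[symmetric],
        simp add: restrict_Zplus_def mult.assoc[symmetric] powi_add[symmetric])+
qed

lemma relation_K_commute:
  assumes "i \<in> {1..n - 1}" "j \<in> {1..n - 1}"
  shows "free_act n q (gK i * gK j - gK j * gK i) v = 0"
  using gens_in_qgens[OF assms(1)] gens_in_qgens[OF assms(2)]
  by (intro poly_mapping_eqI) (simp add: free_act_expand, simp add: restrict_Zplus_def)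

lemma relation_K_e:
  assumes "i \<in> {1..n - 1}" "j \<in> {1..n - 1}"
  shows "free_act n q (gK i * ge j - const (q powi cartan i j) * ge j * gK i) v = 0"
proof (rule poly_mapping_eqI)
  note gens = gens_in_qgens[OF assms(1)] gens_in_qgens[OF assms(2)]
  fix \<gamma>
  have "q powi (\<gamma> i - \<gamma> (Suc i)) = q powi cartan i j * q powi (\<gamma> i + root_vec j i - (\<gamma> (Suc i) + root_vec j (Suc i)))"
    by (simp only: powi_add[symmetric]) (auto simp: root_vec_def cartan_def)
  then show "Poly_Mapping.lookup (free_act n q (gK i * ge j - const (q powi cartan i j) * ge j * gK i) v) \<gamma> = Poly_Mapping.lookup 0 \<gamma>"
    by (simp add: free_act_expand gens) (simp add: restrict_Zplus_def gen_op_e del: gen_op.simps(1))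
qed

lemma relation_K_f:
  assumes "i \<in> {1..n - 1}" "j \<in> {1..n - 1}"
  shows "free_act n q (gK i * gf j - const (q powi (- cartan i j)) * gf j * gK i) v = 0"
proof (rule poly_mapping_eqI)
  note gens = gens_in_qgens[OF assms(1)] gens_in_qgens[OF assms(2)]
  fix \<gamma>
  have "q powi (\<gamma> i - \<gamma> (Suc i)) = q powi (- cartan i j) * q powi (\<gamma> i - root_vec j i - (\<gamma> (Suc i) - root_vec j (Suc i)))"
    by (simp only: powi_add[symmetric]) (auto simp: root_vec_def cartan_def)
  then show "Poly_Mapping.lookup (free_act n q (gK i * gf j - const (q powi (- cartan i j)) * gf j * gK i) v) \<gamma> = Poly_Mapping.lookup 0 \<gamma>"
    by (simp add: free_act_expand gens del: power_int_minus) (simp add: restrict_Zplus_def gen_op_f del: gen_op.simps(2))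
qed

lemma relation_e_f:
  assumes "i \<in> {1..n - 1}" "j \<in> {1..n - 1}"
  shows "free_act n q (ge i * gf j - gf j * ge i
           - (if i = j then const (1 / (q - inverse q)) * (gK i - gKinv i) else 0)) v = 0"
proof (rule poly_mapping_eqI)
  note gens = gens_in_qgens[OF assms(1)] gens_in_qgens[OF assms(2)]
  fix \<gamma>
  show "Poly_Mapping.lookup (free_act n q (ge i * gf j - gf j * ge i
           - (if i = j then const (1 / (q - inverse q)) * (gK i - gKinv i) else 0)) v) \<gamma> = Poly_Mapping.lookup 0 \<gamma>"
  proof (cases "i = j")
    case True
    have "qint q (\<gamma> i) * qint q (\<gamma> (Suc i) + 1) - qint q (\<gamma> (Suc i)) * qint q (\<gamma> i + 1) =
        (q powi (\<gamma> i - \<gamma> (Suc i)) - q powi (\<gamma> (Suc i) - \<gamma> i)) / (q - inverse q)"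
      unfolding qint_commutator by (simp add: qint_def)
    from arg_cong[OF this, of "\<lambda>x. Poly_Mapping.lookup v \<gamma> * x"] show ?thesis
      using True
      by (simp add: free_act_expand gens)
        (simp add: restrict_Zplus_def gen_op_e gen_op_f root_vec_def algebra_simps diff_divide_distrib
          del: gen_op.simps(1,2))
  next
    case False
    then show ?thesis
      by (simp add: free_act_expand gens)
        (simp add: restrict_Zplus_def gen_op_e gen_op_f algebra_simps root_vec_def del: gen_op.simps)
  qed
qed

lemma relation_commute:
  assumes "i \<in> {1..n - 1}" "j \<in> {1..n - 1}" "cartan i j = 0"
  shows "free_act n q (ge i * ge j - ge j * ge i) v = 0" "free_act n q (gf i * gf j - gf j * gf i) v = 0"
proof -
  note gens = gens_in_qgens[OF assms(1)] gens_in_qgens[OF assms(2)]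
  have rv: "root_vec i j = 0" "root_vec j i = 0" "root_vec i (Suc j) = 0" "root_vec j (Suc i) = 0"
    using assms(3) by (auto simp: cartan_def root_vec_def split: if_splits)
  show "free_act n q (ge i * ge j - ge j * ge i) v = 0" "free_act n q (gf i * gf j - gf j * gf i) v = 0"
    by (rule poly_mapping_eqI, simp add: free_act_expand gens,
        simp add: restrict_Zplus_def gen_op_e gen_op_f rv algebra_simps del: gen_op.simps)+
qed

lemma relation_serre:
  assumes "i \<in> {1..n - 1}" "j \<in> {1..n - 1}" "cartan i j = - 1"
  shows "free_act n q (ge i ^ 2 * ge j - const (qint q 2) * ge i * ge j * ge i + ge j * ge i ^ 2) v = 0"
    "free_act n q (gf i ^ 2 * gf j - const (qint q 2) * gf i * gf j * gf i + gf j * gf i ^ 2) v = 0"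
proof -
  note gens = gens_in_qgens[OF assms(1)] gens_in_qgens[OF assms(2)]
  have ij: "j = i + 1 \<or> i = j + 1"
    using assms(3) by (auto simp: cartan_def split: if_splits)
  show "free_act n q (ge i ^ 2 * ge j - const (qint q 2) * ge i * ge j * ge i + ge j * ge i ^ 2) v = 0"
    "free_act n q (gf i ^ 2 * gf j - const (qint q 2) * gf i * gf j * gf i + gf j * gf i ^ 2) v = 0"
    using gen_op_serre[OF ij, of "Poly_Mapping.lookup v", unfolded eq_diff_eq[symmetric]]
    by (rule_tac poly_mapping_eqI, simp add: free_act_expand power2_eq_square gens del: gen_op.simps,
        simp add: restrict_Zplus_def del: gen_op.simps)+
qed

lemma lookup_gen_act_funpow:
  assumes "g \<in> qgens n"
  shows "Poly_Mapping.lookup ((gen_act n q g ^^ k) v) = restrict_Zplus n ((gen_op q g ^^ k) (Poly_Mapping.lookup v))"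
  using assms by (induction k) (simp_all add: lookup_gen_act restrict_Zplus_gen_op restrict_Zplus_lookup v)

lemma relation_small:
  assumes "i \<in> {1..n - 1}"
  shows "free_act n q (ge i ^ l) v = 0" "free_act n q (gf i ^ l) v = 0"
    "free_act n q (gK i ^ (2 * l) - 1) v = 0"
proof -
  have gen: "free_act n q (gen g) = gen_act n q g" for g
    by (rule ext) simp
  note gens = gens_in_qgens[OF assms]
  have less: "x mod int l < int l" for x
    using l_ge by simp
  show "free_act n q (ge i ^ l) v = 0" "free_act n q (gf i ^ l) v = 0"
    by (rule poly_mapping_eqI, simp add: free_act_power gen lookup_gen_act_funpow gens,
        simp add: restrict_Zplus_def gen_op_e_nilpotent gen_op_f_nilpotent less)+
  have "q powi (int (2 * l) * x) = 1" for x
    using powi_two_eq_1[of "int l * x"] by (simp add: mult.assoc)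
  then have "restrict_Zplus n ((gen_op q (gen_K i) ^^ (2 * l)) (Poly_Mapping.lookup v)) = Poly_Mapping.lookup v"
    by (subst (2) restrict_Zplus_lookup[OF v, symmetric]) (simp add: gen_op_K_power restrict_Zplus_def fun_eq_iff)
  then show "free_act n q (gK i ^ (2 * l) - 1) v = 0"
    by (intro poly_mapping_eqI)
      (simp add: free_act_diff free_act_power gen lookup_minus lookup_gen_act_funpow gens)
qed

end

lemma relation_acts_as_zero:
  assumes p: "p \<in> Uq_relations n q \<union> small_relations n l" and v: "Poly_Mapping.keys v \<subseteq> Zplus n"
  shows "free_act n q p v = 0"
  by (insert p, unfold Uq_relations_def small_relations_def, elim UnE UN_E insertE emptyE CollectE conjE; hypsubst;
      (rule relation_K_inverse[OF v] relation_K_commute[OF v] relation_K_e[OF v] relation_K_f[OF v]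
        relation_e_f[OF v] relation_commute[OF v] relation_serre[OF v] relation_small[OF v]; simp))

lemma relations_subset: "Uq_relations n q \<union> small_relations n l \<subseteq> carrier (free_algebra n)"
proof
  fix p
  assume "p \<in> Uq_relations n q \<union> small_relations n l"
  then show "p \<in> carrier (free_algebra n)"
    unfolding Uq_relations_def small_relations_def
    by (elim UnE UN_E insertE emptyE CollectE conjE; hypsubst)
      ((split if_split)?, (intro conjI impI free_algebra_closed gens_in_qgens; assumption)+)+
qed

end

section \<open>Submodules\<close>

lemma submodule_subset: "submodule H R M \<Longrightarrow> H \<subseteq> carrier M"
  using subgroup.subset[OF submodule.axioms(1)] by force

lemma (in left_module) smult_zero:
  assumes "a \<in> carrier R"
  shows "a \<odot>\<^bsub>M\<^esub> \<zero>\<^bsub>M\<^esub> = \<zero>\<^bsub>M\<^esub>"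
proof -
  have "a \<odot>\<^bsub>M\<^esub> \<zero>\<^bsub>M\<^esub> \<oplus>\<^bsub>M\<^esub> a \<odot>\<^bsub>M\<^esub> \<zero>\<^bsub>M\<^esub> = a \<odot>\<^bsub>M\<^esub> \<zero>\<^bsub>M\<^esub> \<oplus>\<^bsub>M\<^esub> \<zero>\<^bsub>M\<^esub>"
    using assms smult_r_distr[of a "\<zero>\<^bsub>M\<^esub>" "\<zero>\<^bsub>M\<^esub>"] by simp
  then show ?thesis
    using assms by (metis M.add.l_cancel_one M.zero_closed smult_closed)
qed

lemma (in left_module) smult_minus:
  assumes "a \<in> carrier R" "x \<in> carrier M"
  shows "a \<odot>\<^bsub>M\<^esub> (\<ominus>\<^bsub>M\<^esub> x) = \<ominus>\<^bsub>M\<^esub> (a \<odot>\<^bsub>M\<^esub> x)"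
proof -
  have "a \<odot>\<^bsub>M\<^esub> (\<ominus>\<^bsub>M\<^esub> x) \<oplus>\<^bsub>M\<^esub> a \<odot>\<^bsub>M\<^esub> x = \<zero>\<^bsub>M\<^esub>"
    using assms smult_r_distr[of a "\<ominus>\<^bsub>M\<^esub> x" x] smult_zero[of a] by (simp add: M.l_neg)
  then show ?thesis
    using assms by (intro M.minus_equality[symmetric]) auto
qed

lemma (in left_module) submoduleI:
  assumes "H \<subseteq> carrier M" "\<zero>\<^bsub>M\<^esub> \<in> H"
    and "\<And>x. x \<in> H \<Longrightarrow> \<ominus>\<^bsub>M\<^esub> x \<in> H"
    and "\<And>x y. x \<in> H \<Longrightarrow> y \<in> H \<Longrightarrow> x \<oplus>\<^bsub>M\<^esub> y \<in> H"
    and "\<And>a x. a \<in> carrier R \<Longrightarrow> x \<in> H \<Longrightarrow> a \<odot>\<^bsub>M\<^esub> x \<in> H"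
  shows "submodule H R M"
  using assms by (intro submodule.intro subgroup.intro submodule_axioms.intro) (auto simp: a_inv_def)

text \<open>These are the preimages in \<open>M\<close> of the simple submodules of
  \<open>M / N\<close>.\<close>

definition atom_over ::
  "'a set \<Rightarrow> ('r, 'c) ring_scheme \<Rightarrow> ('r, 'a, 'd) module_scheme \<Rightarrow> 'a set \<Rightarrow> bool" where
  "atom_over N R M T \<longleftrightarrow> submodule T R M \<and> N \<subset> T \<and>
     (\<forall>H. submodule H R M \<longrightarrow> N \<subset> H \<longrightarrow> H \<subseteq> T \<longrightarrow> H = T)"

section \<open>Quotient modules and the correspondence of submodules\<close>

locale quotient = left_module R M for R (structure) and M (structure) +
  fixes N
  assumes N: "submodule N R M"
begin

sublocale N: abelian_subgroup N M
  by (rule abelian_subgroupI3)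
    (use N in \<open>auto simp: submodule_def additive_subgroup_def intro: M.abelian_group_axioms\<close>)

abbreviation coset where "coset x \<equiv> N +>\<^bsub>M\<^esub> x"

abbreviation MN where "MN \<equiv> quotient_module M N"

lemma carrier_MN: "X \<in> carrier MN \<longleftrightarrow> (\<exists>x\<in>carrier M. X = coset x)"
  by (auto simp: quotient_module_def A_RCOSETS_def')

lemma zero_MN: "\<zero>\<^bsub>MN\<^esub> = N"
  by (simp add: quotient_module_def)

lemma add_MN:
  assumes "x \<in> carrier M" "y \<in> carrier M"
  shows "coset x \<oplus>\<^bsub>MN\<^esub> coset y = coset (x \<oplus>\<^bsub>M\<^esub> y)"
  using assms by (simp add: quotient_module_def N.a_rcos_sum)

lemma coset_eq:
  assumes "x \<in> carrier M" "y \<in> carrier M"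
  shows "coset x = coset y \<longleftrightarrow> x \<oplus>\<^bsub>M\<^esub> (\<ominus>\<^bsub>M\<^esub> y) \<in> N"
proof -
  have "coset x = coset y \<longleftrightarrow> x \<in> coset y"
    using N.a_rcos_self[OF assms(1)] N.a_repr_independence'[OF _ assms(2), of x] by auto
  then show ?thesis
    using N.a_rcos_module[OF assms(2,1)] by simp
qed

lemma coset_eq_N: "x \<in> carrier M \<Longrightarrow> coset x = N \<longleftrightarrow> x \<in> N"
  using N.a_rcos_const[of x] N.a_rcos_self[of x] by auto

text \<open>The quotient forms a union over all representatives. Two of them differ by an element of
  \<open>N\<close>, which is closed under scalars, so all cosets in the union coincide.\<close>

lemma smult_MN:
  assumes "a \<in> carrier R" "x \<in> carrier M"
  shows "a \<odot>\<^bsub>MN\<^esub> coset x = coset (a \<odot>\<^bsub>M\<^esub> x)"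
proof -
  have "coset (a \<odot>\<^bsub>M\<^esub> x') = coset (a \<odot>\<^bsub>M\<^esub> x)" if "x' \<in> coset x" for x'
  proof -
    have x': "x' \<in> carrier M"
      using that M.a_r_coset_subset_G[OF N.a_subset assms(2)] by blast
    have "x' \<oplus>\<^bsub>M\<^esub> (\<ominus>\<^bsub>M\<^esub> x) \<in> N"
      using that N.a_rcos_module[OF assms(2) x'] by simp
    then have "a \<odot>\<^bsub>M\<^esub> (x' \<oplus>\<^bsub>M\<^esub> (\<ominus>\<^bsub>M\<^esub> x)) \<in> N"
      by (rule submodule.smult_closed[OF N assms(1)])
    then show ?thesis
      using assms x' by (simp add: coset_eq smult_r_distr smult_minus)
  qed
  moreover have "x \<in> coset x"
    using assms N.a_rcos_self by blast
  ultimately have "(\<Union>x'\<in>coset x. coset (a \<odot>\<^bsub>M\<^esub> x')) = coset (a \<odot>\<^bsub>M\<^esub> x)"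
    by (intro UN_constant_eq ballI)
  then show ?thesis
    by (simp add: quotient_module_def)
qed

lemma minus_MN:
  assumes "x \<in> carrier M"
  shows "inv\<^bsub>add_monoid MN\<^esub> coset x = coset (\<ominus>\<^bsub>M\<^esub> x)"
proof -
  have zero: "coset \<zero>\<^bsub>M\<^esub> = N"
    using coset_eq_N[of "\<zero>\<^bsub>M\<^esub>"] by simp
  \<comment> \<open>Submodules are defined through inverses in the additive monoid, so inverses in
    the quotient must be known to be unique before they can be computed.\<close>
  have "group (add_monoid MN)"
  proof (rule groupI)
    fix X Y
    assume X: "X \<in> carrier (add_monoid MN)"
    then obtain x where x: "x \<in> carrier M" "X = coset x"
      using carrier_MN by auto
    have "coset (\<ominus>\<^bsub>M\<^esub> x) \<oplus>\<^bsub>MN\<^esub> X = N"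
      using x by (simp add: add_MN M.l_neg zero)
    then show "\<exists>Y\<in>carrier (add_monoid MN). Y \<otimes>\<^bsub>add_monoid MN\<^esub> X = \<one>\<^bsub>add_monoid MN\<^esub>"
      using x by (intro bexI[of _ "coset (\<ominus>\<^bsub>M\<^esub> x)"]) (auto simp: zero_MN carrier_MN)
    have "coset \<zero>\<^bsub>M\<^esub> \<oplus>\<^bsub>MN\<^esub> X = X"
      using x by (simp only: add_MN M.zero_closed M.l_zero)
    then show "\<one>\<^bsub>add_monoid MN\<^esub> \<otimes>\<^bsub>add_monoid MN\<^esub> X = X"
      by (simp add: zero zero_MN)
    assume "Y \<in> carrier (add_monoid MN)"
    then obtain y where y: "y \<in> carrier M" "Y = coset y"
      using carrier_MN by auto
    show "X \<otimes>\<^bsub>add_monoid MN\<^esub> Y \<in> carrier (add_monoid MN)"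
      using x y by (auto simp: add_MN carrier_MN)
    fix Z
    assume "Z \<in> carrier (add_monoid MN)"
    then obtain z where z: "z \<in> carrier M" "Z = coset z"
      using carrier_MN by auto
    show "X \<otimes>\<^bsub>add_monoid MN\<^esub> Y \<otimes>\<^bsub>add_monoid MN\<^esub> Z = X \<otimes>\<^bsub>add_monoid MN\<^esub> (Y \<otimes>\<^bsub>add_monoid MN\<^esub> Z)"
      using x y z by (simp add: add_MN M.a_assoc)
  next
    show "\<one>\<^bsub>add_monoid MN\<^esub> \<in> carrier (add_monoid MN)"
      using zero by (auto simp: zero_MN carrier_MN)
  qed
  moreover have "coset (\<ominus>\<^bsub>M\<^esub> x) \<oplus>\<^bsub>MN\<^esub> coset x = \<zero>\<^bsub>MN\<^esub>"
    using assms coset_eq_N[of "\<zero>\<^bsub>M\<^esub>"] by (simp add: add_MN M.l_neg zero_MN)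
  ultimately show ?thesis
    using assms carrier_MN by (intro group.inv_equality) auto
qed

lemma submodule_vimage:
  assumes "submodule H R MN"
  shows "submodule {x \<in> carrier M. coset x \<in> H} R M"
proof -
  interpret H: submodule H R MN
    by fact
  show ?thesis
  proof (rule submoduleI)
    show "\<zero>\<^bsub>M\<^esub> \<in> {x \<in> carrier M. coset x \<in> H}"
      using H.one_closed coset_eq_N[of "\<zero>\<^bsub>M\<^esub>"] by (simp add: zero_MN)
    show "\<ominus>\<^bsub>M\<^esub> x \<in> {x \<in> carrier M. coset x \<in> H}" if "x \<in> {x \<in> carrier M. coset x \<in> H}" for x
      using that H.m_inv_closed[of "coset x"] by (simp add: minus_MN)
    show "x \<oplus>\<^bsub>M\<^esub> y \<in> {x \<in> carrier M. coset x \<in> H}"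
      if "x \<in> {x \<in> carrier M. coset x \<in> H}" "y \<in> {x \<in> carrier M. coset x \<in> H}" for x y
      using that H.m_closed[of "coset x" "coset y"] by (simp add: add_MN)
    show "a \<odot>\<^bsub>M\<^esub> x \<in> {x \<in> carrier M. coset x \<in> H}"
      if "a \<in> carrier R" "x \<in> {x \<in> carrier M. coset x \<in> H}" for a x
      using that H.smult_closed[of a "coset x"] by (simp add: smult_MN)
  qed auto
qed

lemma submodule_image:
  assumes "submodule H R M"
  shows "submodule (coset ` H) R MN"
proof -
  interpret H: submodule H R M
    by fact
  have H: "x \<in> carrier M" if "x \<in> H" for x
    using that submodule_subset[OF assms] by blast
  show ?thesis
  proof (intro submodule.intro subgroup.intro submodule_axioms.intro)
    show "coset ` H \<subseteq> carrier (add_monoid MN)"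
    proof
      fix X
      assume "X \<in> coset ` H"
      then show "X \<in> carrier (add_monoid MN)"
        using H carrier_MN[of X] by auto
    qed
    show "\<one>\<^bsub>add_monoid MN\<^esub> \<in> coset ` H"
      using imageI[OF H.one_closed, of coset] coset_eq_N[of "\<zero>\<^bsub>M\<^esub>"] by (simp add: zero_MN)
    show "X \<otimes>\<^bsub>add_monoid MN\<^esub> Y \<in> coset ` H" if XY: "X \<in> coset ` H" "Y \<in> coset ` H" for X Y
    proof -
      obtain x y where "x \<in> H" "y \<in> H" "X = coset x" "Y = coset y"
        using XY by blast
      then show ?thesis
        using imageI[OF H.m_closed[of x y], of coset] H by (simp add: add_MN)
    qed
    show "inv\<^bsub>add_monoid MN\<^esub> X \<in> coset ` H" if X: "X \<in> coset ` H" for X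
    proof -
      obtain x where "x \<in> H" "X = coset x"
        using X by blast
      then show ?thesis
        using imageI[OF H.m_inv_closed[of x, folded a_inv_def], of coset] minus_MN[OF H[of x]] by metis
    qed
    show "a \<odot>\<^bsub>MN\<^esub> X \<in> coset ` H" if aX: "a \<in> carrier R" "X \<in> coset ` H" for a X
    proof -
      obtain x where "x \<in> H" "X = coset x"
        using aX(2) by blast
      then show ?thesis
        using imageI[OF H.smult_closed[of a x], of coset] H aX by (simp add: smult_MN)
    qed
  qed
qed

lemma coset_in_image_iff:
  assumes "submodule H R M" "N \<subseteq> H" "x \<in> carrier M"
  shows "coset x \<in> coset ` H \<longleftrightarrow> x \<in> H"
proof
  assume "coset x \<in> coset ` H"
  then obtain h where h: "h \<in> H" "coset x = coset h"
    by blast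
  have hM: "h \<in> carrier M"
    using h submodule_subset[OF assms(1)] by blast
  have "x \<oplus>\<^bsub>M\<^esub> (\<ominus>\<^bsub>M\<^esub> h) \<in> H"
    using coset_eq[OF assms(3) hM] h(2) assms(2) by blast
  then have "x \<oplus>\<^bsub>M\<^esub> (\<ominus>\<^bsub>M\<^esub> h) \<oplus>\<^bsub>M\<^esub> h \<in> H"
    using h(1) subgroup.m_closed[OF submodule.axioms(1)[OF assms(1)]] by simp
  then show "x \<in> H"
    using hM assms(3) by (simp add: M.a_assoc M.l_neg)
qed auto

text \<open>Taking images and preimages matches the submodules of \<open>M / N\<close> with those of
  \<open>M\<close> above \<open>N\<close>, and simple ones with atoms over \<open>N\<close>. So the
  preimage of the socle is the least submodule above \<open>N\<close> that contains all atoms;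
  \<open>le\<close> and \<open>ge\<close> characterise \<open>P\<close> as that one.\<close>

lemma Soc_quotient:
  assumes P: "submodule P R M" "N \<subseteq> P"
    and le: "\<And>T. atom_over N R M T \<Longrightarrow> T \<subseteq> P"
    and ge: "\<And>H. submodule H R M \<Longrightarrow> N \<subseteq> H \<Longrightarrow> (\<And>T. atom_over N R M T \<Longrightarrow> T \<subseteq> H) \<Longrightarrow> P \<subseteq> H"
  shows "{x \<in> carrier M. coset x \<in> Soc R MN} = P"
proof (intro equalityI subsetI)
  fix x
  assume "x \<in> {x \<in> carrier M. coset x \<in> Soc R MN}"
  then have x: "x \<in> carrier M" "coset x \<in> Soc R MN"
    by auto
  have "S \<subseteq> coset ` P" if S: "simple_submodule S R MN" for S
  proof -
    define T where "T = {x \<in> carrier M. coset x \<in> S}"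
    have sub: "submodule S R MN" and "S \<noteq> {N}"
      and simple: "\<And>H. submodule H R MN \<Longrightarrow> H \<subseteq> S \<Longrightarrow> H = {N} \<or> H = S"
      using S by (auto simp: simple_submodule_def zero_MN)
    have S_T: "S = coset ` T"
      using submodule_subset[OF sub] by (force simp: T_def carrier_MN)
    have N_S: "N \<in> S"
      using subgroup.one_closed[OF submodule.axioms(1)[OF sub]] by (simp add: zero_MN)
    have "atom_over N R M T"
      unfolding atom_over_def
    proof (intro conjI allI impI psubsetI)
      show "submodule T R M"
        unfolding T_def by (rule submodule_vimage[OF sub])
      show "N \<subseteq> T"
        using N_S N.a_rcos_const N.a_subset by (auto simp: T_def)
      show "N \<noteq> T"
      proof
        assume "N = T"
        then have "\<forall>X\<in>S. X = N"
          unfolding S_T using coset_eq_N N.a_subset by blast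
        then show False
          using N_S \<open>S \<noteq> {N}\<close> by blast
      qed
      fix H
      assume H: "submodule H R M" "N \<subset> H" "H \<subseteq> T"
      have "coset ` H \<subseteq> S"
      proof
        fix X
        assume "X \<in> coset ` H"
        then obtain h where "h \<in> H" "X = coset h"
          by blast
        then show "X \<in> S"
          using subsetD[OF H(3), of h] by (simp add: T_def)
      qed
      note image = submodule_image[OF H(1)]
      have "coset ` H = {N} \<or> coset ` H = S"
        by (rule simple) fact+
      then show "H = T"
      proof
        assume 1: "coset ` H = {N}"
        have "h \<in> N" if "h \<in> H" for h
          using that 1 coset_eq_N[of h] subsetD[OF submodule_subset[OF H(1)] that] by blast
        then show ?thesis
          using H(2) by blast
      next
        assume 2: "coset ` H = S"
        have "t \<in> H" if "t \<in> T" for t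
          using that 2 coset_in_image_iff[OF H(1) psubset_imp_subset[OF H(2)], of t] by (simp add: T_def)
        then show ?thesis
          using H(3) by blast
      qed
    qed
    then show ?thesis
      using le S_T by blast
  qed
  then have "coset x \<in> coset ` P"
    using x(2) submodule_image[OF P(1)] unfolding Soc_def by blast
  then show "x \<in> P"
    using coset_in_image_iff[OF P x(1)] by simp
next
  fix x
  assume "x \<in> P"
  then have x: "x \<in> carrier M"
    using submodule_subset[OF P(1)] by blast
  have "coset x \<in> H'" if H': "submodule H' R MN" "\<And>S. simple_submodule S R MN \<Longrightarrow> S \<subseteq> H'" for H'
  proof -
    define H where "H = {x \<in> carrier M. coset x \<in> H'}"
    have H: "submodule H R M"
      unfolding H_def by (rule submodule_vimage[OF H'(1)])
    have N_H': "N \<in> H''" if "submodule H'' R MN" for H''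
      using subgroup.one_closed[OF submodule.axioms(1)[OF that]] by (simp add: zero_MN)
    have N_le: "N \<subseteq> {x \<in> carrier M. coset x \<in> H''}" if "submodule H'' R MN" for H''
      using N_H'[OF that] N.a_rcos_const N.a_subset by auto
    have "T \<subseteq> H" if T: "atom_over N R M T" for T
    proof -
      have sub: "submodule T R M" and NT: "N \<subset> T"
        and atom: "\<And>H. submodule H R M \<Longrightarrow> N \<subset> H \<Longrightarrow> H \<subseteq> T \<Longrightarrow> H = T"
        using T by (auto simp: atom_over_def)
      have T_M: "T \<subseteq> carrier M"
        using submodule_subset[OF sub] .
      have "simple_submodule (coset ` T) R MN"
        unfolding simple_submodule_def zero_MN
      proof (intro conjI allI impI)
        show "submodule (coset ` T) R MN"
          by (rule submodule_image[OF sub])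
        show "coset ` T \<noteq> {N}"
        proof
          assume 1: "coset ` T = {N}"
          have "t \<in> N" if "t \<in> T" for t
            using that 1 coset_eq_N[of t] subsetD[OF T_M that] by blast
          then show False
            using NT by blast
        qed
        fix H''
        assume H'': "submodule H'' R MN" "H'' \<subseteq> coset ` T"
        define K where "K = {x \<in> carrier M. coset x \<in> H''}"
        have K: "submodule K R M" "N \<subseteq> K"
          unfolding K_def using submodule_vimage N_le H''(1) by auto
        have H''_K: "H'' = coset ` K"
          using submodule_subset[OF H''(1)] by (force simp: K_def carrier_MN)
        have "K \<subseteq> T"
        proof
          fix y
          assume "y \<in> K"
          then show "y \<in> T"
            using subsetD[OF H''(2), of "coset y"] coset_in_image_iff[OF sub psubset_imp_subset[OF NT], of y]
            by (simp add: K_def)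
        qed
        show "H'' = {N} \<or> H'' = coset ` T"
        proof (cases "K = N")
          case True
          then have "\<forall>X\<in>H''. X = N"
            unfolding H''_K using coset_eq_N N.a_subset by blast
          then show ?thesis
            using N_H'[OF H''(1)] by blast
        next
          case False
          then have "K = T"
            using atom[OF K(1)] K(2) \<open>K \<subseteq> T\<close> by blast
          then show ?thesis
            using H''_K by simp
        qed
      qed
      then show "T \<subseteq> H"
      proof -
        assume S: "simple_submodule (coset ` T) R MN"
        show "T \<subseteq> H"
          using H'(2)[OF S] T_M unfolding H_def by blast
      qed
    qed
    then have "P \<subseteq> H"
      using ge[OF H] N_le[OF H'(1)] by (simp add: H_def)
    then show ?thesis
      using \<open>x \<in> P\<close> by (auto simp: H_def)
  qed
  then show "x \<in> {x \<in> carrier M. coset x \<in> Soc R MN}"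
    using x unfolding Soc_def by blast
qed

end

section \<open>Modules over the small quantum group\<close>

definition supported :: "'b set \<Rightarrow> ('b \<Rightarrow>\<^sub>0 'k::zero) set" where
  "supported B = {v. Poly_Mapping.keys v \<subseteq> B}"

lemma in_supported: "v \<in> supported B \<longleftrightarrow> (\<forall>\<gamma>. Poly_Mapping.lookup v \<gamma> \<noteq> 0 \<longrightarrow> \<gamma> \<in> B)"
  by (auto simp: supported_def in_keys_iff)

lemma supported_mono: "B \<subseteq> C \<Longrightarrow> supported B \<subseteq> supported C"
  by (auto simp: supported_def)

lemma subspace_supported: "scale.subspace (supported B)"
  by (auto simp: scale.subspace_def in_supported lookup_add) (metis add.right_neutral)

text \<open>Invariance under single generators is what can be checked on exponents;
  \<open>submodule_uq_module_iff\<close> identifies it with being a submodule over the quotient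
  algebra.\<close>

definition stable :: "nat \<Rightarrow> 'k::field \<Rightarrow> ((nat \<Rightarrow> int) \<Rightarrow>\<^sub>0 'k) set \<Rightarrow> bool" where
  "stable n q H \<longleftrightarrow> scale.subspace H \<and> (\<forall>g\<in>qgens n. \<forall>v\<in>H. gen_act n q g v \<in> H)"

definition uq_module ::
  "nat \<Rightarrow> 'k::field \<Rightarrow> ((nat \<Rightarrow> int) \<Rightarrow>\<^sub>0 'k) set \<Rightarrow> ((qword \<Rightarrow>\<^sub>0 'k) set, (nat \<Rightarrow> int) \<Rightarrow>\<^sub>0 'k) module" where
  "uq_module n q C = (Aq n q)\<lparr>carrier := C\<rparr>"

lemma uq_module_simps [simp]:
  "carrier (uq_module n q C) = C" "\<zero>\<^bsub>uq_module n q C\<^esub> = 0"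
  "x \<oplus>\<^bsub>uq_module n q C\<^esub> y = x + y"
  "smult (uq_module n q C) = smult (Aq n q)"
  by (simp_all add: uq_module_def Aq_def)

lemma uq_module_update [simp]: "(uq_module n q C)\<lparr>carrier := D\<rparr> = uq_module n q D"
  by (simp add: uq_module_def)

lemma stable_free_act:
  assumes "stable n q H" "p \<in> carrier (free_algebra n)" "v \<in> H"
  shows "free_act n q p v \<in> H"
proof -
  have "word_act n q gs v \<in> H" if "set gs \<subseteq> qgens n" for gs
    using that assms by (induction gs) (auto simp: word_act_def stable_def)
  then show ?thesis
    unfolding free_act_def word_act_def[symmetric]
    using assms by (intro scale.subspace_sum scale.subspace_scale)
      (auto simp: stable_def carrier_free_algebra)
qed

lemma stable_inter: "stable n q H \<Longrightarrow> stable n q H' \<Longrightarrow> stable n q (H \<inter> H')"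
  by (auto simp: stable_def scale.subspace_inter)

context root_of_unity
begin

abbreviation (input) "rels n \<equiv> Uq_relations n q \<union> small_relations n l"

lemma ideal_rels: "ideal (genideal (free_algebra n) (rels n)) (free_algebra n)"
  by (rule ring.genideal_ideal[OF ring_free_algebra relations_subset])

lemma ring_small_uq: "ring (small_uq n q l)"
  unfolding small_uq_def by (rule ideal.quotient_is_ring[OF ideal_rels])

lemma genideal_acts_as_zero:
  assumes "p \<in> genideal (free_algebra n) (rels n)" "Poly_Mapping.keys v \<subseteq> Zplus n"
  shows "free_act n q p v = 0"
proof -
  \<comment> \<open>The annihilator of all vectors with nonnegative exponents. It is a two-sided
    ideal because the action preserves this set of vectors, and it contains the relations.\<close>
  define K where "K = {p \<in> carrier (free_algebra n). \<forall>v. Poly_Mapping.keys v \<subseteq> Zplus n \<longrightarrow> free_act n q p v = 0}"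
  have "subgroup K (add_monoid (free_algebra n))"
  proof (rule group.subgroupI)
    show "group (add_monoid (free_algebra n))"
      using ring_free_algebra abelian_group.a_group ring_def by blast
    fix p
    assume p: "p \<in> K"
    have "inv\<^bsub>add_monoid (free_algebra n)\<^esub> p = - p"
      using p ring_free_algebra free_algebra_closed
      by (intro group.inv_equality[OF \<open>group (add_monoid (free_algebra n))\<close>]) (auto simp: K_def)
    then show "inv\<^bsub>add_monoid (free_algebra n)\<^esub> p \<in> K"
      using p by (auto simp: K_def free_act_uminus)
  qed (auto simp: K_def free_act_add)
  then have "ideal K (free_algebra n)"
  proof (rule idealI[OF ring_free_algebra])
    fix p r :: "qword \<Rightarrow>\<^sub>0 'k"
    assume "p \<in> K" "r \<in> carrier (free_algebra n)"
    then show "r \<otimes>\<^bsub>free_algebra n\<^esub> p \<in> K" "p \<otimes>\<^bsub>free_algebra n\<^esub> r \<in> K"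
      by (auto simp: K_def free_act_mult keys_free_act)
  qed
  moreover have "rels n \<subseteq> K"
    using relations_subset relation_acts_as_zero by (auto simp: K_def)
  ultimately have "genideal (free_algebra n) (rels n) \<subseteq> K"
    by (rule ring.genideal_minimal[OF ring_free_algebra])
  then show ?thesis
    using assms by (auto simp: K_def)
qed

definition uq_class :: "nat \<Rightarrow> (qword \<Rightarrow>\<^sub>0 'k) \<Rightarrow> (qword \<Rightarrow>\<^sub>0 'k) set" where
  "uq_class n p = genideal (free_algebra n) (rels n) +>\<^bsub>free_algebra n\<^esub> p"

lemma carrier_small_uq: "carrier (small_uq n q l) = uq_class n ` carrier (free_algebra n)"
  by (auto simp: small_uq_def FactRing_def A_RCOSETS_def' uq_class_def)

lemma small_uq_ops:
  assumes "p \<in> carrier (free_algebra n)" "p' \<in> carrier (free_algebra n)"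
  shows "uq_class n p \<oplus>\<^bsub>small_uq n q l\<^esub> uq_class n p' = uq_class n (p + p')"
    and "uq_class n p \<otimes>\<^bsub>small_uq n q l\<^esub> uq_class n p' = uq_class n (p * p')"
    and "\<one>\<^bsub>small_uq n q l\<^esub> = uq_class n 1"
  using assms ideal.rcoset_mult_add[OF ideal_rels] ideal.a_rcos_sum[OF ideal_rels]
  by (simp_all add: small_uq_def FactRing_def uq_class_def)

text \<open>Representatives of a class differ by an element of the ideal, which acts as zero; hence
  the set of values is a singleton and \<open>the_elem\<close> is meaningful.\<close>

lemma smult_uq_class:
  assumes p: "p \<in> carrier (free_algebra n)" and v: "Poly_Mapping.keys v \<subseteq> Zplus n"
  shows "uq_class n p \<odot>\<^bsub>Aq n q\<^esub> v = free_act n q p v"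
proof -
  interpret I: ideal "genideal (free_algebra n) (rels n)" "free_algebra n"
    by (rule ideal_rels)
  have "(\<lambda>p. free_act n q p v) ` uq_class n p = {free_act n q p v}"
  proof -
    have "free_act n q p' v = free_act n q p v" if p': "p' \<in> uq_class n p" for p'
    proof -
      obtain h where "h \<in> genideal (free_algebra n) (rels n)" "p' = h + p"
        using p' by (auto simp: uq_class_def a_r_coset_def' free_algebra_def)
      then show ?thesis
        using genideal_acts_as_zero[OF _ v] by (simp add: free_act_add)
    qed
    moreover have "p \<in> uq_class n p"
      unfolding uq_class_def by (rule I.a_rcos_self[OF p])
    ultimately show ?thesis
      by blast
  qed
  then show ?thesis
    by (simp add: Aq_def)
qed

context
  fixes n and C :: "((nat \<Rightarrow> int) \<Rightarrow>\<^sub>0 'k) set"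
  assumes C: "stable n q C" "C \<subseteq> supported (Zplus n)"
begin

lemma smult_uq_class_carrier:
  assumes p: "p \<in> carrier (free_algebra n)" and v: "v \<in> C"
  shows "uq_class n p \<odot>\<^bsub>Aq n q\<^esub> v = free_act n q p v"
  using assms C(2) by (intro smult_uq_class) (auto simp: supported_def)

lemma left_module_uq_module: "left_module (small_uq n q l) (uq_module n q C)"
proof -
  have sub: "scale.subspace C"
    using C by (simp add: stable_def)
  interpret R: ring "small_uq n q l"
    by (rule ring_small_uq)
  interpret M: abelian_group "uq_module n q C"
  proof (rule abelian_groupI)
    fix x
    assume "x \<in> carrier (uq_module n q C)"
    then show "\<exists>y\<in>carrier (uq_module n q C). y \<oplus>\<^bsub>uq_module n q C\<^esub> x = \<zero>\<^bsub>uq_module n q C\<^esub>"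
      using scale.subspace_neg[OF sub, of x] by (intro bexI[of _ "- x"]) auto
  qed (use sub in \<open>auto simp: add_ac scale.subspace_def\<close>)
  show ?thesis
  proof
    fix a x
    assume "a \<in> carrier (small_uq n q l)" "x \<in> carrier (uq_module n q C)"
    then show "a \<odot>\<^bsub>uq_module n q C\<^esub> x \<in> carrier (uq_module n q C)"
      by (auto simp: carrier_small_uq smult_uq_class_carrier stable_free_act[OF C(1)])
  next
    fix a b x
    assume "a \<in> carrier (small_uq n q l)" "b \<in> carrier (small_uq n q l)" "x \<in> carrier (uq_module n q C)"
    then show "(a \<oplus>\<^bsub>small_uq n q l\<^esub> b) \<odot>\<^bsub>uq_module n q C\<^esub> x =
        a \<odot>\<^bsub>uq_module n q C\<^esub> x \<oplus>\<^bsub>uq_module n q C\<^esub> b \<odot>\<^bsub>uq_module n q C\<^esub> x"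
      "(a \<otimes>\<^bsub>small_uq n q l\<^esub> b) \<odot>\<^bsub>uq_module n q C\<^esub> x =
        a \<odot>\<^bsub>uq_module n q C\<^esub> (b \<odot>\<^bsub>uq_module n q C\<^esub> x)"
      by (auto simp: carrier_small_uq smult_uq_class_carrier small_uq_ops free_act_add
          free_act_mult free_algebra_closed stable_free_act[OF C(1)])
  next
    fix a x y
    assume "a \<in> carrier (small_uq n q l)" "x \<in> carrier (uq_module n q C)" "y \<in> carrier (uq_module n q C)"
    then show "a \<odot>\<^bsub>uq_module n q C\<^esub> (x \<oplus>\<^bsub>uq_module n q C\<^esub> y) =
        a \<odot>\<^bsub>uq_module n q C\<^esub> x \<oplus>\<^bsub>uq_module n q C\<^esub> a \<odot>\<^bsub>uq_module n q C\<^esub> y"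
      by (auto simp: carrier_small_uq smult_uq_class_carrier free_act_add_right scale.subspace_add[OF sub])
  next
    fix x
    assume "x \<in> carrier (uq_module n q C)"
    then show "\<one>\<^bsub>small_uq n q l\<^esub> \<odot>\<^bsub>uq_module n q C\<^esub> x = x"
      using small_uq_ops(3)[of 0 n 0] by (simp add: smult_uq_class_carrier free_algebra_closed)
  qed
qed

lemma submodule_uq_module_iff:
  "submodule H (small_uq n q l) (uq_module n q C) \<longleftrightarrow> stable n q H \<and> H \<subseteq> C"
proof
  assume H: "submodule H (small_uq n q l) (uq_module n q C)"
  interpret H: submodule H "small_uq n q l" "uq_module n q C"
    by (rule H)
  have sub: "H \<subseteq> C"
    using submodule_subset[OF H] by simp
  have act: "free_act n q p v \<in> H" if "p \<in> carrier (free_algebra n)" "v \<in> H" for p v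
  proof -
    have "uq_class n p \<in> carrier (small_uq n q l)"
      using that by (simp add: carrier_small_uq)
    from H.smult_closed[OF this that(2)] show ?thesis
      using smult_uq_class_carrier[OF that(1) subsetD[OF sub that(2)]] by simp
  qed
  \<comment> \<open>The field acts through the classes of the constants, so closure under the
    algebra already gives a linear subspace.\<close>
  have "scale.subspace H"
    using H.one_closed H.m_closed act[OF free_algebra_closed(8)] by (auto simp: scale.subspace_def)
  moreover have "gen_act n q g v \<in> H" if "g \<in> qgens n" "v \<in> H" for g v
    using act[OF free_algebra_closed(9)[OF that(1)] that(2)] by simp
  ultimately show "stable n q H \<and> H \<subseteq> C"
    using sub by (simp add: stable_def)
next
  assume H: "stable n q H \<and> H \<subseteq> C"
  then have sub: "scale.subspace H"
    by (simp add: stable_def)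
  interpret left_module "small_uq n q l" "uq_module n q C"
    by (rule left_module_uq_module)
  show "submodule H (small_uq n q l) (uq_module n q C)"
  proof (rule submoduleI)
    fix x
    assume x: "x \<in> H"
    have "\<ominus>\<^bsub>uq_module n q C\<^esub> x = - x"
      using x H scale.subspace_neg[OF sub x] by (intro M.minus_equality) auto
    then show "\<ominus>\<^bsub>uq_module n q C\<^esub> x \<in> H"
      using scale.subspace_neg[OF sub x] by simp
  next
    fix a x
    assume "a \<in> carrier (small_uq n q l)" "x \<in> H"
    then show "a \<odot>\<^bsub>uq_module n q C\<^esub> x \<in> H"
      using H by (auto simp: carrier_small_uq smult_uq_class_carrier subset_iff stable_free_act)
  qed (use H sub in \<open>auto simp: scale.subspace_def\<close>)
qed

end

end

lemma span_x_pow: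
  assumes "B \<subseteq> Zplus n"
  shows "scale.span (x_pow n ` B) = (supported B :: ((nat \<Rightarrow> int) \<Rightarrow>\<^sub>0 'k::field) set)"
proof (intro equalityI subsetI)
  fix v :: "(nat \<Rightarrow> int) \<Rightarrow>\<^sub>0 'k"
  assume "v \<in> scale.span (x_pow n ` B)"
  then show "v \<in> supported B"
  proof (rule scale.span_induct)
    show "x \<in> supported B" if "x \<in> x_pow n ` B" for x :: "(nat \<Rightarrow> int) \<Rightarrow>\<^sub>0 'k"
      using that assms by (auto simp: in_supported lookup_x_pow split: if_splits)
  qed (simp_all add: subspace_supported)
next
  fix v :: "(nat \<Rightarrow> int) \<Rightarrow>\<^sub>0 'k"
  assume v: "v \<in> supported B"
  have "v = (\<Sum>\<beta>\<in>Poly_Mapping.keys v. scale (Poly_Mapping.lookup v \<beta>) (x_pow n \<beta>))"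
  proof (rule poly_mapping_eqI)
    fix \<gamma>
    have "(\<Sum>\<beta>\<in>Poly_Mapping.keys v. Poly_Mapping.lookup v \<beta> * Poly_Mapping.lookup (x_pow n \<beta> :: _ \<Rightarrow>\<^sub>0 'k) \<gamma>) =
        (\<Sum>\<beta>\<in>Poly_Mapping.keys v. if \<beta> = \<gamma> then Poly_Mapping.lookup v \<beta> else 0)"
      using v assms by (intro sum.cong) (auto simp: lookup_x_pow supported_def)
    then show "Poly_Mapping.lookup v \<gamma> =
        Poly_Mapping.lookup (\<Sum>\<beta>\<in>Poly_Mapping.keys v. scale (Poly_Mapping.lookup v \<beta>) (x_pow n \<beta>)) \<gamma>"
      by (simp add: lookup_sum sum.delta' in_keys_iff)
  qed
  also have "\<dots> \<in> scale.span (x_pow n ` B)"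
    using v by (intro scale.span_sum scale.span_scale scale.span_base) (auto simp: supported_def)
  finally show "v \<in> scale.span (x_pow n ` B)" .
qed

lemma Zplus_trunc_subset: "Zplus_trunc n l m s \<subseteq> Zplus n"
  by (auto simp: Zplus_trunc_def)

lemma Aq_trunc_eq: "Aq_trunc n q l m s = uq_module n q (supported (Zplus_trunc n l m s))"
  unfolding Aq_trunc_def uq_module_def span_x_pow[OF Zplus_trunc_subset] ..

section \<open>Moves between exponents\<close>

lemma div_mod_add_1:
  fixes x L :: int
  assumes "L > 0" "\<not> L dvd x + 1"
  shows "(x + 1) div L = x div L" "(x + 1) mod L = x mod L + 1"
proof -
  have "x mod L \<noteq> L - 1"
  proof
    assume "x mod L = L - 1"
    then have "x + 1 = L * (x div L + 1)"
      using mult_div_mod_eq[of L x] unfolding distrib_left by linarith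
    then show False
      using assms(2) by (metis dvd_triv_left)
  qed
  moreover have "0 \<le> x mod L" "x mod L < L"
    using assms(1) by simp_all
  ultimately have *: "0 \<le> x mod L + 1" "x mod L + 1 < L"
    by linarith+
  have "x + 1 = L * (x div L) + (x mod L + 1)"
    using mult_div_mod_eq[of L x] by simp
  from int_div_pos_eq[OF this *] int_mod_pos_eq[OF this *]
  show "(x + 1) div L = x div L" "(x + 1) mod L = x mod L + 1"
    by auto
qed

lemma div_diff_1:
  fixes x L :: int
  assumes "L > 0"
  shows "(x - 1) div L = x div L - (if L dvd x then 1 else 0)"
proof (cases "L dvd x")
  case True
  then have "x - 1 = L * (x div L - 1) + (L - 1)"
    by (auto simp: algebra_simps)
  from int_div_pos_eq[OF this] show ?thesis
    using True assms by simp
next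
  case False
  then show ?thesis
    using div_mod_add_1(1)[of L "x - 1"] assms by simp
qed

lemma mod_diff_1:
  fixes x L :: int
  assumes "L > 0" "\<not> L dvd x"
  shows "(x - 1) mod L = x mod L - 1"
  using div_mod_add_1(2)[of L "x - 1"] assms by simp

lemma dvd_add_1_iff:
  fixes x L :: int
  assumes "L > 0"
  shows "L dvd x + 1 \<longleftrightarrow> x mod L = L - 1"
proof
  assume "L dvd x + 1"
  then obtain k where "x + 1 = L * k"
    by (elim dvdE)
  then have "x = L * (k - 1) + (L - 1)"
    unfolding right_diff_distrib by linarith
  from int_mod_pos_eq[OF this] show "x mod L = L - 1"
    using assms by simp
next
  assume "x mod L = L - 1"
  then have "x + 1 = L * (x div L + 1)"
    using mult_div_mod_eq[of L x] unfolding distrib_left by linarith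
  then show "L dvd x + 1"
    by (metis dvd_triv_left)
qed

section \<open>Moving one unit between neighbouring entries\<close>

definition shift :: "nat \<Rightarrow> nat \<Rightarrow> (nat \<Rightarrow> int) \<Rightarrow> nat \<Rightarrow> int" where
  "shift c d \<gamma> i = \<gamma> i + of_bool (i = d) - of_bool (i = c)"

lemma shift_shift [simp]: "shift c d (shift d c \<gamma>) = \<gamma>"
  by (auto simp: shift_def)

definition adjacent :: "nat \<Rightarrow> nat \<Rightarrow> nat \<Rightarrow> bool" where
  "adjacent n c d \<longleftrightarrow> c \<in> {1..n} \<and> d \<in> {1..n} \<and> (d = c + 1 \<or> c = d + 1)"

lemma adjacentD: "adjacent n c d \<Longrightarrow> c \<in> {1..n} \<and> d \<in> {1..n} \<and> c \<noteq> d"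
  by (auto simp: adjacent_def)

lemma sum_shift:
  assumes "c \<in> {1..n}" "d \<in> {1..n}"
  shows "(\<Sum>i=1..n. g i * shift c d \<gamma> i) = (\<Sum>i=1..n. g i * \<gamma> i) + g d - (g c :: int)"
proof -
  have "(\<Sum>i=1..n. g i * shift c d \<gamma> i) =
      (\<Sum>i=1..n. g i * \<gamma> i + (if i = d then g i else 0) - (if i = c then g i else 0))"
    by (intro sum.cong) (auto simp: shift_def algebra_simps)
  then show ?thesis
    using assms by (simp add: sum.distrib sum_subtractf)
qed

lemma sum_shift_1:
  assumes "c \<in> {1..n}" "d \<in> {1..n}"
  shows "(\<Sum>i=1..n. shift c d \<gamma> i) = (\<Sum>i=1..n. \<gamma> i)"
  using sum_shift[OF assms, of "\<lambda>_. 1"] by simp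

text \<open>A common name for \<open>f_c\<close> and \<open>e_d\<close>: both take a unit from c to
  d with coefficient \<open>[\<beta>_d + 1]\<close>, so raising and lowering need no separate
  treatment. It is meaningful only for adjacent c and d.\<close>

definition move :: "nat \<Rightarrow> 'k::field \<Rightarrow> nat \<Rightarrow> nat \<Rightarrow> ((nat \<Rightarrow> int) \<Rightarrow>\<^sub>0 'k) \<Rightarrow> ((nat \<Rightarrow> int) \<Rightarrow>\<^sub>0 'k)" where
  "move n q c d = gen_act n q (if d = c + 1 then gen_f c else gen_e d)"

lemma lookup_move:
  assumes "adjacent n c d"
  shows "Poly_Mapping.lookup (move n q c d v) \<gamma> =
    (if \<gamma> \<in> Zplus n then qint q (\<gamma> d) * Poly_Mapping.lookup v (shift d c \<gamma>) else 0)"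
proof (cases "d = c + 1")
  case True
  have "\<gamma>(c := \<gamma> c + 1, c + 1 := \<gamma> (c + 1) - 1) = shift d c \<gamma>"
    using True by (auto simp: shift_def)
  then show ?thesis
    using True by (simp add: move_def lookup_gen_act restrict_Zplus_def)
next
  case False
  then have c: "c = d + 1"
    using assms by (simp add: adjacent_def)
  have "\<gamma>(d := \<gamma> d - 1, d + 1 := \<gamma> (d + 1) + 1) = shift d c \<gamma>"
    using c by (auto simp: shift_def)
  then show ?thesis
    using c by (simp add: move_def lookup_gen_act restrict_Zplus_def)
qed

lemma stable_move:
  assumes "stable n q H" "adjacent n c d" "v \<in> H"
  shows "move n q c d v \<in> H"
proof -
  have "(if d = c + 1 then gen_f c else gen_e d) \<in> qgens n"
    using assms(2) by (auto simp: adjacent_def qgens_def)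
  then show ?thesis
    using assms by (simp add: stable_def move_def)
qed

lemma stable_K:
  assumes "stable n q H" "i \<in> {1..n - 1}" "v \<in> H"
  shows "gen_act n q (gen_K i) v \<in> H"
  using assms by (auto simp: stable_def)

lemma lookup_gen_K:
  assumes "Poly_Mapping.keys v \<subseteq> Zplus n"
  shows "Poly_Mapping.lookup (gen_act n q (gen_K i) v) \<gamma> = q powi (\<gamma> i - \<gamma> (i + 1)) * Poly_Mapping.lookup v \<gamma>"
  using assms by (auto simp: lookup_gen_act restrict_Zplus_def in_keys_iff)

lemma stableI:
  fixes H :: "((nat \<Rightarrow> int) \<Rightarrow>\<^sub>0 'k::field) set"
  assumes "scale.subspace H"
    and "\<And>c d v. adjacent n c d \<Longrightarrow> v \<in> H \<Longrightarrow> move n q c d v \<in> H"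
    and "\<And>i v. i \<in> {1..n - 1} \<Longrightarrow> v \<in> H \<Longrightarrow> gen_act n q (gen_K i) v \<in> H"
    and "\<And>i v. i \<in> {1..n - 1} \<Longrightarrow> v \<in> H \<Longrightarrow> gen_act n q (gen_Kinv i) v \<in> H"
  shows "stable n q H"
proof -
  have "gen_act n q (gen_e i) v \<in> H" "gen_act n q (gen_f i) v \<in> H" if "i \<in> {1..n - 1}" "v \<in> H" for i v
  proof -
    have "adjacent n (i + 1) i" "adjacent n i (i + 1)"
      using that by (auto simp: adjacent_def)
    then show "gen_act n q (gen_e i) v \<in> H" "gen_act n q (gen_f i) v \<in> H"
      using assms(2)[of "i + 1" i v] assms(2)[of i "i + 1" v] that by (auto simp: move_def)
  qed
  then show ?thesis
    using assms unfolding stable_def qgens_def by auto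
qed

section \<open>Residue vectors and their dominant representatives\<close>

definition residue :: "nat \<Rightarrow> (nat \<Rightarrow> int) \<Rightarrow> nat \<Rightarrow> int" where
  "residue l \<gamma> i = \<gamma> i mod int l"

text \<open>These are the exponents in degree \<open>t\<close> of the truncation with
  \<open>m = 1\<close>, the module of which every layer is built up to signs.\<close>

definition residues_sum :: "nat \<Rightarrow> nat \<Rightarrow> int \<Rightarrow> (nat \<Rightarrow> int) set" where
  "residues_sum n l t = {b. (\<forall>i. 0 \<le> b i \<and> b i < int l) \<and> (\<forall>i. i \<notin> {1..n} \<longrightarrow> b i = 0) \<and> (\<Sum>i=1..n. b i) = t}"

text \<open>The highest weight condition modulo lower energy: \<open>e_i\<close> kills the monomial
  if entry \<open>i\<close> would carry, and lowers its energy or kills it if entry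
  \<open>i + 1\<close> has residue 0.\<close>

definition dominant :: "nat \<Rightarrow> nat \<Rightarrow> (nat \<Rightarrow> int) \<Rightarrow> bool" where
  "dominant n l b \<longleftrightarrow> (\<forall>i\<in>{1..n - 1}. b i = int l - 1 \<or> b (i + 1) = 0)"

text \<open>Greedy filling: each entry takes what is left of \<open>t\<close>, up to its
  bound.\<close>

lemma exists_bounded_sum:
  fixes u :: "'a \<Rightarrow> int"
  assumes "finite A" "\<And>i. i \<in> A \<Longrightarrow> 0 \<le> u i" "0 \<le> t" "t \<le> sum u A"
  shows "\<exists>b. (\<forall>i\<in>A. 0 \<le> b i \<and> b i \<le> u i) \<and> (\<forall>i. i \<notin> A \<longrightarrow> b i = 0) \<and> sum b A = t"
  using assms
proof (induction A arbitrary: t rule: finite_induct)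
  case empty
  then show ?case
    by (intro exI[of _ "\<lambda>_. 0"]) auto
next
  case (insert x A)
  define r where "r = min t (u x)"
  have "\<exists>b. (\<forall>i\<in>A. 0 \<le> b i \<and> b i \<le> u i) \<and> (\<forall>i. i \<notin> A \<longrightarrow> b i = 0) \<and> sum b A = t - r"
    using insert by (intro insert.IH) (auto simp: r_def min_def sum_nonneg)
  then obtain b where b: "\<forall>i\<in>A. 0 \<le> b i \<and> b i \<le> u i" "\<forall>i. i \<notin> A \<longrightarrow> b i = 0" "sum b A = t - r"
    by blast
  have "sum (b(x := r)) A = sum b A"
    using insert.hyps by (intro sum.cong) auto
  then show ?case
    using insert b by (intro exI[of _ "b(x := r)"]) (auto simp: r_def)
qed

text \<open>The dominant residue vectors are \<open>(l - 1, \<dots>, l - 1, r, 0, \<dots>, 0)\<close>.\<close>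

lemma dominant_form:
  assumes l: "l \<ge> 3" and b: "b \<in> residues_sum n l t" "dominant n l b"
  obtains p where "p \<le> n" "\<And>i. i \<in> {1..p} \<Longrightarrow> b i = int l - 1" "\<And>i. i > p + 1 \<Longrightarrow> b i = 0"
    "b (p + 1) < int l - 1" "t = int p * (int l - 1) + b (p + 1)"
proof -
  \<comment> \<open>Entry \<open>n + 1\<close> lies outside the index range and is 0, so the initial
    block of entries \<open>l - 1\<close>, of length \<open>p\<close>, ends at \<open>n\<close> at
    the latest.\<close>
  have ex: "\<exists>k. b (Suc k) \<noteq> int l - 1"
    using b l by (intro exI[of _ n]) (auto simp: residues_sum_def)
  define p where "p = (LEAST k. b (Suc k) \<noteq> int l - 1)"
  have p: "b (Suc p) \<noteq> int l - 1"
    unfolding p_def by (rule LeastI_ex[OF ex])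
  have less: "b (Suc k) = int l - 1" if "k < p" for k
    using that not_less_Least[of k] by (auto simp: p_def)
  have le: "b i = int l - 1" if "i \<in> {1..p}" for i
    using that less[of "i - 1"] by (cases i) auto
  have "p \<le> n"
    unfolding p_def using b l by (intro Least_le) (auto simp: residues_sum_def)
  have zero: "b (p + 2 + k) = 0" for k
  proof (induction k)
    case 0
    then show ?case
    proof (cases "p + 2 \<le> n")
      case True
      then have "b (p + 1) = int l - 1 \<or> b (p + 1 + 1) = 0"
        using b(2) unfolding dominant_def by (intro bspec[of _ _ "p + 1"]) auto
      then show ?thesis
        using p by simp
    qed (use b(1) in \<open>auto simp: residues_sum_def\<close>)
  next
    case (Suc k)
    show ?case
    proof (cases "p + 2 + Suc k \<le> n")
      case True
      then have "b (p + 2 + k) = int l - 1 \<or> b (p + 2 + k + 1) = 0"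
        using b(2) unfolding dominant_def by (intro bspec[of _ _ "p + 2 + k"]) auto
      then show ?thesis
        using Suc l by simp
    qed (use b(1) in \<open>auto simp: residues_sum_def\<close>)
  qed
  have gt: "b i = 0" if "i > p + 1" for i
  proof -
    have "p + 2 + (i - (p + 2)) = i"
      using that by linarith
    then show ?thesis
      using zero[of "i - (p + 2)"] by metis
  qed
  have "t = (\<Sum>i=1..n. b i)"
    using b by (simp add: residues_sum_def)
  \<comment> \<open>For \<open>p = n\<close> the entry \<open>p + 1\<close> is outside the range and
    contributes 0, so the formula covers the full block as well.\<close>
  also have "\<dots> = (\<Sum>i=1..p + 1. b i)"
  proof (cases "p = n")
    case True
    have "b (Suc n) = 0"
      using b(1) by (simp add: residues_sum_def)
    then show ?thesis
      using True by simp
  next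
    case False
    then show ?thesis
      using \<open>p \<le> n\<close> gt by (intro sum.mono_neutral_right) auto
  qed
  also have "\<dots> = int p * (int l - 1) + b (p + 1)"
    using le by simp
  finally have t: "t = int p * (int l - 1) + b (p + 1)" .
  have "b (p + 1) < int l - 1"
    using p b(1) by (auto simp: residues_sum_def order.strict_iff_order)
  with \<open>p \<le> n\<close> le gt t show ?thesis
    using that by blast
qed

text \<open>The length of the block and the entry after it are the quotient and the remainder of
  \<open>t\<close> on division by \<open>l - 1\<close>.\<close>

lemma dominant_unique:
  assumes l: "l \<ge> 3" and b: "b \<in> residues_sum n l t" "dominant n l b"
    and b': "b' \<in> residues_sum n l t" "dominant n l b'"
  shows "b = b'"
proof -
  obtain p where p: "p \<le> n" "\<And>i. i \<in> {1..p} \<Longrightarrow> b i = int l - 1" "\<And>i. i > p + 1 \<Longrightarrow> b i = 0"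
    "b (p + 1) < int l - 1" "t = int p * (int l - 1) + b (p + 1)"
    by (rule dominant_form[OF l b], rule that)
  obtain p' where p': "p' \<le> n" "\<And>i. i \<in> {1..p'} \<Longrightarrow> b' i = int l - 1" "\<And>i. i > p' + 1 \<Longrightarrow> b' i = 0"
    "b' (p' + 1) < int l - 1" "t = int p' * (int l - 1) + b' (p' + 1)"
    by (rule dominant_form[OF l b'], rule that)
  have nonneg: "b (p + 1) \<ge> 0" "b' (p' + 1) \<ge> 0"
    using b b' by (auto simp: residues_sum_def)
  have "int p = t div (int l - 1)"
    using p(4,5) nonneg by (intro int_div_pos_eq[symmetric]) (auto simp: mult.commute)
  moreover have "int p' = t div (int l - 1)"
    using p'(4,5) nonneg by (intro int_div_pos_eq[symmetric]) (auto simp: mult.commute)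
  ultimately have pp: "p = p'"
    by simp
  then have r: "b (p + 1) = b' (p + 1)"
    using p(5) p'(5) by simp
  show ?thesis
  proof
    fix i
    consider "i = 0" | "i \<in> {1..p}" | "i = p + 1" | "i > p + 1"
      by force
    then show "b i = b' i"
    proof cases
      case 1
      then show ?thesis
        using b b' by (simp add: residues_sum_def)
    qed (use p(2,3) p'(2,3) pp r in auto)
  qed
qed

text \<open>Since \<open>l = (l - 1) + 1\<close>, raising the sum by \<open>l\<close> lengthens the
  block by one entry and raises the remainder \<open>r\<close> by one; both vectors are thus
  explicit. The hypothesis \<open>n \<ge> 3\<close> leaves room for a telling index: for
  \<open>n = 2\<close> and even \<open>l\<close> the vectors (l/2 - 1, 0) and (l - 1, l/2) have sums
  differing by \<open>l\<close>, but equal weights.\<close>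

lemma dominant_separate:
  assumes l: "l \<ge> 3" and n: "n \<ge> 3" and b: "b \<in> residues_sum n l t" "dominant n l b"
    and b': "b' \<in> residues_sum n l (t + int l)" "dominant n l b'"
  obtains i where "i \<in> {1..n - 1}" "\<not> int l dvd (b i - b (i + 1)) - (b' i - b' (i + 1))"
proof -
  obtain p where p: "p \<le> n" "\<And>i. i \<in> {1..p} \<Longrightarrow> b i = int l - 1" "\<And>i. i > p + 1 \<Longrightarrow> b i = 0"
    "b (p + 1) < int l - 1" "t = int p * (int l - 1) + b (p + 1)"
    by (rule dominant_form[OF l b], rule that)
  define r where "r = b (p + 1)"
  have r: "0 \<le> r" "r < int l - 1"
    using b p by (auto simp: residues_sum_def r_def)
  have "(\<Sum>i=1..n. b' i) \<le> (\<Sum>i=1..n. int l - 1)"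
    using b' by (intro sum_mono) (auto simp: residues_sum_def)
  then have "t + int l \<le> (\<Sum>i=1..n. int l - 1)"
    using b' by (simp add: residues_sum_def)
  \<comment> \<open>The \<open>n\<close> entries of \<open>b'\<close> are at most
    \<open>l - 1\<close>, so the larger sum must fit under \<open>n (l - 1)\<close>. This forces
    \<open>p + 2 \<le> n\<close>, room for the longer block and the new remainder.\<close>
  then have "int (p + 1) * (int l - 1) + (r + 1) \<le> int n * (int l - 1)"
    using p(5) by (simp add: r_def algebra_simps)
  then have "int (p + 1) * (int l - 1) < int n * (int l - 1)"
    using r by linarith
  then have pn: "p + 2 \<le> n"
    using l by (simp add: mult_less_cancel_right)
  define c where "c i = (if i \<in> {1..p + 1} then int l - 1 else if i = p + 2 then r + 1 else 0)" for i
  have "(\<Sum>i=1..n. c i) = (\<Sum>i=1..p + 2. c i)"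
    using pn by (intro sum.mono_neutral_right) (auto simp: c_def)
  also have "\<dots> = (\<Sum>i=1..p + 1. c i) + c (p + 2)"
    by simp
  also have "(\<Sum>i=1..p + 1. c i) = (\<Sum>i=1..p + 1. int l - 1)"
    by (intro sum.cong) (auto simp: c_def)
  also have "\<dots> + c (p + 2) = t + int l"
    using p(5) by (simp add: c_def r_def algebra_simps)
  finally have "c \<in> residues_sum n l (t + int l)"
    using r l pn by (auto simp: residues_sum_def c_def)
  moreover have "dominant n l c"
    by (auto simp: dominant_def c_def)
  ultimately have b'_c: "b' = c"
    using dominant_unique[OF l b'] by blast
  show ?thesis
  \<comment> \<open>At the end of the block of \<open>b\<close> the weights differ by
    \<open>l - 1 - r\<close>. If there is no block, index 2 is used, where they differ by
    \<open>r + 1\<close>. Both numbers lie strictly between 0 and \<open>l\<close>.\<close>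
  proof (cases "p = 0")
    case True
    have "b 2 = 0" "b 3 = 0" "b' 2 = r + 1" "b' 3 = 0"
      using True p(3) by (auto simp: b'_c c_def)
    moreover have "\<not> int l dvd - (r + 1)"
      unfolding dvd_minus_iff using r zdvd_not_zless[of "r + 1" "int l"] by auto
    ultimately show ?thesis
      using n by (intro that[of 2]) (auto simp: numeral_3_eq_3 eval_nat_numeral)
  next
    case False
    have "b p = int l - 1" "b' p = int l - 1" "b' (p + 1) = int l - 1"
      using False p(2) by (auto simp: b'_c c_def)
    moreover have "\<not> int l dvd int l - 1 - r"
      using r zdvd_not_zless[of "int l - 1 - r" "int l"] by auto
    ultimately show ?thesis
      using False pn by (intro that[of p]) (auto simp: r_def)
  qed
qed

lemma residues_sum_shift:
  assumes "b \<in> residues_sum n l t" "c \<in> {1..n}" "d \<in> {1..n}" "c \<noteq> d" "b c > 0" "b d < int l - 1"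
  shows "shift c d b \<in> residues_sum n l t"
proof -
  have "0 \<le> shift c d b i \<and> shift c d b i < int l" for i
    using assms by (auto simp: residues_sum_def shift_def) (smt (verit))
  moreover have "shift c d b i = 0" if "i \<notin> {1..n}" for i
    using assms that by (auto simp: residues_sum_def shift_def)
  ultimately show ?thesis
    using assms(1) sum_shift_1[OF assms(2,3), of b] by (simp add: residues_sum_def)
qed

text \<open>Where dominance fails, a unit can be moved back from \<open>i + 1\<close> to
  \<open>i\<close> without carry or borrow, and the sum of \<open>i * b i\<close> drops by one. So
  every residue vector arises from a dominant one by lowering moves that change no quotient.\<close>

lemma residues_sum_induct [consumes 1, case_names dominant shift]:
  assumes b: "b \<in> residues_sum n l t"
    and dominant: "\<And>b. b \<in> residues_sum n l t \<Longrightarrow> dominant n l b \<Longrightarrow> P b"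
    and shift: "\<And>b i. b \<in> residues_sum n l t \<Longrightarrow> i \<in> {1..n - 1} \<Longrightarrow> b i > 0 \<Longrightarrow> b (i + 1) < int l - 1 \<Longrightarrow>
      P b \<Longrightarrow> P (shift i (i + 1) b)"
  shows "P b"
  using b
proof (induction "nat (\<Sum>i=1..n. int i * b i)" arbitrary: b rule: less_induct)
  case less
  show ?case
  proof (cases "dominant n l b")
    case False
    then obtain i where i: "i \<in> {1..n - 1}" "b i \<noteq> int l - 1" "b (i + 1) \<noteq> 0"
      by (auto simp: dominant_def)
    have i': "i \<in> {1..n}" "i + 1 \<in> {1..n}"
      using i by auto
    have bi: "b i < int l - 1" "b (i + 1) > 0"
      using i less.prems by (auto simp: residues_sum_def) (smt (verit))+
    define b1 where "b1 = shift (i + 1) i b"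
    have b1: "b1 \<in> residues_sum n l t"
      unfolding b1_def using less.prems i' bi by (intro residues_sum_shift) auto
    have "(\<Sum>k=1..n. int k * b1 k) = (\<Sum>k=1..n. int k * b k) - 1"
      unfolding b1_def using sum_shift[OF i'(2,1), of int b] by simp
    moreover have "(\<Sum>k=1..n. int k * b1 k) \<ge> 0"
      using b1 by (intro sum_nonneg) (auto simp: residues_sum_def)
    ultimately have "P b1"
      using b1 by (intro less.hyps) auto
    moreover have "b1 i > 0" "b1 (i + 1) < int l - 1"
      using less.prems bi by (auto simp: b1_def shift_def residues_sum_def)
    ultimately have "P (shift i (i + 1) b1)"
      using shift b1 i by blast
    then show ?thesis
      by (simp add: b1_def)
  qed (use less dominant in blast)
qed

section \<open>The energy filtration\<close>

locale energy = root_of_unity q l for q :: "'k :: field" and l :: nat +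
  fixes n m :: nat
  assumes n_ge: "n \<ge> 3" and m_ge: "m \<ge> 1"
begin

lemma l_pos: "int l > 0"
  using l_ge by simp

abbreviation "B s \<equiv> Zplus_trunc n l m s"

abbreviation "E \<equiv> Edeg n l"

lemma B_D:
  assumes "\<gamma> \<in> B s"
  shows "\<gamma> \<in> Zplus n" "\<gamma> i \<ge> 0" "i \<notin> {1..n} \<Longrightarrow> \<gamma> i = 0" "(\<Sum>i=1..n. \<gamma> i) = int s"
    "i \<in> {1..n} \<Longrightarrow> \<gamma> i \<le> int m * int l - 1"
  using assms by (auto simp: Zplus_trunc_def Zplus_def)

lemma finite_B: "finite (B s)"
proof -
  have "B s \<subseteq> {f. \<forall>i. (i \<in> {1..n} \<longrightarrow> f i \<in> {0..int m * int l}) \<and> (i \<notin> {1..n} \<longrightarrow> f i = 0)}"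
    using B_D by fastforce
  moreover have "finite \<dots>"
    by (rule finite_set_of_finite_funs) auto
  ultimately show ?thesis
    by (rule finite_subset)
qed

lemma E_nonneg: "\<gamma> \<in> Zplus n \<Longrightarrow> E \<gamma> \<ge> 0"
  using l_pos unfolding Edeg_def by (intro sum_nonneg) (auto simp: Zplus_def pos_imp_zdiv_nonneg_iff)

lemma shift_div:
  assumes "\<not> int l dvd \<beta> d + 1" "c \<noteq> d"
  shows "shift c d \<beta> i div int l = \<beta> i div int l - of_bool (i = c \<and> int l dvd \<beta> c)"
  using div_mod_add_1(1)[OF l_pos assms(1)] div_diff_1[OF l_pos, of "\<beta> c"] assms(2)
  by (auto simp: shift_def)

text \<open>The hypothesis excludes a carry at \<open>d\<close>, so only the borrow at
  \<open>c\<close> can change a quotient.\<close>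

lemma E_shift:
  assumes "\<not> int l dvd \<beta> d + 1" "c \<noteq> d" "c \<in> {1..n}"
  shows "E (shift c d \<beta>) = E \<beta> - of_bool (int l dvd \<beta> c)"
proof -
  have "E (shift c d \<beta>) = (\<Sum>i=1..n. \<beta> i div int l - (if i = c then of_bool (int l dvd \<beta> c) else 0))"
    unfolding Edeg_def by (intro sum.cong) (auto simp: shift_div[of \<beta> d c, OF assms(1,2)])
  then show ?thesis
    using assms(3) by (simp add: sum_subtractf Edeg_def)
qed

text \<open>Entry \<open>d\<close> could exceed \<open>m l - 1\<close> only by reaching
  \<open>m l\<close>, which is a multiple of \<open>l\<close> and hence a forbidden carry.\<close>

lemma shift_in_B:
  assumes "\<beta> \<in> B s" "c \<in> {1..n}" "d \<in> {1..n}" "c \<noteq> d" "\<beta> c \<ge> 1" "\<not> int l dvd \<beta> d + 1"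
  shows "shift c d \<beta> \<in> B s"
proof -
  have "\<beta> d + 1 \<noteq> int m * int l"
    using assms(6) by (metis dvd_triv_right)
  then have "shift c d \<beta> i \<le> int m * int l - 1" if "i \<in> {1..n}" for i
    using B_D(5)[OF assms(1) that] by (auto simp: shift_def)
  moreover have "shift c d \<beta> i \<ge> 0" "i \<notin> {1..n} \<Longrightarrow> shift c d \<beta> i = 0" for i
    using B_D(2,3)[OF assms(1), of i] assms by (auto simp: shift_def)
  ultimately show ?thesis
    using sum_shift_1[OF assms(2,3), of \<beta>] B_D(4)[OF assms(1)] by (auto simp: Zplus_trunc_def Zplus_def)
qed

lemma lookup_move_nonzero:
  assumes "adjacent n c d" "Poly_Mapping.lookup (move n q c d v) \<gamma> \<noteq> 0"
  obtains \<beta> where "\<gamma> = shift c d \<beta>" "Poly_Mapping.lookup v \<beta> \<noteq> 0" "\<not> int l dvd \<beta> d + 1" "\<beta> c \<ge> 1"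
proof
  show "\<gamma> = shift c d (shift d c \<gamma>)"
    by simp
  show "Poly_Mapping.lookup v (shift d c \<gamma>) \<noteq> 0"
    using assms by (auto simp: lookup_move split: if_splits)
  have "c \<noteq> d"
    using adjacentD[OF assms(1)] by simp
  then show "\<not> int l dvd shift d c \<gamma> d + 1" "shift d c \<gamma> c \<ge> 1"
    using assms by (auto simp: lookup_move qint_eq_0 shift_def Zplus_def split: if_splits)
qed

lemma lookup_move_shift:
  assumes "adjacent n c d" "shift c d \<beta> \<in> Zplus n"
  shows "Poly_Mapping.lookup (move n q c d v) (shift c d \<beta>) = qint q (\<beta> d + 1) * Poly_Mapping.lookup v \<beta>"
  using assms adjacentD[OF assms(1)] by (simp add: lookup_move) (simp add: shift_def)

text \<open>Monomials are eigenvectors of the \<open>K_i\<close>, and a move has nonzero coefficient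
  only if it does not carry. Stability of a monomial subspace is therefore a closure property of its
  exponents.\<close>

lemma stable_supported:
  assumes S: "S \<subseteq> Zplus n"
    and closed: "\<And>\<beta> c d. \<beta> \<in> S \<Longrightarrow> adjacent n c d \<Longrightarrow> \<beta> c \<ge> 1 \<Longrightarrow> \<not> int l dvd \<beta> d + 1 \<Longrightarrow> shift c d \<beta> \<in> S"
  shows "stable n q (supported S)"
proof (rule stableI)
  show "move n q c d v \<in> supported S" if "adjacent n c d" "v \<in> supported S" for c d v
    unfolding in_supported
  proof (intro allI impI)
    fix \<gamma>
    assume "Poly_Mapping.lookup (move n q c d v) \<gamma> \<noteq> 0"
    then obtain \<beta> where "\<gamma> = shift c d \<beta>" "Poly_Mapping.lookup v \<beta> \<noteq> 0" "\<not> int l dvd \<beta> d + 1" "\<beta> c \<ge> 1"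
      using lookup_move_nonzero[OF \<open>adjacent n c d\<close>] by metis
    then show "\<gamma> \<in> S"
      using closed that by (auto simp: in_supported)
  qed
qed (auto simp: subspace_supported in_supported lookup_gen_act restrict_Zplus_def)

definition V :: "nat \<Rightarrow> int \<Rightarrow> ((nat \<Rightarrow> int) \<Rightarrow>\<^sub>0 'k) set" where
  "V s j = supported {\<gamma> \<in> B s. E \<gamma> \<le> j}"

lemma V_iff: "v \<in> V s j \<longleftrightarrow> (\<forall>\<gamma>. Poly_Mapping.lookup v \<gamma> \<noteq> 0 \<longrightarrow> \<gamma> \<in> B s \<and> E \<gamma> \<le> j)"
  by (auto simp: V_def in_supported)

lemma V_mono: "j \<le> k \<Longrightarrow> V s j \<subseteq> V s k"
  unfolding V_def by (intro supported_mono) auto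

lemma stable_V: "stable n q (V s j)"
  unfolding V_def
proof (rule stable_supported)
  fix \<beta> c d
  assume *: "\<beta> \<in> {\<gamma> \<in> B s. E \<gamma> \<le> j}" "adjacent n c d" "\<beta> c \<ge> 1" "\<not> int l dvd \<beta> d + 1"
  then show "shift c d \<beta> \<in> {\<gamma> \<in> B s. E \<gamma> \<le> j}"
    using adjacentD[OF *(2)] shift_in_B[of \<beta> s c d] E_shift[of \<beta> d c] by (auto simp: of_bool_def)
qed (auto dest: B_D)

lemma not_in_V_diff:
  assumes "v \<in> V s j" "v \<notin> V s (j - 1)"
  obtains \<gamma> where "Poly_Mapping.lookup v \<gamma> \<noteq> 0" "\<gamma> \<in> B s" "E \<gamma> = j"
  using assms unfolding V_iff by (metis linorder_not_less zle_diff1_eq order.order_iff_strict)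

lemma residue_in_residues_sum:
  assumes "\<gamma> \<in> B s"
  shows "residue l \<gamma> \<in> residues_sum n l (int s - int l * E \<gamma>)"
proof -
  have "(\<Sum>i=1..n. \<gamma> i) = (\<Sum>i=1..n. \<gamma> i mod int l + int l * (\<gamma> i div int l))"
    by simp
  then have "(\<Sum>i=1..n. \<gamma> i mod int l) = int s - int l * E \<gamma>"
    using B_D(4)[OF assms] unfolding Edeg_def sum.distrib sum_distrib_left by linarith
  then show ?thesis
    using l_pos B_D(3)[OF assms] by (auto simp: residues_sum_def residue_def)
qed

text \<open>Raising operators lower \<open>\<Sum>i. i * \<gamma> i\<close>, so applying them as long as the leading layer
  survives leads to a vector whose leading layer is singular.\<close>

lemma exists_singular:
  assumes H: "stable n q H" and v: "v \<in> H" "v \<in> V s j" "v \<notin> V s (j - 1)"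
  obtains w where "w \<in> H" "w \<in> V s j" "w \<notin> V s (j - 1)"
    "\<And>i. i \<in> {1..n - 1} \<Longrightarrow> move n q (i + 1) i w \<in> V s (j - 1)"
proof -
  have "\<exists>w\<in>H. w \<in> V s j \<and> w \<notin> V s (j - 1) \<and> (\<forall>i\<in>{1..n - 1}. move n q (i + 1) i w \<in> V s (j - 1))"
    if "\<And>\<gamma>. Poly_Mapping.lookup v \<gamma> \<noteq> 0 \<Longrightarrow> (\<Sum>i=1..n. int i * \<gamma> i) < int N" for N
    using v that
  proof (induction N arbitrary: v)
    case 0
    obtain \<gamma> where "Poly_Mapping.lookup v \<gamma> \<noteq> 0" "\<gamma> \<in> B s"
      using not_in_V_diff[OF 0(2,3)] by metis
    moreover have "(\<Sum>i=1..n. int i * \<gamma> i) \<ge> 0"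
      using B_D(2)[OF \<open>\<gamma> \<in> B s\<close>] by (intro sum_nonneg) simp
    ultimately show ?case
      using 0(4)[of \<gamma>] by simp
  next
    case (Suc N)
    show ?case
    proof (cases "\<forall>i\<in>{1..n - 1}. move n q (i + 1) i v \<in> V s (j - 1)")
      case False
      then obtain i where i: "i \<in> {1..n - 1}" "move n q (i + 1) i v \<notin> V s (j - 1)"
        by blast
      then have adj: "adjacent n (i + 1) i" and i': "i + 1 \<in> {1..n}" "i \<in> {1..n}"
        by (auto simp: adjacent_def)
      show ?thesis
      proof (rule Suc.IH)
        show "move n q (i + 1) i v \<in> H"
          by (rule stable_move[OF H adj Suc.prems(1)])
        show "move n q (i + 1) i v \<in> V s j"
          by (rule stable_move[OF stable_V adj Suc.prems(2)])
        show "move n q (i + 1) i v \<notin> V s (j - 1)"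
          by fact
        fix \<gamma>
        assume "Poly_Mapping.lookup (move n q (i + 1) i v) \<gamma> \<noteq> 0"
        then obtain \<beta> where "\<gamma> = shift (i + 1) i \<beta>" "Poly_Mapping.lookup v \<beta> \<noteq> 0"
          using lookup_move_nonzero[OF adj] by metis
        then show "(\<Sum>i=1..n. int i * \<gamma> i) < int N"
          using Suc.prems(4)[of \<beta>] sum_shift[OF i', of int \<beta>] by simp
      qed
    qed (use Suc.prems in blast)
  qed
  moreover obtain N where "\<And>\<gamma>. Poly_Mapping.lookup v \<gamma> \<noteq> 0 \<Longrightarrow> (\<Sum>i=1..n. int i * \<gamma> i) < int N"
  proof
    fix \<gamma>
    assume "Poly_Mapping.lookup v \<gamma> \<noteq> 0"
    then have "(\<Sum>i=1..n. int i * \<gamma> i) \<le> Max ((\<lambda>\<gamma>. \<Sum>i=1..n. int i * \<gamma> i) ` Poly_Mapping.keys v)"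
      by (intro Max_ge) (auto simp: in_keys_iff)
    then show "(\<Sum>i=1..n. int i * \<gamma> i) < int (nat (Max ((\<lambda>\<gamma>. \<Sum>i=1..n. int i * \<gamma> i) ` Poly_Mapping.keys v) + 1))"
      by linarith
  qed
  ultimately show ?thesis
    using that by blast
qed

text \<open>A violation at \<open>i\<close> would give a move that neither carries nor borrows. Its
  image stays in layer \<open>j\<close> with nonzero coefficient, as no other monomial contributes
  there.\<close>

lemma dominant_if_singular:
  assumes w: "\<And>i. i \<in> {1..n - 1} \<Longrightarrow> move n q (i + 1) i w \<in> V s (j - 1)"
    and \<gamma>: "Poly_Mapping.lookup w \<gamma> \<noteq> 0" "\<gamma> \<in> B s" "E \<gamma> = j"
  shows "dominant n l (residue l \<gamma>)"
  unfolding dominant_def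
proof (rule ballI, rule ccontr)
  fix i
  assume i: "i \<in> {1..n - 1}" and "\<not> (residue l \<gamma> i = int l - 1 \<or> residue l \<gamma> (i + 1) = 0)"
  then have nd: "\<not> int l dvd \<gamma> i + 1" "\<not> int l dvd \<gamma> (i + 1)"
    using dvd_add_1_iff[OF l_pos, of "\<gamma> i"] by (auto simp: residue_def dvd_eq_mod_eq_0)
  have adj: "adjacent n (i + 1) i"
    using i by (auto simp: adjacent_def)
  have "\<gamma> (i + 1) \<noteq> 0"
    using nd(2) by auto
  then have "\<gamma> (i + 1) \<ge> 1"
    using B_D(2)[OF \<gamma>(2), of "i + 1"] by linarith
  then have sB: "shift (i + 1) i \<gamma> \<in> B s"
    using adjacentD[OF adj] nd \<gamma> by (intro shift_in_B) auto
  have "Poly_Mapping.lookup (move n q (i + 1) i w) (shift (i + 1) i \<gamma>) \<noteq> 0"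
    using lookup_move_shift[OF adj B_D(1)[OF sB]] \<gamma>(1) nd(1) by (simp add: qint_eq_0)
  then have "E (shift (i + 1) i \<gamma>) \<le> j - 1"
    using w[OF i] by (simp add: V_iff)
  then show False
    using E_shift[of \<gamma> i "i + 1", OF nd(1)] adjacentD[OF adj] nd(2) \<gamma>(3) by simp
qed

lemma residue_shift:
  assumes "\<not> int l dvd \<beta> d + 1" "\<not> int l dvd \<beta> c" "c \<noteq> d"
  shows "residue l (shift c d \<beta>) = shift c d (residue l \<beta>)"
  using div_mod_add_1(2)[OF l_pos assms(1)] mod_diff_1[OF l_pos assms(2)] assms(3)
  by (auto simp: residue_def shift_def fun_eq_iff)

text \<open>The layer \<open>j\<close> of \<open>w\<close> is concentrated at the residue vector \<open>b\<close> and nonzero at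
  \<open>l * a + b\<close>, and its layer \<open>j - 1\<close> vanishes.\<close>

definition layer_at :: "nat \<Rightarrow> int \<Rightarrow> (nat \<Rightarrow> int) \<Rightarrow> (nat \<Rightarrow> int) \<Rightarrow> ((nat \<Rightarrow> int) \<Rightarrow>\<^sub>0 'k) \<Rightarrow> bool" where
  "layer_at s j a b w \<longleftrightarrow> w \<in> V s j \<and>
     (\<forall>\<gamma>. Poly_Mapping.lookup w \<gamma> \<noteq> 0 \<longrightarrow> E \<gamma> = j \<and> residue l \<gamma> = b \<or> E \<gamma> \<le> j - 2) \<and>
     Poly_Mapping.lookup w (\<lambda>i. int l * a i + b i) \<noteq> 0"

text \<open>In layer \<open>j\<close> the two inequalities exclude a borrow at \<open>c\<close> and
  a carry at \<open>d\<close>, so this layer moves as a block and keeps its quotients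
  \<open>a\<close>. Terms of energy at most \<open>j - 2\<close> cannot rise, so layer
  \<open>j - 1\<close> stays empty.\<close>

lemma layer_at_move:
  assumes w: "layer_at s j a b w" and b: "b \<in> residues_sum n l t"
    and cd: "adjacent n c d" "b c > 0" "b d < int l - 1"
  shows "layer_at s j a (shift c d b) (move n q c d w)"
  unfolding layer_at_def
proof (intro conjI allI impI)
  have cd': "c \<in> {1..n}" "d \<in> {1..n}" "c \<noteq> d"
    using adjacentD[OF cd(1)] by auto
  have bb: "0 \<le> b i" "b i < int l" for i
    using b by (auto simp: residues_sum_def)
  show "move n q c d w \<in> V s j"
    using w by (intro stable_move[OF stable_V cd(1)]) (simp add: layer_at_def)
  show "E \<gamma> = j \<and> residue l \<gamma> = shift c d b \<or> E \<gamma> \<le> j - 2"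
    if nz: "Poly_Mapping.lookup (move n q c d w) \<gamma> \<noteq> 0" for \<gamma>
  proof -
    obtain \<beta> where \<beta>: "\<gamma> = shift c d \<beta>" "Poly_Mapping.lookup w \<beta> \<noteq> 0" "\<not> int l dvd \<beta> d + 1"
      using lookup_move_nonzero[OF cd(1) nz] by metis
    have E: "E \<gamma> = E \<beta> - of_bool (int l dvd \<beta> c)"
      using E_shift[of \<beta> d c, OF \<beta>(3) cd'(3,1)] \<beta>(1) by simp
    consider "E \<beta> = j" "residue l \<beta> = b" | "E \<beta> \<le> j - 2"
      using w \<beta>(2) by (auto simp: layer_at_def)
    then show ?thesis
    proof cases
      case 1
      then have "\<not> int l dvd \<beta> c"
        using cd(2) by (auto simp: residue_def dvd_eq_mod_eq_0)
      then show ?thesis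
        using 1 E residue_shift[of \<beta> d c, OF \<beta>(3) _ cd'(3)] \<beta>(1) by simp
    qed (use E in \<open>auto simp: of_bool_def split: if_splits\<close>)
  qed
  define \<gamma> where "\<gamma> = (\<lambda>i. int l * a i + b i)"
  have \<gamma>: "Poly_Mapping.lookup w \<gamma> \<noteq> 0"
    using w by (simp add: layer_at_def \<gamma>_def)
  have \<gamma>B: "\<gamma> \<in> B s"
    using w \<gamma> by (auto simp: layer_at_def V_iff)
  have mods: "\<gamma> i mod int l = b i" for i
    using bb[of i] by (simp add: \<gamma>_def)
  have nd: "\<not> int l dvd \<gamma> d + 1" "\<not> int l dvd \<gamma> c"
    using dvd_add_1_iff[OF l_pos, of "\<gamma> d"] mods[of d] mods[of c] cd by (auto simp: dvd_eq_mod_eq_0)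
  have "\<gamma> c \<ge> 1"
    using nd(2) B_D(2)[OF \<gamma>B, of c] by (cases "\<gamma> c = 0") auto
  then have "shift c d \<gamma> \<in> Zplus n"
    using B_D(1)[OF shift_in_B[of \<gamma> s c d, OF \<gamma>B cd' _ nd(1)]] by blast
  then have "Poly_Mapping.lookup (move n q c d w) (shift c d \<gamma>) \<noteq> 0"
    using lookup_move_shift[OF cd(1)] \<gamma> nd(1) by (simp add: qint_eq_0)
  moreover have "shift c d \<gamma> = (\<lambda>i. int l * a i + shift c d b i)"
    by (auto simp: shift_def \<gamma>_def)
  ultimately show "Poly_Mapping.lookup (move n q c d w) (\<lambda>i. int l * a i + shift c d b i) \<noteq> 0"
    by simp
qed

lemma layer_at_transport:
  assumes H: "stable n q H" and w: "w \<in> H" "layer_at s j a b w"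
    and b: "b \<in> residues_sum n l t" "dominant n l b" and b': "b' \<in> residues_sum n l t"
  obtains w' where "w' \<in> H" "layer_at s j a b' w'"
proof -
  have "\<exists>w'\<in>H. layer_at s j a b' w'"
    using b'
  proof (induction rule: residues_sum_induct)
    case (dominant b')
    then show ?case
      using dominant_unique[OF l_ge b dominant] w by blast
  next
    case (shift b' i)
    then have adj: "adjacent n i (i + 1)"
      by (auto simp: adjacent_def)
    show ?case
      using shift layer_at_move[OF _ shift(1) adj] stable_move[OF H adj] by blast
  qed
  then show ?thesis
    using that by blast
qed

end

section \<open>The socle filtration\<close>

context energy
begin

text \<open>The leading layer of a singular vector has a single residue vector, and if the next layer
  is singular as well, then the two residue vectors are told apart by some \<open>K\<^sub>i\<^sup>2\<close>.\<close>

lemma exists_layer_at_dominant: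
  assumes H: "stable n q H"
    and w: "w \<in> H" "w \<in> V s j" "w \<notin> V s (j - 1)"
    and sing: "\<And>i. i \<in> {1..n - 1} \<Longrightarrow> move n q (i + 1) i w \<in> V s (j - 2)"
  obtains w' a b where "w' \<in> H" "layer_at s j a b w'" "dominant n l b"
    "b \<in> residues_sum n l (int s - int l * j)" "\<And>i. a i \<ge> 0" "(\<Sum>i=1..n. a i) = j"
    "\<And>i. i \<notin> {1..n} \<Longrightarrow> a i = 0"
proof -
  have sing1: "move n q (i + 1) i w \<in> V s (j - 1)" if "i \<in> {1..n - 1}" for i
    using sing[OF that] V_mono[of "j - 2" "j - 1" s] by auto
  have sing2: "move n q (i + 1) i w \<in> V s (j - 1 - 1)" if "i \<in> {1..n - 1}" for i
    using sing[OF that] by simp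
  have in_B: "\<gamma> \<in> B s" "E \<gamma> \<le> j" if "Poly_Mapping.lookup w \<gamma> \<noteq> 0" for \<gamma>
    using w(2) that by (auto simp: V_iff)
  define t where "t = int s - int l * j"
  obtain \<gamma>0 where \<gamma>0: "Poly_Mapping.lookup w \<gamma>0 \<noteq> 0" "\<gamma>0 \<in> B s" "E \<gamma>0 = j"
    using not_in_V_diff[OF w(2,3)] by metis
  define a where "a i = \<gamma>0 i div int l" for i
  define b where "b = residue l \<gamma>0"
  have b: "b \<in> residues_sum n l t" "dominant n l b"
    using residue_in_residues_sum[OF \<gamma>0(2)] dominant_if_singular[OF sing1 \<gamma>0] \<gamma>0(3)
    by (auto simp: b_def t_def)
  have layer_j: "residue l \<gamma> = b" if "Poly_Mapping.lookup w \<gamma> \<noteq> 0" "E \<gamma> = j" for \<gamma>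
    using dominant_unique[OF l_ge _ _ b] residue_in_residues_sum[OF in_B(1)[OF that(1)]]
      dominant_if_singular[OF sing1 that(1) in_B(1)[OF that(1)] that(2)] that(2)
    by (simp add: t_def)
  have \<gamma>0_eq: "(\<lambda>i. int l * a i + b i) = \<gamma>0"
    by (simp add: a_def b_def residue_def)
  have "\<exists>w'\<in>H. layer_at s j a b w'"
  proof (cases "\<exists>\<gamma>. Poly_Mapping.lookup w \<gamma> \<noteq> 0 \<and> E \<gamma> = j - 1")
    case False
    have "layer_at s j a b w"
      unfolding layer_at_def \<gamma>0_eq
    proof (intro conjI allI impI)
      fix \<gamma>
      assume "Poly_Mapping.lookup w \<gamma> \<noteq> 0"
      then show "E \<gamma> = j \<and> residue l \<gamma> = b \<or> E \<gamma> \<le> j - 2"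
        using False layer_j[of \<gamma>] in_B(2)[of \<gamma>] by force
    qed (use w \<gamma>0 in auto)
    then show ?thesis
      using w(1) by blast
  next
    case True
    then obtain \<gamma>1 where \<gamma>1: "Poly_Mapping.lookup w \<gamma>1 \<noteq> 0" "E \<gamma>1 = j - 1"
      by blast
    define b' where "b' = residue l \<gamma>1"
    \<comment> \<open>The degree \<open>s\<close> is fixed, so one unit less of energy means
      \<open>l\<close> more in the residues.\<close>
    have b': "b' \<in> residues_sum n l (t + int l)" "dominant n l b'"
      using residue_in_residues_sum[OF in_B(1)[OF \<gamma>1(1)]]
        dominant_if_singular[OF sing2 \<gamma>1(1) in_B(1)[OF \<gamma>1(1)] \<gamma>1(2)] \<gamma>1(2)
      by (auto simp: b'_def t_def algebra_simps)
    have layer_j1: "residue l \<gamma> = b'" if "Poly_Mapping.lookup w \<gamma> \<noteq> 0" "E \<gamma> = j - 1" for \<gamma>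
      using dominant_unique[OF l_ge _ _ b'] residue_in_residues_sum[OF in_B(1)[OF that(1)]]
        dominant_if_singular[OF sing2 that(1) in_B(1)[OF that(1)] that(2)] that(2)
      by (simp add: t_def algebra_simps)
    obtain i where i: "i \<in> {1..n - 1}" "\<not> int l dvd (b i - b (i + 1)) - (b' i - b' (i + 1))"
      using dominant_separate[OF l_ge n_ge b b'] by metis
    \<comment> \<open>The quotients contribute an even multiple of \<open>l\<close> to the exponent
      of \<open>q\<close>, hence a factor 1.\<close>
    have eigen: "q powi (2 * (\<gamma> i - \<gamma> (i + 1))) = q powi (2 * (residue l \<gamma> i - residue l \<gamma> (i + 1)))" for \<gamma>
    proof -
      have "\<gamma> i - \<gamma> (i + 1) = int l * (\<gamma> i div int l - \<gamma> (i + 1) div int l) + (residue l \<gamma> i - residue l \<gamma> (i + 1))"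
        by (simp add: residue_def algebra_simps)
      then have "q powi (2 * (\<gamma> i - \<gamma> (i + 1))) =
          q powi (2 * (int l * (\<gamma> i div int l - \<gamma> (i + 1) div int l))) * q powi (2 * (residue l \<gamma> i - residue l \<gamma> (i + 1)))"
        by (simp only: distrib_left powi_add)
      then show ?thesis
        using powi_two_eq_1[of "int l * (\<gamma> i div int l - \<gamma> (i + 1) div int l)"] by simp
    qed
    \<comment> \<open>The eigenvalue of the squared \<open>K_i\<close> on layer
      \<open>j - 1\<close>. Subtracting \<open>c\<close> times the vector clears that layer and
      multiplies layer \<open>j\<close> by a nonzero scalar.\<close>
    define c where "c = q powi (2 * (b' i - b' (i + 1)))"
    define w' where "w' = gen_act n q (gen_K i) (gen_act n q (gen_K i) w) - scale c w"
    have subs: "scale.subspace H"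
      using H by (simp add: stable_def)
    have "w' \<in> H"
      unfolding w'_def using w(1) stable_K[OF H i(1)] scale.subspace_diff[OF subs] scale.subspace_scale[OF subs]
      by blast
    have lookup_w': "Poly_Mapping.lookup w' \<gamma> = (q powi (2 * (residue l \<gamma> i - residue l \<gamma> (i + 1))) - c) * Poly_Mapping.lookup w \<gamma>" for \<gamma>
    proof -
      have keys: "Poly_Mapping.keys w \<subseteq> Zplus n"
        using in_B(1) B_D(1) by (auto simp: in_keys_iff)
      moreover have "Poly_Mapping.keys (gen_act n q (gen_K i) w) \<subseteq> Zplus n"
        by (auto simp: in_keys_iff lookup_gen_act restrict_Zplus_def split: if_splits)
      ultimately have "Poly_Mapping.lookup w' \<gamma> = (q powi (\<gamma> i - \<gamma> (i + 1)) * q powi (\<gamma> i - \<gamma> (i + 1)) - c) * Poly_Mapping.lookup w \<gamma>"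
        by (simp add: w'_def lookup_minus lookup_gen_K algebra_simps)
      also have "q powi (\<gamma> i - \<gamma> (i + 1)) * q powi (\<gamma> i - \<gamma> (i + 1)) = q powi (2 * (\<gamma> i - \<gamma> (i + 1)))"
        by (simp only: mult_2 powi_add)
      finally show ?thesis
        by (simp only: eigen[of \<gamma>])
    qed
    have "q powi (2 * (b i - b (i + 1))) \<noteq> c"
    proof
      assume "q powi (2 * (b i - b (i + 1))) = c"
      moreover have "2 * ((b i - b (i + 1)) - (b' i - b' (i + 1))) = 2 * (b i - b (i + 1)) - 2 * (b' i - b' (i + 1))"
        by simp
      ultimately have "q powi (2 * ((b i - b (i + 1)) - (b' i - b' (i + 1)))) = c * q powi (- (2 * (b' i - b' (i + 1))))"
        by (simp only: powi_diff)
      then have "q powi (2 * ((b i - b (i + 1)) - (b' i - b' (i + 1)))) = 1"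
        unfolding c_def by (simp only: powi_neg_cancel)
      then show False
        using powi_two_eq_1 i(2) by blast
    qed
    then have "layer_at s j a b w'"
      unfolding layer_at_def \<gamma>0_eq
    proof (intro conjI allI impI)
      show "w' \<in> V s j"
        using w(2) by (auto simp: V_iff lookup_w')
      fix \<gamma>
      assume nz: "Poly_Mapping.lookup w' \<gamma> \<noteq> 0"
      then have \<gamma>: "Poly_Mapping.lookup w \<gamma> \<noteq> 0"
        by (auto simp: lookup_w')
      have "E \<gamma> \<noteq> j - 1"
        using layer_j1[OF \<gamma>] nz by (auto simp: lookup_w' c_def)
      then show "E \<gamma> = j \<and> residue l \<gamma> = b \<or> E \<gamma> \<le> j - 2"
        using layer_j[OF \<gamma>] in_B(2)[OF \<gamma>] by linarith
    qed (use \<gamma>0 in \<open>auto simp: lookup_w' b_def[symmetric]\<close>)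
    then show ?thesis
      using \<open>w' \<in> H\<close> by blast
  qed
  moreover have "a i \<ge> 0" for i
    using B_D(2)[OF \<gamma>0(2), of i] l_pos by (simp add: a_def pos_imp_zdiv_nonneg_iff)
  moreover have "(\<Sum>i=1..n. a i) = j"
    using \<gamma>0(3) by (simp add: a_def Edeg_def)
  moreover have "i \<notin> {1..n} \<Longrightarrow> a i = 0" for i
    using B_D(3)[OF \<gamma>0(2), of i] by (simp add: a_def)
  ultimately show ?thesis
    using that[of _ a b] b unfolding t_def by blast
qed

text \<open>The lower monomial \<open>\<delta>\<close> shows that even the sum \<open>t + l\<close>
  fits into \<open>n\<close> residues, so \<open>t \<le> n (l - 1) - l\<close>. This is exactly the
  capacity \<open>(n - 2) (l - 1) + (l - 2)\<close> that remains when entry \<open>c\<close> is kept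
  at 0 and entry \<open>d\<close> below \<open>l - 1\<close>.\<close>

lemma exists_residue_with_room:
  assumes \<delta>: "\<delta> \<in> B s" "E \<delta> < j" and "t = int s - int l * j" "0 \<le> t"
    and cd: "adjacent n c d"
  obtains b where "b \<in> residues_sum n l t" "b c = 0" "b d < int l - 1"
proof -
  define u where "u i = (if i = c then 0 else if i = d then int l - 2 else int l - 1)" for i
  have cd': "c \<in> {1..n}" "d \<in> {1..n}" "c \<noteq> d"
    using adjacentD[OF cd] by auto
  have "(\<Sum>i=1..n. residue l \<delta> i) = int s - int l * E \<delta>"
    using residue_in_residues_sum[OF \<delta>(1)] by (simp add: residues_sum_def)
  moreover have "(\<Sum>i=1..n. residue l \<delta> i) \<le> (\<Sum>i=1..n. int l - 1)"
    using residue_in_residues_sum[OF \<delta>(1)] by (intro sum_mono) (auto simp: residues_sum_def)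
  moreover have "int l * E \<delta> \<le> int l * (j - 1)"
    using \<delta>(2) by (intro mult_left_mono) auto
  ultimately have "t + int l \<le> int n * (int l - 1)"
    using assms(3) by (simp add: algebra_simps)
  moreover have "sum u {1..n} = (\<Sum>i=1..n. (int l - 1) - (if i = c then int l - 1 else 0) - (if i = d then 1 else 0))"
    using cd' by (intro sum.cong) (auto simp: u_def)
  then have "sum u {1..n} = int n * (int l - 1) - (int l - 1) - 1"
    using cd' by (simp add: sum_subtractf)
  ultimately have "t \<le> sum u {1..n}"
    by linarith
  moreover have "u i \<ge> 0" for i
    using l_ge by (simp add: u_def)
  ultimately obtain b where b: "\<forall>i\<in>{1..n}. 0 \<le> b i \<and> b i \<le> u i" "\<forall>i. i \<notin> {1..n} \<longrightarrow> b i = 0" "sum b {1..n} = t"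
    using exists_bounded_sum[of "{1..n}" u t] assms(4) by blast
  have bounds: "0 \<le> b i \<and> b i < int l" for i
  proof (cases "i \<in> {1..n}")
    case True
    then have "0 \<le> b i" "b i \<le> u i" "u i < int l"
      using b(1) l_ge by (auto simp: u_def)
    then show ?thesis
      by linarith
  qed (use b(2) l_pos in auto)
  have "b c \<le> u c" "b d \<le> u d"
    using b(1) cd' by auto
  then show ?thesis
    using that[of b] bounds[of c] b cd' bounds by (simp add: residues_sum_def u_def)
qed

text \<open>A raising operator may leave a nonzero part of a leading-singular vector in layer
  \<open>j - 1\<close>, which already is a descent. Otherwise layer \<open>j - 1\<close> is singular
  as well and can be cleared, and the descent is produced by an explicit borrow.\<close>

lemma descent:
  assumes H: "stable n q H" and v: "v \<in> H" "v \<in> V s j" "v \<notin> V s (j - 1)"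
    and \<delta>: "\<delta> \<in> B s" "E \<delta> < j"
  obtains w where "w \<in> H" "w \<in> V s (j - 1)" "w \<notin> V s (j - 2)"
proof -
  obtain w where w: "w \<in> H" "w \<in> V s j" "w \<notin> V s (j - 1)"
    and sing: "\<And>i. i \<in> {1..n - 1} \<Longrightarrow> move n q (i + 1) i w \<in> V s (j - 1)"
    using exists_singular[OF H v] by metis
  show ?thesis
  proof (cases "\<forall>i\<in>{1..n - 1}. move n q (i + 1) i w \<in> V s (j - 2)")
    case False
    then obtain i where i: "i \<in> {1..n - 1}" "move n q (i + 1) i w \<notin> V s (j - 2)"
      by blast
    moreover have "adjacent n (i + 1) i"
      using i by (auto simp: adjacent_def)
    ultimately show ?thesis
      using that stable_move[OF H _ w(1)] sing by blast
  next
    case True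
    obtain w' a b where w': "w' \<in> H" "layer_at s j a b w'" and b: "dominant n l b"
      "b \<in> residues_sum n l (int s - int l * j)"
      and a: "\<And>i. a i \<ge> 0" "(\<Sum>i=1..n. a i) = j" "\<And>i. i \<notin> {1..n} \<Longrightarrow> a i = 0"
      using exists_layer_at_dominant[OF H w] True by metis
    have "(\<Sum>i=1..n. b i) \<ge> 0"
      using b(2) by (intro sum_nonneg) (auto simp: residues_sum_def)
    then have t: "0 \<le> int s - int l * j"
      using b(2) by (simp add: residues_sum_def)
    \<comment> \<open>The borrow has to start at an entry with positive quotient. There is one,
      because the quotients sum to \<open>j\<close>, which exceeds the nonnegative energy of
      \<open>\<delta>\<close>.\<close>
    have "j > 0"
      using \<delta> E_nonneg[OF B_D(1)[OF \<delta>(1)]] by linarith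
    then obtain c where c: "c \<in> {1..n}" "a c > 0"
      using a(2) sum_nonpos[of "{1..n}" a] by (metis linorder_not_less)
    obtain d where cd: "adjacent n c d"
      using c n_ge by (cases "c < n") (auto simp: adjacent_def intro: that[of "c + 1"] that[of "c - 1"])
    have cd': "c \<in> {1..n}" "d \<in> {1..n}" "c \<noteq> d"
      using adjacentD[OF cd] by auto
    \<comment> \<open>Residue 0 at \<open>c\<close> makes the move borrow, and a residue below
      \<open>l - 1\<close> at \<open>d\<close> keeps it from carrying.\<close>
    obtain b' where b': "b' \<in> residues_sum n l (int s - int l * j)" "b' c = 0" "b' d < int l - 1"
      using exists_residue_with_room[OF \<delta> refl t cd] by metis
    obtain y where y: "y \<in> H" "layer_at s j a b' y"
      using layer_at_transport[OF H w' b(2,1) b'(1)] by metis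
    define \<gamma> where "\<gamma> = (\<lambda>i. int l * a i + b' i)"
    have bb: "0 \<le> b' i" "b' i < int l" for i
      using b'(1) by (auto simp: residues_sum_def)
    have \<gamma>: "Poly_Mapping.lookup y \<gamma> \<noteq> 0"
      using y(2) by (simp add: layer_at_def \<gamma>_def)
    then have \<gamma>B: "\<gamma> \<in> B s"
      using y(2) by (auto simp: layer_at_def V_iff)
    have mods: "\<gamma> i mod int l = b' i" and divs: "\<gamma> i div int l = a i" for i
      using bb[of i] by (simp_all add: \<gamma>_def)
    have E\<gamma>: "E \<gamma> = j"
      using a(2) by (simp add: Edeg_def divs)
    have dvd_c: "int l dvd \<gamma> c"
      using mods[of c] b'(2) by (simp add: dvd_eq_mod_eq_0)
    have ndvd_d: "\<not> int l dvd \<gamma> d + 1"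
      using dvd_add_1_iff[OF l_pos, of "\<gamma> d"] mods[of d] b'(3) by simp
    have "int l * a c \<ge> 1"
      using c(2) l_pos by (simp add: int_one_le_iff_zero_less)
    then have "\<gamma> c \<ge> 1"
      using b'(2) by (simp add: \<gamma>_def)
    then have sB: "shift c d \<gamma> \<in> B s"
      using shift_in_B[of \<gamma> s c d, OF \<gamma>B cd' _ ndvd_d] by blast
    \<comment> \<open>All of layer \<open>j\<close> has residue 0 at \<open>c\<close>, so every term
      that survives the move borrows and leaves the layer.\<close>
    have "move n q c d y \<in> V s (j - 1)"
      unfolding V_iff
    proof (intro allI impI)
      fix \<eta>
      assume nz: "Poly_Mapping.lookup (move n q c d y) \<eta> \<noteq> 0"
      then obtain \<beta> where \<beta>: "\<eta> = shift c d \<beta>" "Poly_Mapping.lookup y \<beta> \<noteq> 0" "\<not> int l dvd \<beta> d + 1"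
        using lookup_move_nonzero[OF cd] by metis
      have "move n q c d y \<in> V s j"
        using y(2) by (intro stable_move[OF stable_V cd]) (simp add: layer_at_def)
      then have "\<eta> \<in> B s"
        using nz by (simp add: V_iff)
      have E\<eta>: "E \<eta> = E \<beta> - of_bool (int l dvd \<beta> c)"
        using E_shift[of \<beta> d c, OF \<beta>(3) cd'(3,1)] \<beta>(1) by simp
      consider "E \<beta> = j" "residue l \<beta> = b'" | "E \<beta> \<le> j - 2"
        using y(2) \<beta>(2) by (auto simp: layer_at_def)
      then have "E \<eta> \<le> j - 1"
      proof cases
        case 1
        then have "int l dvd \<beta> c"
          using b'(2) by (auto simp: residue_def dvd_eq_mod_eq_0)
        then show ?thesis
          using 1 E\<eta> by simp
      qed (use E\<eta> in \<open>auto simp: of_bool_def split: if_splits\<close>)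
      then show "\<eta> \<in> B s \<and> E \<eta> \<le> j - 1"
        using \<open>\<eta> \<in> B s\<close> by simp
    qed
    moreover have "Poly_Mapping.lookup (move n q c d y) (shift c d \<gamma>) \<noteq> 0"
      using lookup_move_shift[of c d \<gamma>, OF cd B_D(1)[OF sB]] \<gamma> ndvd_d by (simp add: qint_eq_0)
    then have "move n q c d y \<notin> V s (j - 2)"
      using E_shift[of \<gamma> d c, OF ndvd_d cd'(3,1)] dvd_c E\<gamma> by (auto simp: V_iff)
    ultimately show ?thesis
      using that stable_move[OF H cd y(1)] by blast
  qed
qed

lemma descent_le:
  assumes H: "stable n q H" and v: "v \<in> H" "v \<in> V s j" "v \<notin> V s (j - 1)"
    and \<delta>: "\<delta> \<in> B s" "E \<delta> \<le> k" and k: "k \<le> j"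
  obtains w where "w \<in> H" "w \<in> V s k" "w \<notin> V s (k - 1)"
proof -
  have "\<exists>w\<in>H. w \<in> V s k \<and> w \<notin> V s (k - 1)"
    using k v
  proof (induction j arbitrary: v rule: int_ge_induct)
    case base
    then show ?case
      by blast
  next
    case (step i)
    obtain w where "w \<in> H" "w \<in> V s (i + 1 - 1)" "w \<notin> V s (i + 1 - 2)"
      using descent[OF H step.prems, of \<delta>] \<delta> step.hyps by auto
    then show ?case
      using step.IH[of w] by simp
  qed
  then show ?thesis
    using that by blast
qed

lemma exists_layer:
  assumes "v \<in> V s J" "v \<notin> V s k"
  obtains j where "j > k" "v \<in> V s j" "v \<notin> V s (j - 1)"
proof -
  have "k \<le> J"
    using assms V_mono[of J k s] by (cases "k \<le> J") auto
  then have "\<exists>j>k. v \<in> V s j \<and> v \<notin> V s (j - 1)"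
    using assms
  proof (induction J rule: int_ge_induct)
    case (step i)
    then show ?case
      by (cases "v \<in> V s i") (auto intro!: exI[of _ "i + 1"])
  qed auto
  then show ?thesis
    using that by blast
qed

section \<open>The simple pieces of a layer\<close>

lemma supported_subset:
  fixes H :: "((nat \<Rightarrow> int) \<Rightarrow>\<^sub>0 'k) set"
  assumes "scale.subspace H" "S \<subseteq> Zplus n" "\<And>\<beta>. \<beta> \<in> S \<Longrightarrow> x_pow n \<beta> \<in> H"
  shows "supported S \<subseteq> H"
  unfolding span_x_pow[OF assms(2), symmetric] using assms by (intro scale.span_minimal) auto

lemma x_pow_in_supported: "\<beta> \<in> S \<Longrightarrow> x_pow n \<beta> \<in> supported S"
  by (auto simp: in_supported lookup_x_pow)

text \<open>When layer \<open>k\<close> has a monomial with quotients \<open>a\<close>, this is one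
  simple summand of the layer, pulled back along reduction modulo
  \<open>V s (k - 1)\<close>.\<close>

definition T :: "nat \<Rightarrow> int \<Rightarrow> (nat \<Rightarrow> int) \<Rightarrow> ((nat \<Rightarrow> int) \<Rightarrow>\<^sub>0 'k) set" where
  "T s k a = supported {\<gamma> \<in> B s. E \<gamma> < k \<or> E \<gamma> = k \<and> (\<lambda>i. \<gamma> i div int l) = a}"

text \<open>A move within layer \<open>k\<close> keeps all quotients, and a borrow leads below the
  layer, where \<open>P\<close> imposes nothing. General \<open>P\<close> is convenient: both one
  vector of quotients and its complement are needed.\<close>

lemma stable_layer_pieces:
  "stable n q (supported {\<gamma> \<in> B s. E \<gamma> < k \<or> E \<gamma> = k \<and> P (\<lambda>i. \<gamma> i div int l)})"
proof (rule stable_supported)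
  fix \<beta> c d
  assume *: "\<beta> \<in> {\<gamma> \<in> B s. E \<gamma> < k \<or> E \<gamma> = k \<and> P (\<lambda>i. \<gamma> i div int l)}"
    "adjacent n c d" "\<beta> c \<ge> 1" "\<not> int l dvd \<beta> d + 1"
  have cd: "c \<in> {1..n}" "d \<in> {1..n}" "c \<noteq> d"
    using adjacentD[OF *(2)] by auto
  have "shift c d \<beta> \<in> B s"
    using * cd by (intro shift_in_B) auto
  moreover have "E (shift c d \<beta>) = E \<beta> - of_bool (int l dvd \<beta> c)"
    using E_shift[of \<beta> d c] * cd by auto
  moreover have "(\<lambda>i. shift c d \<beta> i div int l) = (\<lambda>i. \<beta> i div int l)" if "\<not> int l dvd \<beta> c"
    using shift_div[of \<beta> d c] * cd that by auto
  ultimately show "shift c d \<beta> \<in> {\<gamma> \<in> B s. E \<gamma> < k \<or> E \<gamma> = k \<and> P (\<lambda>i. \<gamma> i div int l)}"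
    using *(1) by (cases "int l dvd \<beta> c") auto
qed (auto dest: B_D)

lemma stable_T: "stable n q (T s k a)"
  unfolding T_def using stable_layer_pieces[of s k "\<lambda>x. x = a"] .

text \<open>Simplicity of a piece. Raising inside \<open>H \<inter> T s k a\<close> yields a
  singular vector whose leading layer has fixed quotients and, by uniqueness of dominant residues,
  is a single monomial. Lowering moves then produce all other monomials of the piece.\<close>

lemma T_subset_if_meets:
  assumes H: "stable n q H" "V s (k - 1) \<subseteq> H" and v: "v \<in> H" "v \<in> T s k a" "v \<notin> V s (k - 1)"
  shows "T s k a \<subseteq> H"
proof -
  have subs: "scale.subspace H"
    using H by (simp add: stable_def)
  have "v \<in> V s k"
    using v(2) by (auto simp: T_def V_iff in_supported)
  obtain w where w: "w \<in> H \<inter> T s k a" "w \<in> V s k" "w \<notin> V s (k - 1)"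
    and sing: "\<And>i. i \<in> {1..n - 1} \<Longrightarrow> move n q (i + 1) i w \<in> V s (k - 1)"
    using exists_singular[OF stable_inter[OF H(1) stable_T] _ \<open>v \<in> V s k\<close> v(3)] v by blast
  obtain \<gamma>0 where \<gamma>0: "Poly_Mapping.lookup w \<gamma>0 \<noteq> 0" "\<gamma>0 \<in> B s" "E \<gamma>0 = k"
    using not_in_V_diff[OF w(2,3)] by metis
  define t where "t = int s - int l * k"
  have wT: "\<gamma> \<in> B s \<and> (E \<gamma> < k \<or> E \<gamma> = k \<and> (\<lambda>i. \<gamma> i div int l) = a)" if "Poly_Mapping.lookup w \<gamma> \<noteq> 0" for \<gamma>
    using w(1) that by (auto simp: T_def in_supported)
  have key_form: "\<gamma> = (\<lambda>i. int l * a i + residue l \<gamma> i)" if "(\<lambda>i. \<gamma> i div int l) = a" for \<gamma>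
    using that by (auto simp: residue_def)
  have b0: "residue l \<gamma>0 \<in> residues_sum n l t" "dominant n l (residue l \<gamma>0)"
    using residue_in_residues_sum[OF \<gamma>0(2)] dominant_if_singular[OF sing \<gamma>0] \<gamma>0(3) by (auto simp: t_def)
  have unique: "\<gamma> = \<gamma>0" if \<gamma>: "Poly_Mapping.lookup w \<gamma> \<noteq> 0" "E \<gamma> = k" for \<gamma>
  proof -
    have "\<gamma> \<in> B s" "(\<lambda>i. \<gamma> i div int l) = a" "(\<lambda>i. \<gamma>0 i div int l) = a"
      using wT[OF \<gamma>(1)] wT[OF \<gamma>0(1)] \<gamma>(2) \<gamma>0(3) by auto
    moreover from this have "residue l \<gamma> = residue l \<gamma>0"
      using dominant_unique[OF l_ge _ _ b0] residue_in_residues_sum[of \<gamma> s]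
        dominant_if_singular[OF sing \<gamma>(1) _ \<gamma>(2)] \<gamma>(2) by (simp add: t_def)
    ultimately show ?thesis
      using key_form[of \<gamma>] key_form[of \<gamma>0] by metis
  qed
  \<comment> \<open>What remains besides the leading monomial is in \<open>V s (k - 1)\<close>,
    hence in \<open>H\<close>, and can be subtracted.\<close>
  have "w - scale (Poly_Mapping.lookup w \<gamma>0) (x_pow n \<gamma>0) \<in> V s (k - 1)"
    unfolding V_iff
  proof (intro allI impI)
    fix \<gamma>
    assume nz: "Poly_Mapping.lookup (w - scale (Poly_Mapping.lookup w \<gamma>0) (x_pow n \<gamma>0)) \<gamma> \<noteq> 0"
    then have "\<gamma> \<noteq> \<gamma>0" "Poly_Mapping.lookup w \<gamma> \<noteq> 0"
      using B_D(1)[OF \<gamma>0(2)] by (auto simp: lookup_minus lookup_x_pow split: if_splits)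
    then show "\<gamma> \<in> B s \<and> E \<gamma> \<le> k - 1"
      using wT[of \<gamma>] unique[of \<gamma>] by auto
  qed
  then have "w - (w - scale (Poly_Mapping.lookup w \<gamma>0) (x_pow n \<gamma>0)) \<in> H"
    using w(1) H(2) scale.subspace_diff[OF subs] by blast
  then have "scale (Poly_Mapping.lookup w \<gamma>0) (x_pow n \<gamma>0) \<in> H"
    by simp
  then have "scale (inverse (Poly_Mapping.lookup w \<gamma>0)) (scale (Poly_Mapping.lookup w \<gamma>0) (x_pow n \<gamma>0)) \<in> H"
    by (rule scale.subspace_scale[OF subs])
  then have x0: "x_pow n \<gamma>0 \<in> H"
    using \<gamma>0(1) by simp
  have all: "x_pow n (\<lambda>i. int l * a i + b i) \<in> H" if "b \<in> residues_sum n l t" for b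
    using that
  proof (induction rule: residues_sum_induct)
    case (dominant b)
    then have "b = residue l \<gamma>0"
      using dominant_unique[OF l_ge _ _ b0] by blast
    moreover have "(\<lambda>i. \<gamma>0 i div int l) = a"
      using wT[OF \<gamma>0(1)] \<gamma>0(3) by auto
    ultimately show ?case
      using x0 key_form[of \<gamma>0] by metis
  next
    case (shift b i)
    define \<gamma> where "\<gamma> = (\<lambda>i. int l * a i + b i)"
    have adj: "adjacent n i (i + 1)"
      using shift by (auto simp: adjacent_def)
    have "(int l * a (i + 1) + b (i + 1)) mod int l = b (i + 1)"
      using shift(1) by (auto simp: residues_sum_def)
    then have ndvd: "\<not> int l dvd \<gamma> (i + 1) + 1"
      using dvd_add_1_iff[OF l_pos, of "\<gamma> (i + 1)"] shift(4) by (simp add: \<gamma>_def)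
    have form: "(\<lambda>j. int l * a j + shift i (i + 1) b j) = shift i (i + 1) \<gamma>"
      by (auto simp: shift_def \<gamma>_def)
    show ?case
    proof (cases "\<gamma> \<in> Zplus n \<and> shift i (i + 1) \<gamma> \<in> Zplus n")
      case True
      have "move n q i (i + 1) (x_pow n \<gamma>) = scale (qint q (\<gamma> (i + 1) + 1)) (x_pow n (shift i (i + 1) \<gamma>))"
      proof (rule poly_mapping_eqI)
        fix \<eta>
        show "Poly_Mapping.lookup (move n q i (i + 1) (x_pow n \<gamma>)) \<eta> =
            Poly_Mapping.lookup (scale (qint q (\<gamma> (i + 1) + 1)) (x_pow n (shift i (i + 1) \<gamma>))) \<eta>"
        proof (cases "\<eta> = shift i (i + 1) \<gamma>")
          case False
          then have "shift (i + 1) i \<eta> \<noteq> \<gamma>"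
            by (metis shift_shift)
          then show ?thesis
            unfolding lookup_move[OF adj] lookup_scale lookup_x_pow using False by simp
        next
          case eq: True
          show ?thesis
            unfolding eq using True by (subst lookup_move_shift[OF adj]) (auto simp: lookup_x_pow)
        qed
      qed
      then have "scale (qint q (\<gamma> (i + 1) + 1)) (x_pow n (shift i (i + 1) \<gamma>)) \<in> H"
        using stable_move[OF H(1) adj shift(5)] by (simp add: \<gamma>_def)
      then have "scale (inverse (qint q (\<gamma> (i + 1) + 1))) (scale (qint q (\<gamma> (i + 1) + 1)) (x_pow n (shift i (i + 1) \<gamma>))) \<in> H"
        using scale.subspace_scale[OF subs] by blast
      then show ?thesis
        unfolding form using ndvd by (simp add: qint_eq_0)
    next
      \<comment> \<open>This case is contradictory: quotients and residues are nonnegative, and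
        \<open>b i > 0\<close> lets entry \<open>i\<close> give up a unit.\<close>
      case False
      have a_nonneg: "a j \<ge> 0" for j
        using wT[OF \<gamma>0(1)] \<gamma>0(3) B_D(2)[OF \<gamma>0(2), of j] l_pos
        by (auto simp: pos_imp_zdiv_nonneg_iff)
      note a_nonneg
      moreover have "a j = 0" if "j \<notin> {1..n}" for j
        using wT[OF \<gamma>0(1)] \<gamma>0(3) B_D(3)[OF \<gamma>0(2) that] by auto
      moreover have "b j \<ge> 0" "j \<notin> {1..n} \<Longrightarrow> b j = 0" for j
        using shift(1) by (auto simp: residues_sum_def)
      moreover have "1 \<le> int l * a i + b i"
        using mult_nonneg_nonneg[of "int l" "a i"] a_nonneg[of i] shift(3) by linarith
      ultimately have "\<gamma> \<in> Zplus n" "shift i (i + 1) \<gamma> \<in> Zplus n"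
        using shift(2,3) by (auto simp: Zplus_def \<gamma>_def shift_def)
      then show ?thesis
        using False by blast
    qed
  qed
  show ?thesis
    unfolding T_def
  proof (rule supported_subset[OF subs])
    fix \<beta>
    assume \<beta>: "\<beta> \<in> {\<gamma> \<in> B s. E \<gamma> < k \<or> E \<gamma> = k \<and> (\<lambda>i. \<gamma> i div int l) = a}"
    show "x_pow n \<beta> \<in> H"
    proof (cases "E \<beta> < k")
      case True
      then have "x_pow n \<beta> \<in> V s (k - 1)"
        using \<beta> by (auto simp: V_def intro!: x_pow_in_supported)
      then show ?thesis
        using H(2) by blast
    next
      case False
      then have "E \<beta> = k" "\<beta> = (\<lambda>i. int l * a i + residue l \<beta> i)" "\<beta> \<in> B s"
        using \<beta> key_form[of \<beta>] by auto
      then show ?thesis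
        using all[of "residue l \<beta>"] residue_in_residues_sum[of \<beta> s] by (simp add: t_def)
    qed
  qed (auto dest: B_D)
qed

section \<open>The truncated module and its socle series\<close>

abbreviation "M s \<equiv> uq_module n q (supported (B s))"

abbreviation "U \<equiv> small_uq n q l"

lemma stable_supported_B: "stable n q (supported (B s))"
  by (rule stable_supported) (auto intro: shift_in_B dest: adjacentD B_D(1))

lemma supported_B_subset: "supported (B s) \<subseteq> supported (Zplus n)"
  using Zplus_trunc_subset by (rule supported_mono)

lemma V_subset: "V s k \<subseteq> supported (B s)"
  unfolding V_def by (rule supported_mono) auto

lemma left_module_M: "left_module U (M s)"
  by (rule left_module_uq_module[OF stable_supported_B supported_B_subset])

lemma submodule_M_iff: "submodule H U (M s) \<longleftrightarrow> stable n q H \<and> H \<subseteq> supported (B s)"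
  by (rule submodule_uq_module_iff[OF stable_supported_B supported_B_subset])

lemma Emin_le: "\<gamma> \<in> B s \<Longrightarrow> E_min n l m s \<le> E \<gamma>"
  unfolding E_min_def using finite_B by (intro Min_le) auto

lemma Emax_ge: "\<gamma> \<in> B s \<Longrightarrow> E \<gamma> \<le> E_max n l m s"
  unfolding E_max_def using finite_B by (intro Max_ge) auto

lemma V_Emax: "E_max n l m s \<le> k \<Longrightarrow> V s k = supported (B s)"
  unfolding V_def using Emax_ge[of _ s] by (intro arg_cong[of _ _ supported]) force

lemma V_Emin: "k < E_min n l m s \<Longrightarrow> V s k = {0}"
proof -
  assume k: "k < E_min n l m s"
  have "{\<gamma> \<in> B s. E \<gamma> \<le> k} = {}"
    using Emin_le[of _ s] k by force
  then show ?thesis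
    unfolding V_def by (simp only: supported_def) (auto simp: keys_eq_empty)
qed

lemma subspace_if_stable: "stable n q H \<Longrightarrow> scale.subspace H"
  by (simp add: stable_def)

lemma atom_over_T:
  assumes "\<beta> \<in> B s" "E \<beta> = k" "(\<lambda>i. \<beta> i div int l) = a"
  shows "atom_over (V s (k - 1)) U (M s) (T s k a)"
  unfolding atom_over_def submodule_M_iff
proof (intro conjI allI impI)
  show "stable n q (T s k a)"
    by (rule stable_T)
  show "T s k a \<subseteq> supported (B s)"
    unfolding T_def by (rule supported_mono) auto
  have "V s (k - 1) \<subseteq> T s k a"
    unfolding T_def V_def by (rule supported_mono) auto
  moreover have "x_pow n \<beta> \<in> T s k a"
    unfolding T_def using assms by (intro x_pow_in_supported) auto
  moreover have "x_pow n \<beta> \<notin> V s (k - 1)"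
    using assms B_D(1)[OF assms(1)] by (auto simp: V_iff lookup_x_pow intro!: exI[of _ \<beta>])
  ultimately show "V s (k - 1) \<subset> T s k a"
    by blast
  fix H
  assume "stable n q H \<and> H \<subseteq> supported (B s)" "V s (k - 1) \<subset> H" "H \<subseteq> T s k a"
  moreover from this obtain v where "v \<in> H" "v \<notin> V s (k - 1)"
    by blast
  ultimately have "T s k a \<subseteq> H"
    using T_subset_if_meets[of H s k v a] by blast
  with \<open>H \<subseteq> T s k a\<close> show "H = T s k a"
    by blast
qed

text \<open>An element outside \<open>V s k\<close> descends, within the atom, to one with leading
  layer exactly \<open>k\<close>. So the intersection with \<open>V s k\<close> is strictly above
  \<open>V s (k - 1)\<close>, and minimality makes it the whole atom.\<close>

lemma atom_over_subset:
  assumes T: "atom_over (V s (k - 1)) U (M s) T'" and k: "\<delta> \<in> B s" "E \<delta> \<le> k"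
  shows "T' \<subseteq> V s k"
proof (rule ccontr)
  have stab: "stable n q T'" and sub: "T' \<subseteq> supported (B s)" "V s (k - 1) \<subset> T'"
    and atom: "\<And>H. stable n q H \<Longrightarrow> V s (k - 1) \<subset> H \<Longrightarrow> H \<subseteq> T' \<Longrightarrow> H = T'"
    using T unfolding atom_over_def submodule_M_iff by (blast | meson order_trans)+
  assume "\<not> T' \<subseteq> V s k"
  then obtain v where v: "v \<in> T'" "v \<notin> V s k"
    by blast
  have "v \<in> V s (E_max n l m s)"
    using v(1) sub V_Emax by blast
  then obtain j where j: "j > k" "v \<in> V s j" "v \<notin> V s (j - 1)"
    using exists_layer[OF _ v(2)] by metis
  obtain w where w: "w \<in> T'" "w \<in> V s k" "w \<notin> V s (k - 1)"
    using descent_le[OF stab v(1) j(2,3) k] j(1) by auto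
  have "V s (k - 1) \<subset> T' \<inter> V s k"
    using w sub V_mono[of "k - 1" k s] by auto
  then have "T' \<inter> V s k = T'"
    using atom[OF stable_inter[OF stab stable_V]] by blast
  then show False
    using v by blast
qed

text \<open>The offset -1 places the zero module just below the lowest layer. No bound on
  \<open>j\<close> is imposed, as \<open>V\<close> is constant from \<open>E_max\<close> on.\<close>

lemma Soc_pow_eq: "Soc_pow U (M s) j = V s (E_min n l m s - 1 + int j)" if "B s \<noteq> {}"
proof (induction j)
  case 0
  show ?case
    by (simp add: V_Emin)
next
  case (Suc j)
  define k where "k = E_min n l m s + int j"
  \<comment> \<open>A monomial of minimal energy is the witness that descent may go on down to layer
    \<open>k\<close>.\<close>
  have "E_min n l m s \<in> E ` B s"
    unfolding E_min_def using that finite_B by (intro Min_in) auto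
  then obtain \<delta> where \<delta>: "\<delta> \<in> B s" "E \<delta> \<le> k"
    by (auto simp: k_def)
  have IH: "Soc_pow U (M s) j = V s (k - 1)"
    using Suc by (simp add: k_def algebra_simps)
  interpret quotient U "M s" "V s (k - 1)"
    by (intro quotient.intro left_module_M quotient_axioms.intro)
      (simp add: submodule_M_iff stable_V V_subset)
  have "{x \<in> carrier (M s). V s (k - 1) +>\<^bsub>M s\<^esub> x \<in> Soc U (quotient_module (M s) (V s (k - 1)))} = V s k"
  proof (rule Soc_quotient)
    show "submodule (V s k) U (M s)"
      by (simp add: submodule_M_iff stable_V V_subset)
    show "V s (k - 1) \<subseteq> V s k"
      by (rule V_mono) simp
    show "T' \<subseteq> V s k" if "atom_over (V s (k - 1)) U (M s) T'" for T'
      using atom_over_subset[OF that \<delta>] .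
    fix H
    assume H: "submodule H U (M s)" "V s (k - 1) \<subseteq> H"
      "\<And>T'. atom_over (V s (k - 1)) U (M s) T' \<Longrightarrow> T' \<subseteq> H"
    show "V s k \<subseteq> H"
      unfolding V_def
    proof (rule supported_subset)
      show "scale.subspace H"
        using H(1) by (simp add: submodule_M_iff stable_def)
      fix \<beta>
      assume \<beta>: "\<beta> \<in> {\<gamma> \<in> B s. E \<gamma> \<le> k}"
      show "x_pow n \<beta> \<in> H"
      proof (cases "E \<beta> = k")
        case True
        then have "x_pow n \<beta> \<in> T s k (\<lambda>i. \<beta> i div int l)"
          unfolding T_def using \<beta> by (intro x_pow_in_supported) auto
        then show ?thesis
          using H(3)[OF atom_over_T[of \<beta> s k]] \<beta> True by blast
      next
        case False
        then have "x_pow n \<beta> \<in> V s (k - 1)"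
          unfolding V_def using \<beta> by (intro x_pow_in_supported) auto
        then show ?thesis
          using H(2) by blast
      qed
    qed (auto dest: B_D)
  qed
  then have "Soc_pow U (M s) (Suc j) = V s k"
    unfolding Soc_pow.simps IH .
  then show ?case
    by (simp add: k_def)
qed

end

section \<open>Duality and the radical filtration\<close>

context energy
begin

section \<open>Complementary exponents and the pairing\<close>

definition star :: "(nat \<Rightarrow> int) \<Rightarrow> nat \<Rightarrow> int" where
  "star \<gamma> i = (if i \<in> {1..n} then int m * int l - 1 - \<gamma> i else 0)"

lemma star_star: "\<gamma> \<in> B s \<Longrightarrow> star (star \<gamma>) = \<gamma>"
  using B_D(3)[of \<gamma> s] by (auto simp: star_def fun_eq_iff)

lemma star_in_B:
  assumes "\<gamma> \<in> B s" "s + s' = n * (m * l - 1)"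
  shows "star \<gamma> \<in> B s'"
proof -
  have "m * l \<ge> 1"
    using m_ge l_ge by simp
  then have "int s + int s' = int n * (int m * int l - 1)"
    using arg_cong[OF assms(2), of int] by (simp add: of_nat_diff)
  moreover have "(\<Sum>i=1..n. star \<gamma> i) = int n * (int m * int l - 1) - (\<Sum>i=1..n. \<gamma> i)"
    by (simp add: star_def sum_subtractf)
  ultimately have "(\<Sum>i=1..n. star \<gamma> i) = int s'"
    using B_D(4)[OF assms(1)] by linarith
  moreover have "0 \<le> star \<gamma> i" "i \<in> {1..n} \<Longrightarrow> star \<gamma> i \<le> int m * int l - 1" for i
    using B_D(2)[OF assms(1), of i] B_D(5)[OF assms(1), of i] by (auto simp: star_def)
  moreover have "i \<notin> {1..n} \<Longrightarrow> star \<gamma> i = 0" for i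
    by (simp only: star_def if_False)
  ultimately show ?thesis
    by (simp add: Zplus_trunc_def Zplus_def)
qed

text \<open>With \<open>m l - 1\<close> as the total, a residue x becomes \<open>l - 1 - x\<close>
  without a borrow, so each quotient a becomes \<open>m - 1 - a\<close>.\<close>

lemma E_star: "E (star \<gamma>) = int n * (int m - 1) - E \<gamma>"
proof -
  have "(int m * int l - 1 - x) div int l = int m - 1 - x div int l" for x
  proof (rule int_div_pos_eq)
    show "int m * int l - 1 - x = int l * (int m - 1 - x div int l) + (int l - 1 - x mod int l)"
      using mult_div_mod_eq[of "int l" x] by (simp add: algebra_simps)
    show "0 \<le> int l - 1 - x mod int l" "int l - 1 - x mod int l < int l"
      using pos_mod_sign[OF l_pos, of x] pos_mod_bound[OF l_pos, of x] by linarith+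
  qed
  then have "E (star \<gamma>) = (\<Sum>i=1..n. int m - 1 - \<gamma> i div int l)"
    unfolding Edeg_def by (intro sum.cong) (auto simp: star_def)
  then show ?thesis
    by (simp add: Edeg_def sum_subtractf)
qed

lemma star_shift:
  assumes "c \<in> {1..n}" "d \<in> {1..n}"
  shows "star (shift c d \<gamma>) = shift d c (star \<gamma>)"
  using assms by (auto simp: star_def shift_def)

text \<open>The pairing \<open>\<langle>x\<^sup>(\<^sup>\<gamma>\<^sup>), x\<^sup>(\<^sup>\<beta>\<^sup>)\<rangle> = 1\<close> if \<open>\<gamma> + \<beta>\<close> is the exponent with all entries \<open>m * l - 1\<close>, and \<open>0\<close>
  otherwise.\<close>

definition pairing :: "nat \<Rightarrow> ((nat \<Rightarrow> int) \<Rightarrow>\<^sub>0 'k) \<Rightarrow> ((nat \<Rightarrow> int) \<Rightarrow>\<^sub>0 'k) \<Rightarrow> 'k" where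
  "pairing s u v = (\<Sum>\<beta>\<in>B s. Poly_Mapping.lookup u (star \<beta>) * Poly_Mapping.lookup v \<beta>)"

lemma pairing_add_left: "pairing s (u + u') v = pairing s u v + pairing s u' v"
  by (simp add: pairing_def lookup_add distrib_right sum.distrib)

lemma pairing_add_right: "pairing s u (v + v') = pairing s u v + pairing s u v'"
  by (simp add: pairing_def lookup_add distrib_left sum.distrib)

lemma pairing_scale_left: "pairing s (scale c u) v = c * pairing s u v"
  by (simp add: pairing_def sum_distrib_left mult_ac)

text \<open>Complementation reverses a shift, and so does passing to the transpose; hence the
  adjoint of a move is the same move. The factor compares \<open>[m l - a]\<close> with
  \<open>[a]\<close>.\<close>

lemma pairing_move:
  assumes u: "u \<in> supported (B s')" and v: "v \<in> supported (B s)" and ss': "s + s' = n * (m * l - 1)"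
    and cd: "adjacent n c d"
  shows "pairing s (move n q c d u) v = - (q powi (int m * int l)) * pairing s u (move n q c d v)"
proof -
  have cd': "c \<in> {1..n}" "d \<in> {1..n}" "c \<noteq> d"
    using adjacentD[OF cd] by auto
  have s's: "s' + s = n * (m * l - 1)"
    using ss' by simp
  define f where "f \<beta> = Poly_Mapping.lookup (move n q c d u) (star \<beta>) * Poly_Mapping.lookup v \<beta>" for \<beta>
  define g where "g \<beta> = - (q powi (int m * int l)) * (Poly_Mapping.lookup u (star \<beta>) * Poly_Mapping.lookup (move n q c d v) \<beta>)" for \<beta>
  have f: "f \<beta> = qint q (star \<beta> d) * Poly_Mapping.lookup u (star (shift c d \<beta>)) * Poly_Mapping.lookup v \<beta>" if "\<beta> \<in> B s" for \<beta>
    using B_D(1)[OF star_in_B[OF that ss']] by (simp add: f_def lookup_move[OF cd] star_shift[OF cd'(1,2)])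
  have g: "g \<beta> = - (q powi (int m * int l)) * qint q (\<beta> d) * Poly_Mapping.lookup u (star \<beta>) * Poly_Mapping.lookup v (shift d c \<beta>)"
    if "\<beta> \<in> Zplus n" for \<beta>
    using that by (simp add: g_def lookup_move[OF cd])
  have in_B_u: "\<beta> \<in> B s" if "Poly_Mapping.lookup u (star \<beta>) \<noteq> 0" "\<And>i. i \<notin> {1..n} \<Longrightarrow> \<beta> i = 0" for \<beta>
  proof -
    have "star \<beta> \<in> B s'"
      using u that(1) by (simp add: in_supported)
    then have "star (star \<beta>) \<in> B s"
      by (rule star_in_B[OF _ s's])
    moreover have "star (star \<beta>) = \<beta>"
      using that(2) by (auto simp: star_def fun_eq_iff)
    ultimately show ?thesis
      by simp
  qed
  \<comment> \<open>A shift may leave the box of exponents, so reindexing is a bijection only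
    between the indices with nonzero terms.\<close>
  have "sum f (B s) = sum g (B s)"
  proof (rule sum.reindex_bij_witness_not_neutral[where i = "shift d c" and j = "shift c d"
        and S' = "{\<beta> \<in> B s. f \<beta> = 0}" and T' = "{\<beta> \<in> B s. g \<beta> = 0}"])
    show "finite {\<beta> \<in> B s. f \<beta> = 0}" "finite {\<beta> \<in> B s. g \<beta> = 0}"
      using finite_B by simp_all
    have in_B: "shift c d \<beta> \<in> B s" if \<beta>: "\<beta> \<in> B s" "f \<beta> \<noteq> 0" for \<beta>
      using \<beta> B_D(3)[OF \<beta>(1)] cd' by (intro in_B_u) (auto simp: f shift_def)
    show g_f: "g (shift c d \<beta>) = f \<beta>" if \<beta>: "\<beta> \<in> B s" for \<beta>
    proof (cases "shift c d \<beta> \<in> Zplus n")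
      case True
      have "qint q (star \<beta> d) = - (q powi (int m * int l)) * qint q (shift c d \<beta> d)"
        using qint_reflect[of m "\<beta> d + 1"] cd' by (simp add: star_def shift_def algebra_simps)
      then show ?thesis
        by (simp add: g[OF True] f[OF \<beta>])
    next
      case False
      then have "g (shift c d \<beta>) = 0"
        by (simp add: g_def lookup_move[OF cd])
      then show ?thesis
        using in_B[OF \<beta>] False B_D(1) by metis
    qed
    show "shift c d \<beta> \<in> B s - {\<beta> \<in> B s. g \<beta> = 0}" if "\<beta> \<in> B s - {\<beta> \<in> B s. f \<beta> = 0}" for \<beta>
      using in_B[of \<beta>] g_f[of \<beta>] that by auto
    show "shift d c \<beta> \<in> B s - {\<beta> \<in> B s. f \<beta> = 0}" if "\<beta> \<in> B s - {\<beta> \<in> B s. g \<beta> = 0}" for \<beta>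
    proof -
      have \<beta>: "\<beta> \<in> B s" "g \<beta> \<noteq> 0"
        using that by auto
      then have sB: "shift d c \<beta> \<in> B s"
        using v by (auto simp: g[OF B_D(1)] in_supported)
      have "qint q (star (shift d c \<beta>) d) = - (q powi (int m * int l)) * qint q (\<beta> d)"
        using qint_reflect[of m "\<beta> d"] cd' by (simp add: star_def shift_def)
      then have "f (shift d c \<beta>) = g \<beta>"
        by (simp add: g[OF B_D(1)[OF \<beta>(1)]] f[OF sB])
      then show ?thesis
        using sB \<beta> by simp
    qed
  qed auto
  then show ?thesis
    by (simp add: f_def g_def pairing_def sum_distrib_left)
qed

text \<open>Complementation negates the difference of neighbouring entries, so \<open>K_i\<close> is
  adjoint to its inverse.\<close>

lemma pairing_K:
  assumes u: "u \<in> supported (B s')" and v: "v \<in> supported (B s)" and ss': "s + s' = n * (m * l - 1)"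
    and i: "i \<in> {1..n - 1}"
  shows "pairing s (gen_act n q (gen_K i) u) v = pairing s u (gen_act n q (gen_Kinv i) v)"
    and "pairing s (gen_act n q (gen_Kinv i) u) v = pairing s u (gen_act n q (gen_K i) v)"
proof -
  have "i \<in> {1..n}" "i + 1 \<in> {1..n}"
    using i by auto
  then have "star \<beta> i - star \<beta> (i + 1) = - (\<beta> i - \<beta> (i + 1))" for \<beta>
    unfolding star_def by simp
  then show "pairing s (gen_act n q (gen_K i) u) v = pairing s u (gen_act n q (gen_Kinv i) v)"
    "pairing s (gen_act n q (gen_Kinv i) u) v = pairing s u (gen_act n q (gen_K i) v)"
    unfolding pairing_def using B_D(1) B_D(1)[OF star_in_B[OF _ ss']]
    by (auto intro!: sum.cong simp: lookup_gen_act restrict_Zplus_def simp del: minus_diff_eq)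
qed

definition annihilator :: "nat \<Rightarrow> nat \<Rightarrow> ((nat \<Rightarrow> int) \<Rightarrow>\<^sub>0 'k) set \<Rightarrow> ((nat \<Rightarrow> int) \<Rightarrow>\<^sub>0 'k) set" where
  "annihilator s s' L = {u \<in> supported (B s'). \<forall>v\<in>L. pairing s u v = 0}"

text \<open>The adjoint of every generator is a scalar multiple of a generator, so the signs in the
  duality do no harm.\<close>

lemma stable_annihilator:
  assumes L: "stable n q L" "L \<subseteq> supported (B s)" and ss': "s + s' = n * (m * l - 1)"
  shows "stable n q (annihilator s s' L)"
proof (rule stableI)
  note sB = subspace_supported[of "B s'"]
  show "scale.subspace (annihilator s s' L)"
    using sB unfolding scale.subspace_def annihilator_def
    by (auto simp: pairing_add_left pairing_scale_left) (simp add: pairing_def)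
  show "move n q c d u \<in> annihilator s s' L" if "adjacent n c d" "u \<in> annihilator s s' L" for c d u
    using that stable_move[OF stable_supported_B that(1)] stable_move[OF L(1) that(1)] L(2)
      pairing_move[OF _ _ ss' that(1)] by (auto simp: annihilator_def subset_iff)
  show "gen_act n q (gen_K i) u \<in> annihilator s s' L" "gen_act n q (gen_Kinv i) u \<in> annihilator s s' L"
    if i: "i \<in> {1..n - 1}" and u: "u \<in> annihilator s s' L" for i u
  proof -
    have g: "gen_K i \<in> qgens n" "gen_Kinv i \<in> qgens n"
      using i by auto
    have "gen_act n q (gen_K i) u \<in> supported (B s')" "gen_act n q (gen_Kinv i) u \<in> supported (B s')"
      using g u stable_supported_B[of s'] by (auto simp: stable_def annihilator_def)
    moreover have "gen_act n q (gen_K i) v \<in> L" "gen_act n q (gen_Kinv i) v \<in> L" if "v \<in> L" for v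
      using g that L(1) by (auto simp: stable_def)
    ultimately show "gen_act n q (gen_K i) u \<in> annihilator s s' L" "gen_act n q (gen_Kinv i) u \<in> annihilator s s' L"
      using u L(2) pairing_K[OF _ _ ss' i] by (auto simp: annihilator_def subset_iff)
  qed
qed

lemma exists_separating_functional:
  fixes L :: "((nat \<Rightarrow> int) \<Rightarrow>\<^sub>0 'k) set"
  assumes "scale.subspace L" "x \<notin> L"
  obtains \<phi> where "Vector_Spaces.linear scale (*) \<phi>" "\<And>v. v \<in> L \<Longrightarrow> \<phi> v = (0 :: 'k)" "\<phi> x = 1"
proof -
  interpret vector_space_pair "scale :: 'k \<Rightarrow> ((nat \<Rightarrow> int) \<Rightarrow>\<^sub>0 'k) \<Rightarrow> _" "(*) :: 'k \<Rightarrow> 'k \<Rightarrow> 'k"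
    by unfold_locales (simp_all add: algebra_simps)
  obtain S where S: "S \<subseteq> L" "scale.independent S" "L \<subseteq> scale.span S"
    using scale.basis_exists[of L] by metis
  have span: "scale.span S = L"
    using S scale.span_minimal[OF S(1) assms(1)] by blast
  then have "scale.independent (insert x S)"
    using S(2) assms(2) scale.independent_insertI by metis
  then obtain \<phi> where \<phi>: "Vector_Spaces.linear scale (*) \<phi>" "\<forall>y\<in>insert x S. \<phi> y = (if y = x then 1 else 0)"
    using linear_independent_extend[of "insert x S" "\<lambda>y. if y = x then 1 else 0"] by blast
  have "\<phi> y = 0" if "y \<in> S" for y
    using \<phi>(2) S(1) assms(2) that by auto
  then have "\<phi> v = 0" if "v \<in> L" for v
    using linear_eq_0_on_span[OF \<phi>(1), of S v] that span by blast
  then show ?thesis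
    using that \<phi> by auto
qed

text \<open>Monomials of degrees \<open>s\<close> and \<open>s'\<close> are dual bases under
  \<open>star\<close>: the coefficient of \<open>u\<close> at \<open>\<gamma>\<close> has to be the
  value of \<open>\<phi>\<close> at the complementary monomial.\<close>

lemma linear_eq_pairing:
  fixes \<phi> :: "((nat \<Rightarrow> int) \<Rightarrow>\<^sub>0 'k) \<Rightarrow> 'k"
  assumes \<phi>: "Vector_Spaces.linear scale (*) \<phi>" and ss': "s + s' = n * (m * l - 1)"
  obtains u where "u \<in> supported (B s')" "\<And>v. v \<in> supported (B s) \<Longrightarrow> \<phi> v = pairing s u v"
proof -
  interpret phi: Vector_Spaces.linear scale "(*)" \<phi>
    by (rule \<phi>)
  define u where "u = Abs_poly_mapping (\<lambda>\<gamma>. if \<gamma> \<in> B s' then \<phi> (x_pow n (star \<gamma>)) else 0)"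
  have u: "Poly_Mapping.lookup u \<gamma> = (if \<gamma> \<in> B s' then \<phi> (x_pow n (star \<gamma>)) else 0)" for \<gamma>
    unfolding u_def by (subst lookup_Abs_poly_mapping) (auto intro: finite_subset[OF _ finite_B[of s']])
  show ?thesis
  proof
    show "u \<in> supported (B s')"
      by (simp add: in_supported u)
    fix v :: "(nat \<Rightarrow> int) \<Rightarrow>\<^sub>0 'k"
    assume v: "v \<in> supported (B s)"
    have "v = (\<Sum>\<beta>\<in>B s. scale (Poly_Mapping.lookup v \<beta>) (x_pow n \<beta>))"
    proof (rule poly_mapping_eqI)
      fix \<gamma>
      have "(\<Sum>\<beta>\<in>B s. Poly_Mapping.lookup v \<beta> * Poly_Mapping.lookup (x_pow n \<beta> :: _ \<Rightarrow>\<^sub>0 'k) \<gamma>) =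
          (\<Sum>\<beta>\<in>B s. if \<beta> = \<gamma> then Poly_Mapping.lookup v \<beta> else 0)"
        using B_D(1) by (intro sum.cong) (auto simp: lookup_x_pow)
      then show "Poly_Mapping.lookup v \<gamma> = Poly_Mapping.lookup (\<Sum>\<beta>\<in>B s. scale (Poly_Mapping.lookup v \<beta>) (x_pow n \<beta>)) \<gamma>"
        using v finite_B by (auto simp: lookup_sum in_supported)
    qed
    then have "\<phi> v = \<phi> (\<Sum>\<beta>\<in>B s. scale (Poly_Mapping.lookup v \<beta>) (x_pow n \<beta>))"
      by simp
    also have "\<dots> = (\<Sum>\<beta>\<in>B s. Poly_Mapping.lookup v \<beta> * \<phi> (x_pow n \<beta>))"
      by (simp add: phi.sum phi.scale)
    also have "\<dots> = pairing s u v"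
      unfolding pairing_def using star_in_B[OF _ ss'] by (intro sum.cong) (auto simp: u star_star)
    finally show "\<phi> v = pairing s u v" .
  qed
qed

section \<open>Maximal submodules and the radical of a filtration step\<close>

lemma submodule_V_iff: "submodule H U (uq_module n q (V s k)) \<longleftrightarrow> stable n q H \<and> H \<subseteq> V s k"
  using V_subset supported_B_subset by (intro submodule_uq_module_iff[OF stable_V]) blast

text \<open>If \<open>L\<close> missed part of \<open>V s (k - 1)\<close>, a functional vanishing on
  \<open>L\<close> but not there would be a vector above layer \<open>K\<close> in the dual. Descent
  inside the annihilator of \<open>L\<close> leads to leading layer exactly \<open>K\<close>; such a
  vector kills \<open>V s (k - 1)\<close> too, hence \<open>L + V s (k - 1) = V s k\<close>, yet it
  detects a monomial of layer \<open>k\<close>.\<close>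

lemma maximal_contains_V:
  assumes ss': "s + s' = n * (m * l - 1)" and \<delta>: "\<delta> \<in> B s" "E \<delta> = k"
    and L: "maximal_submodule L U (uq_module n q (V s k))"
  shows "V s (k - 1) \<subseteq> L"
proof (rule ccontr)
  have L': "stable n q L" "L \<subseteq> V s k" "L \<noteq> V s k"
    and max: "\<And>H. stable n q H \<Longrightarrow> H \<subseteq> V s k \<Longrightarrow> L \<subseteq> H \<Longrightarrow> H = L \<or> H = V s k"
    using L unfolding maximal_submodule_def submodule_V_iff by auto
  have L_B: "L \<subseteq> supported (B s)"
    using L'(2) V_subset by blast
  assume "\<not> V s (k - 1) \<subseteq> L"
  then obtain x where x: "x \<in> V s (k - 1)" "x \<notin> L"
    by blast
  obtain \<phi> where \<phi>: "Vector_Spaces.linear scale (*) \<phi>" "\<And>v. v \<in> L \<Longrightarrow> \<phi> v = 0" "\<phi> x = 1"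
    using exists_separating_functional[OF subspace_if_stable[OF L'(1)] x(2)] by blast
  obtain u where u: "u \<in> supported (B s')" "\<And>v. v \<in> supported (B s) \<Longrightarrow> \<phi> v = pairing s u v"
    using linear_eq_pairing[OF \<phi>(1) ss'] by blast
  have u_ann: "u \<in> annihilator s s' L"
    unfolding annihilator_def using u \<phi>(2) L_B by force
  \<comment> \<open>The energy of the complements of layer \<open>k\<close>. Paired exponents have
    energies adding up to \<open>n (m - 1)\<close>, so \<open>V s' K\<close> is orthogonal to
    \<open>V s (k - 1)\<close>.\<close>
  define K where "K = int n * (int m - 1) - k"
  have low: "pairing s u' v = 0" if "u' \<in> V s' K" "v \<in> V s (k - 1)" for u' v
    unfolding pairing_def
  proof (rule sum.neutral, rule ballI, rule ccontr)
    fix \<beta>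
    assume "Poly_Mapping.lookup u' (star \<beta>) * Poly_Mapping.lookup v \<beta> \<noteq> 0"
    then have "E (star \<beta>) \<le> K" "E \<beta> \<le> k - 1"
      using that by (auto simp: V_iff)
    then show False
      by (simp add: E_star K_def)
  qed
  have "pairing s u x = 1"
    using u(2)[of x] x(1) \<phi>(3) V_subset by auto
  then have "u \<notin> V s' K"
    using low x(1) by force
  moreover have "u \<in> V s' (E_max n l m s')"
    using u(1) V_Emax by blast
  ultimately obtain j where j: "j > K" "u \<in> V s' j" "u \<notin> V s' (j - 1)"
    using exists_layer by metis
  have "star \<delta> \<in> B s'" "E (star \<delta>) \<le> K"
    using star_in_B[OF \<delta>(1) ss'] \<delta>(2) by (auto simp: E_star K_def)
  \<comment> \<open>Unlike \<open>u\<close>, the vector \<open>w\<close> no longer sees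
    \<open>x\<close>; what matters now is that it is low enough to be orthogonal to
    \<open>V s (k - 1)\<close> and still kills \<open>L\<close>.\<close>
  then obtain w where w: "w \<in> annihilator s s' L" "w \<in> V s' K" "w \<notin> V s' (K - 1)"
    using descent_le[OF stable_annihilator[OF L'(1) L_B ss'] u_ann j(2,3)] j(1) by (metis less_imp_le)
  define S where "S = {y + z |y z. y \<in> L \<and> z \<in> V s (k - 1)}"
  have "stable n q S"
    unfolding stable_def
  proof (intro conjI ballI)
    show "scale.subspace S"
      unfolding S_def by (intro scale.subspace_sums subspace_if_stable L'(1) stable_V)
    fix g v
    assume "g \<in> qgens n" "v \<in> S"
    then obtain y z where yz: "y \<in> L" "z \<in> V s (k - 1)" "v = y + z"
      by (auto simp: S_def)
    then have "gen_act n q g y \<in> L" "gen_act n q g z \<in> V s (k - 1)"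
      using \<open>g \<in> qgens n\<close> L'(1) stable_V[of s "k - 1"] by (auto simp: stable_def)
    then show "gen_act n q g v \<in> S"
      unfolding S_def yz(3) gen_act_add by blast
  qed
  moreover have "S \<subseteq> V s k"
    using L'(2) V_mono[of "k - 1" k s] scale.subspace_add[OF subspace_if_stable[OF stable_V[of s k]]]
    by (auto simp: S_def)
  moreover have zero: "0 \<in> L" "0 \<in> V s (k - 1)"
    using scale.subspace_0 subspace_if_stable L'(1) stable_V by blast+
  have "y \<in> S" if "y \<in> L" for y
    unfolding S_def using that zero(2) by force
  then have "L \<subseteq> S"
    by blast
  moreover have "x \<in> S"
    unfolding S_def using x(1) zero(1) by force
  ultimately have S: "S = V s k"
    using max[of S] x(2) by blast
  have kill: "pairing s w v = 0" if "v \<in> V s k" for v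
    using that w(1) low[OF w(2)] unfolding S[symmetric] by (auto simp: S_def pairing_add_right annihilator_def)
  obtain \<gamma> where \<gamma>: "Poly_Mapping.lookup w \<gamma> \<noteq> 0" "\<gamma> \<in> B s'" "E \<gamma> = K"
    using not_in_V_diff[OF w(2,3)] by metis
  have s's: "s' + s = n * (m * l - 1)"
    using ss' by simp
  have sB: "star \<gamma> \<in> B s"
    using star_in_B[OF \<gamma>(2) s's] .
  have "x_pow n (star \<gamma>) \<in> V s k"
    unfolding V_def using sB \<gamma>(3) by (intro x_pow_in_supported) (simp add: E_star K_def)
  then have "pairing s w (x_pow n (star \<gamma>)) = 0"
    by (rule kill)
  moreover have "pairing s w (x_pow n (star \<gamma>)) = (\<Sum>\<beta>\<in>B s. if \<beta> = star \<gamma> then Poly_Mapping.lookup w (star \<beta>) else 0)"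
    unfolding pairing_def using B_D(1)[OF sB] by (intro sum.cong) (auto simp: lookup_x_pow)
  then have "pairing s w (x_pow n (star \<gamma>)) = Poly_Mapping.lookup w \<gamma>"
    using sB finite_B star_star[OF \<gamma>(2)] by simp
  ultimately show False
    using \<gamma>(1) by simp
qed

lemma supported_split:
  fixes v :: "(nat \<Rightarrow> int) \<Rightarrow>\<^sub>0 'k"
  assumes "v \<in> supported (S \<union> S')"
  obtains u w where "u \<in> supported S" "w \<in> supported S'" "v = u + w"
proof -
  define u where "u = Abs_poly_mapping (\<lambda>\<gamma>. if \<gamma> \<in> S then Poly_Mapping.lookup v \<gamma> else 0)"
  have u: "Poly_Mapping.lookup u \<gamma> = (if \<gamma> \<in> S then Poly_Mapping.lookup v \<gamma> else 0)" for \<gamma>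
    unfolding u_def by (subst lookup_Abs_poly_mapping) (auto intro: finite_subset[OF _ finite_keys[of v]] simp: in_keys_iff)
  show ?thesis
  proof
    show "u \<in> supported S"
      by (simp add: in_supported u)
    show "v - u \<in> supported S'"
      using assms by (auto simp: in_supported u lookup_minus)
  qed simp
qed

text \<open>The quotient by \<open>L\<close> is the simple piece with the quotients of
  \<open>\<gamma>\<close>. Modulo \<open>L\<close>, an element of a larger submodule can be taken in
  that piece and above \<open>V s (k - 1)\<close>, so the whole piece follows.\<close>

lemma maximal_submodule_omit:
  assumes \<gamma>: "\<gamma> \<in> B s" "E \<gamma> = k"
  defines "L \<equiv> supported {\<beta> \<in> B s. E \<beta> < k \<or> E \<beta> = k \<and> (\<lambda>i. \<beta> i div int l) \<noteq> (\<lambda>i. \<gamma> i div int l)}"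
  shows "maximal_submodule L U (uq_module n q (V s k))"
  unfolding maximal_submodule_def submodule_V_iff
proof (intro conjI allI impI)
  show stab: "stable n q L"
    unfolding L_def by (rule stable_layer_pieces)
  show "L \<subseteq> V s k"
    unfolding L_def V_def by (rule supported_mono) auto
  have "x_pow n \<gamma> \<in> V s k"
    unfolding V_def using \<gamma> by (intro x_pow_in_supported) auto
  moreover have "x_pow n \<gamma> \<notin> L"
    unfolding L_def using \<gamma> B_D(1)[OF \<gamma>(1)] by (auto simp: in_supported lookup_x_pow intro!: exI[of _ \<gamma>])
  ultimately show "L \<noteq> carrier (uq_module n q (V s k))"
    by auto
  fix H
  assume "stable n q H \<and> H \<subseteq> V s k" and LH: "L \<subseteq> H"
  then have H: "stable n q H" "H \<subseteq> V s k"
    by auto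
  define a where "a = (\<lambda>i. \<gamma> i div int l)"
  have V_k: "{\<beta> \<in> B s. E \<beta> \<le> k} = {\<beta> \<in> B s. E \<beta> < k \<or> E \<beta> = k \<and> (\<lambda>i. \<beta> i div int l) = a} \<union>
      {\<beta> \<in> B s. E \<beta> < k \<or> E \<beta> = k \<and> (\<lambda>i. \<beta> i div int l) \<noteq> a}"
    by auto
  have split: "\<exists>x y. v = x + y \<and> x \<in> T s k a \<and> y \<in> L" if "v \<in> V s k" for v
  proof -
    have "v \<in> supported ({\<beta> \<in> B s. E \<beta> < k \<or> E \<beta> = k \<and> (\<lambda>i. \<beta> i div int l) = a} \<union>
        {\<beta> \<in> B s. E \<beta> < k \<or> E \<beta> = k \<and> (\<lambda>i. \<beta> i div int l) \<noteq> a})"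
      using that unfolding V_def V_k .
    then obtain x y where "x \<in> T s k a" "y \<in> L" "v = x + y"
      unfolding T_def L_def a_def by (rule supported_split)
    then show ?thesis
      by blast
  qed
  have low: "V s (k - 1) \<subseteq> L"
    unfolding L_def V_def by (rule supported_mono) auto
  show "H = L \<or> H = carrier (uq_module n q (V s k))"
  proof (cases "H \<subseteq> L")
    case False
    then obtain v where v: "v \<in> H" "v \<notin> L"
      by blast
    then obtain x y where xy: "v = x + y" "x \<in> T s k a" "y \<in> L"
      using split H(2) by blast
    have "v - y \<in> H"
      using v(1) xy(3) LH scale.subspace_diff[OF subspace_if_stable[OF H(1)]] by blast
    then have "x \<in> H"
      using xy(1) by simp
    moreover have "x \<notin> V s (k - 1)"
    proof
      assume "x \<in> V s (k - 1)"
      then have "x + y \<in> L"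
        using low xy(3) scale.subspace_add[OF subspace_if_stable[OF stab]] by blast
      then show False
        using v(2) xy(1) by simp
    qed
    moreover have "V s (k - 1) \<subseteq> H"
      using low LH by blast
    ultimately have "T s k a \<subseteq> H"
      using T_subset_if_meets[OF H(1) _ _ xy(2)] by blast
    then have "V s k \<subseteq> H"
      using split LH scale.subspace_add[OF subspace_if_stable[OF H(1)]] by blast
    then show ?thesis
      using H(2) by simp
  qed (use LH in blast)
qed

text \<open>One inclusion is the bound on all maximal submodules. For the other, a monomial of layer
  \<open>k\<close> in the support is excluded by the maximal submodule that omits its
  quotients.\<close>

lemma Rad_V:
  assumes ss': "s + s' = n * (m * l - 1)" and \<delta>: "\<delta> \<in> B s" "E \<delta> = k"
  shows "Rad U (uq_module n q (V s k)) = V s (k - 1)"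
proof (intro equalityI subsetI)
  fix x
  assume x: "x \<in> V s (k - 1)"
  then have "x \<in> V s k"
    using V_mono[of "k - 1" k s] by auto
  then show "x \<in> Rad U (uq_module n q (V s k))"
    using maximal_contains_V[OF ss' \<delta>] x by (auto simp: Rad_def)
next
  fix x
  assume x: "x \<in> Rad U (uq_module n q (V s k))"
  then have xV: "x \<in> V s k"
    by (simp add: Rad_def)
  show "x \<in> V s (k - 1)"
  proof (rule ccontr)
    assume "x \<notin> V s (k - 1)"
    then obtain \<gamma> where \<gamma>: "Poly_Mapping.lookup x \<gamma> \<noteq> 0" "\<gamma> \<in> B s" "E \<gamma> = k"
      using not_in_V_diff[OF xV] by metis
    have "x \<in> supported {\<beta> \<in> B s. E \<beta> < k \<or> E \<beta> = k \<and> (\<lambda>i. \<beta> i div int l) \<noteq> (\<lambda>i. \<gamma> i div int l)}"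
      using x maximal_submodule_omit[OF \<gamma>(2,3)] unfolding Rad_def by blast
    then show False
      using \<gamma> unfolding in_supported by blast
  qed
qed

text \<open>Energy degrees have no gaps: descent from a monomial of maximal energy passes through
  every layer above the minimum.\<close>

lemma exists_in_layer:
  assumes "B s \<noteq> {}" "E_min n l m s \<le> k" "k \<le> E_max n l m s"
  obtains \<gamma> where "\<gamma> \<in> B s" "E \<gamma> = k"
proof -
  have "E_max n l m s \<in> E ` B s" "E_min n l m s \<in> E ` B s"
    unfolding E_max_def E_min_def using assms(1) finite_B by (auto intro!: Max_in Min_in)
  then obtain \<beta> \<delta> where \<beta>: "\<beta> \<in> B s" "E \<beta> = E_max n l m s" and \<delta>: "\<delta> \<in> B s" "E \<delta> = E_min n l m s"
    by auto
  have x: "x_pow n \<beta> \<in> V s (E_max n l m s)"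
    unfolding V_def using \<beta> by (intro x_pow_in_supported) auto
  have x': "x_pow n \<beta> \<notin> V s (E_max n l m s - 1)"
    using \<beta> B_D(1)[OF \<beta>(1)] by (auto simp: V_iff lookup_x_pow intro!: exI[of _ \<beta>])
  have x0: "x_pow n \<beta> \<in> supported (B s)"
    using \<beta> by (intro x_pow_in_supported)
  have \<delta>k: "E \<delta> \<le> k"
    using \<delta>(2) assms(2) by simp
  obtain w where "w \<in> V s k" "w \<notin> V s (k - 1)"
    using descent_le[OF stable_supported_B x0 x x' \<delta>(1) \<delta>k assms(3)] by metis
  then show ?thesis
    using not_in_V_diff[of w s k] that by metis
qed

text \<open>The bound on \<open>j\<close> keeps the layer removed at each step nonempty, as
  \<open>Rad_V\<close> demands; the last admissible \<open>j\<close> reaches the zero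
  module.\<close>

lemma Rad_pow_eq:
  assumes "s \<le> n * (m * l - 1)" "B s \<noteq> {}" "int j \<le> E_max n l m s - E_min n l m s + 1"
  shows "Rad_pow U (M s) j = V s (E_max n l m s - int j)"
  using assms(3)
proof (induction j)
  case 0
  show ?case
    by (simp add: V_Emax)
next
  case (Suc j)
  define k where "k = E_max n l m s - int j"
  have "E_min n l m s \<le> k" "k \<le> E_max n l m s"
    using Suc.prems by (auto simp: k_def)
  then obtain \<gamma> where \<gamma>: "\<gamma> \<in> B s" "E \<gamma> = k"
    using exists_in_layer[OF assms(2)] by blast
  have "Rad_pow U (M s) j = V s k"
    using Suc by (simp add: k_def)
  then have "Rad_pow U (M s) (Suc j) = Rad U (uq_module n q (V s k))"
    by simp
  also have "\<dots> = V s (k - 1)"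
    using Rad_V[of s "n * (m * l - 1) - s", OF _ \<gamma>] assms(1) by simp
  finally show ?case
    by (simp add: k_def algebra_simps)
qed

lemma Zplus_trunc_nonempty:
  assumes "s \<le> n * (m * l - 1)"
  shows "B s \<noteq> {}"
proof -
  have ml: "m * l \<ge> 1"
    using m_ge l_ge by simp
  have "int s \<le> (\<Sum>i=1..n. int m * int l - 1)"
    using zle_int[THEN iffD2, OF assms] ml by (simp add: of_nat_diff)
  moreover have "int m * int l - 1 \<ge> 0"
    using ml by (simp flip: of_nat_mult)
  ultimately obtain b where "\<forall>i\<in>{1..n}. 0 \<le> b i \<and> b i \<le> int m * int l - 1"
    "\<forall>i. i \<notin> {1..n} \<longrightarrow> b i = 0" "sum b {1..n} = int s"
    using exists_bounded_sum[of "{1..n}" "\<lambda>_. int m * int l - 1" "int s"] by auto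
  then have "b \<in> B s"
    by (auto simp: Zplus_trunc_def Zplus_def)
  then show ?thesis
    by blast
qed

lemma has_Loewy_length_and_rigid:
  assumes "s \<le> n * (m * l - 1)"
  shows "has_Loewy_length U (M s) (nat (E_max n l m s - E_min n l m s + 1))" "rigid U (M s)"
proof -
  have ne: "B s \<noteq> {}"
    by (rule Zplus_trunc_nonempty[OF assms])
  define r where "r = nat (E_max n l m s - E_min n l m s + 1)"
  obtain \<gamma> where "\<gamma> \<in> B s"
    using ne by blast
  then have le: "E_min n l m s \<le> E_max n l m s"
    using Emin_le[of \<gamma> s] Emax_ge[of \<gamma> s] by linarith
  then have r: "int r = E_max n l m s - E_min n l m s + 1"
    by (simp add: r_def)
  have rad: "Rad_pow U (M s) j = V s (E_max n l m s - int j)" if "j \<le> r" for j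
    using that r by (intro Rad_pow_eq[OF assms ne]) linarith
  have soc: "Soc_pow U (M s) j = V s (E_min n l m s - 1 + int j)" for j
    by (rule Soc_pow_eq[OF ne])
  obtain \<beta> where \<beta>: "\<beta> \<in> B s" "E \<beta> = E_max n l m s"
    using exists_in_layer[OF ne le] by blast
  obtain \<delta> where \<delta>: "\<delta> \<in> B s" "E \<delta> = E_min n l m s"
    using exists_in_layer[OF ne order_refl le] by blast
  have "V s k \<noteq> supported (B s)" if "k < E_max n l m s" for k
  proof -
    have "x_pow n \<beta> \<in> supported (B s)"
      using \<beta> by (intro x_pow_in_supported)
    moreover have "x_pow n \<beta> \<notin> V s k"
      using \<beta> B_D(1)[OF \<beta>(1)] that by (auto simp: V_iff lookup_x_pow intro!: exI[of _ \<beta>])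
    ultimately show ?thesis
      by blast
  qed
  moreover have "V s k \<noteq> {0}" if "k \<ge> E_min n l m s" for k
  proof -
    have "x_pow n \<delta> \<in> V s k"
      unfolding V_def using \<delta> that by (intro x_pow_in_supported) auto
    moreover have "Poly_Mapping.lookup (x_pow n \<delta> :: _ \<Rightarrow>\<^sub>0 'k) \<delta> = 1"
      using B_D(1)[OF \<delta>(1)] by (simp add: lookup_x_pow)
    then have "x_pow n \<delta> \<noteq> (0 :: (nat \<Rightarrow> int) \<Rightarrow>\<^sub>0 'k)"
      by force
    ultimately show ?thesis
      by blast
  qed
  ultimately have "has_Loewy_length U (M s) r"
    unfolding has_Loewy_length_def using r rad soc V_Emax[of s] V_Emin[of _ s] by auto
  then show "has_Loewy_length U (M s) (nat (E_max n l m s - E_min n l m s + 1))"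
    by (simp add: r_def)
  have "Rad_pow U (M s) (r - j) = Soc_pow U (M s) j" if "j \<le> r" for j
  proof -
    \<comment> \<open>Both filtrations use the same subspaces; the indices match because
      \<open>r\<close> is the number of layers.\<close>
    have "E_max n l m s - int (r - j) = E_min n l m s - 1 + int j"
      using that r by (simp add: of_nat_diff)
    then show ?thesis
      using rad[of "r - j"] soc[of j] by simp
  qed
  then show "rigid U (M s)"
    unfolding rigid_def using \<open>has_Loewy_length U (M s) r\<close> by blast
qed

end

theorem theorem3p12:
  fixes q :: "'k :: {alg_closed_field, field_char_0}" and n l m s :: nat
  assumes "q \<noteq> 0" "q \<noteq> 1" "q \<noteq> - 1"
    and "n \<ge> 3" and "qchar q = l" and "l \<ge> 3" and "m \<ge> 1"
    and "s \<le> n * (m * l - 1)"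
  shows "left_module (small_uq n q l) (Aq_trunc n q l m s) \<and>
         rigid (small_uq n q l) (Aq_trunc n q l m s) \<and>
         has_Loewy_length (small_uq n q l) (Aq_trunc n q l m s)
           (nat (E_max n l m s - E_min n l m s + 1))"
proof -
  \<comment> \<open>This is the denominator of the quantum integers; it vanishes only for
    \<open>q = 1\<close> and \<open>q = -1\<close>.\<close>
  have diff: "q - inverse q \<noteq> 0"
  proof
    assume "q - inverse q = 0"
    then have "q * q = 1"
      using assms(1) by (metis eq_iff_diff_eq_0 right_inverse)
    then show False
      using assms(2,3) by (metis square_eq_1_iff)
  qed
  interpret energy q l n m
    using assms(1,4,6,7) diff powi_two_eq_1_iff_qchar_dvd[OF assms(1) diff assms(5)]
    by unfold_locales auto
  show ?thesis
    unfolding Aq_trunc_eq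
    using left_module_M has_Loewy_length_and_rigid[OF assms(8)] by blast
qed

end
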